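(* Let $1<p<\infty$ and $F\in H^p(\Omega_-)$. Then $F(w)$ has a non-tangential boundary limit $F(\zeta)\in L^p(\Gamma,|\mathrm{d}\zeta|)$ a.e. on $\Gamma$, with $\lVert F\rVert_{L^p(\Gamma,|\mathrm{d}\zeta|)}\leqslant\lVert F\rVert_{H^p(\Omega_-)}$, and $$\frac1{2\pi\mathrm{i}}\int_\Gamma\frac{F(\zeta)}{\zeta-w}\,\mathrm{d}\zeta=\begin{cases}0&\text{if } w\in\Omega_+,\\ -F(w)&\text{if } w\in\Omega_-.\end{cases}$$ Moreover $\lVert F_{\sigma+\tau,-\tau}-\chi_\Gamma F\rVert_{L^p(\gamma,|\mathrm{d}\zeta|)}\to0$ as $\tau>0$ and $\tau\to0$.
   Context: Fix $\sigma>0$. For $s>0$, $t\in\mathbb{R}$ let $D_{s,t}=\{u+\mathrm{i}v: |u|<s,\ v>t\}$ and let $\Gamma_{s,t}=\partial D_{s,t}=\Gamma_{s,t,1}\cup\Gamma_{s,t,2}\cup\Gamma_{s,t,3}$ with $\Gamma_{s,t,1}=\{-s+\mathrm{i}v: v>t\}$, $\Gamma_{s,t,2}=\{u+\mathrm{i}t: |u|\leqslant s\}$, $\Gamma_{s,t,3}=\{s+\mathrm{i}v: v>t\}$, oriented so that $D_{s,t}$ lies on its left. Put $\Omega_+=D_{\sigma,0}$, $\Omega_-=\mathbb{C}\setminus\overline{D_{\sigma,0}}$, $\Gamma=\Gamma_{\sigma,0}$, $\Gamma_j=\Gamma_{\sigma,0,j}$. $H^p(\Omega_-)$ is the set of $F$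 analytic on $\Omega_-$ with $\lVert F\rVert_{H^p(\Omega_-)}=\sup_{s>\sigma,\,t<0}\big(\int_{\Gamma_{s,t}}|F(w)|^p|\mathrm{d}w|\big)^{1/p}<\infty$. Non-tangential limits: for $\alpha>0$ and $\zeta\in\Gamma\setminus\{\pm\sigma\}$ let $\Omega_{\alpha-}(\zeta)$ be $\zeta-\{x+\mathrm{i}y: x>0,|y|<\alpha x\}$ if $\zeta\in\Gamma_1$, $\zeta-\{x+\mathrm{i}y: y>0,|x|<\alpha y\}$ if $\zeta\in\Gamma_2\setminus\{\pm\sigma\}$, $\zeta-\{x+\mathrm{i}y: x<0,|y|<-\alpha x\}$ if $\zeta\in\Gamma_3$. $F$ on $\Omega_-$ has non-tangential boundary limit $F(\zeta_0)$ at $\zeta_0$ if for all $\alpha>0$, $F(w)\to F(\zeta_0)$ as $w\to\zeta_0$, $w\in\Omega_{\alpha-}(\zeta_0)\cap\Omega_-$. Transported functions: let $\gamma_1=\{\mathrm{Re}\,w=-\sigma\}$, $\gamma_2=\mathbb{R}$, $\gamma_3=\{\mathrm{Re}\,w=\sigma\}$, $\gamma=\gamma_1\cup\gamma_2\cup\gamma_3$; $\gamma_{s,t,1}=\gamma_1\cap\{\mathrm{Im}\,w>t\}$, $\gamma_{s,t,2}=\gamma_2\cap\{|\mathrm{Re}\,w|\leqslant s\}$, $\gamma_{s,t,3}=\gamma_3\cap\{\mathrm{Im}\,w>t\}$, $\gamma_{s,t}=\bigcup_j\gamma_{s,t,j}$. Define $P_{s,t}:\gamma_{s,t}\to\Gamma_{s,t}$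 (up to the null set $\{\pm\sigma\}$) by $P_{s,t}(\zeta)=\zeta+(\sigma-s)$ on $\gamma_{s,t,1}$, $\zeta+\mathrm{i}t$ on $\gamma_{s,t,2}$, $\zeta-(\sigma-s)$ on $\gamma_{s,t,3}$. For $G$ defined on $\Gamma_{s,t}$, $G_{s,t}(\zeta)=G(P_{s,t}(\zeta))$ for $\zeta\in\gamma_{s,t}$ and $G_{s,t}(\zeta)=0$ for $\zeta\in\gamma\setminus\gamma_{s,t}$. $\chi_\Gamma F$ denotes $F$ on $\Gamma\subset\gamma$ extended by $0$ to $\gamma$. *)

theory Defs
  imports "HOL-Analysis.Analysis"
begin

section \<open>The half-strips and their boundaries\<close>

definition half_strip :: "real \<Rightarrow> real \<Rightarrow> complex set" where
  "half_strip s t = {Complex u v | u v. \<bar>u\<bar> < s \<and> v > t}"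

definition Gamma1 :: "real \<Rightarrow> real \<Rightarrow> complex set" where
  "Gamma1 s t = {Complex (- s) v | v. v > t}"

definition Gamma2 :: "real \<Rightarrow> real \<Rightarrow> complex set" where
  "Gamma2 s t = {Complex u t | u. \<bar>u\<bar> \<le> s}"

definition Gamma3 :: "real \<Rightarrow> real \<Rightarrow> complex set" where
  "Gamma3 s t = {Complex s v | v. v > t}"

definition Gamma_bd :: "real \<Rightarrow> real \<Rightarrow> complex set" where
  "Gamma_bd s t = Gamma1 s t \<union> Gamma2 s t \<union> Gamma3 s t"

definition Omega_plus :: "real \<Rightarrow> complex set" where
  "Omega_plus \<sigma> = half_strip \<sigma> 0"

definition Omega_minus :: "real \<Rightarrow> complex set" where
  "Omega_minus \<sigma> = - closure (half_strip \<sigma> 0)"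

lemma frontier_half_strip:
  assumes "s > 0"
  shows "frontier (half_strip s t) = Gamma_bd s t"
proof -
  define C where "C = {w. Re w \<le> s} \<inter> {w. Re w \<ge> - s} \<inter> {w. Im w \<ge> t}"
  have D: "half_strip s t = {w. Re w < s} \<inter> {w. Re w > - s} \<inter> {w. Im w > t}"
  proof (rule set_eqI)
    fix w
    show "w \<in> half_strip s t \<longleftrightarrow> w \<in> {w. Re w < s} \<inter> {w. Re w > - s} \<inter> {w. Im w > t}"
      by (cases w) (auto simp: half_strip_def abs_less_iff)
  qed
  have opn: "open (half_strip s t)"
    unfolding D by (intro open_Int open_halfspace_Re_lt open_halfspace_Re_gt open_halfspace_Im_gt)
  have int: "interior C = half_strip s t"
    unfolding C_def D interior_Int
    using interior_halfspace_le[of "1::complex" s] interior_halfspace_ge[of "1::complex" "- s"]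
      interior_halfspace_ge[of "\<i>" t] by (simp add: inner_complex_def)
  have "convex C"
    unfolding C_def
    by (intro convex_Int convex_halfspace_Re_le convex_halfspace_Re_ge convex_halfspace_Im_ge)
  moreover have "Complex 0 (t + 1) \<in> interior C"
    unfolding int D using assms by simp
  ultimately have "closure (half_strip s t) = closure C"
    using convex_closure_interior[of C] int by auto
  also have "closed C"
    unfolding C_def
    by (intro closed_Int closed_halfspace_Re_le closed_halfspace_Re_ge closed_halfspace_Im_ge)
  then have "closure C = C" by simp
  finally have "frontier (half_strip s t) = C - half_strip s t"
    using opn by (simp add: frontier_def interior_open)
  also have "\<dots> = Gamma_bd s t"
  proof (rule set_eqI)
    fix w
    show "w \<in> C - half_strip s t \<longleftrightarrow> w \<in> Gamma_bd s t"
      unfolding C_def D Gamma_bd_def Gamma1_def Gamma2_def Gamma3_def using assms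
      by (cases w) auto
  qed
  finally show ?thesis .
qed

section \<open>Arc length\<close>

text \<open>
  Arc length on the union of the three full lines \<open>Re w = -s\<close>, \<open>Im w = t\<close>, \<open>Re w = s\<close>
  (for \<open>s > 0\<close>), as a measure on the Borel sets of the plane.
\<close>
definition lines_measure :: "real \<Rightarrow> real \<Rightarrow> complex measure" where
  "lines_measure s t = measure_of UNIV (sets borel)
     (\<lambda>A. emeasure lborel {v. Complex (- s) v \<in> A}
        + emeasure lborel {u. Complex u t \<in> A}
        + emeasure lborel {v. Complex s v \<in> A})"

lemma space_lines_measure [simp]: "space (lines_measure s t) = UNIV"
  by (simp add: lines_measure_def)

lemma sets_lines_measure [simp, measurable_cong]: "sets (lines_measure s t) = sets borel"
  using sets.sigma_sets_eq[of "borel :: complex measure"] by (simp add: lines_measure_def)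

lemma emeasure_lines_measure:
  assumes "A \<in> sets borel"
  shows "emeasure (lines_measure s t) A =
    emeasure lborel {v. Complex (- s) v \<in> A} + emeasure lborel {u. Complex u t \<in> A}
      + emeasure lborel {v. Complex s v \<in> A}"
proof (rule emeasure_measure_of[OF lines_measure_def])
  have [measurable]: "(\<lambda>v. Complex a v) \<in> borel_measurable borel"
    "(\<lambda>u. Complex u a) \<in> borel_measurable borel" for a
    unfolding Complex_eq by measurable
  have eq: "emeasure lborel {v. Complex a v \<in> A} = emeasure (distr lborel borel (\<lambda>v. Complex a v)) A"
    "emeasure lborel {u. Complex u a \<in> A} = emeasure (distr lborel borel (\<lambda>u. Complex u a)) A"
    if "A \<in> sets borel" for A a
    using that by (simp_all add: emeasure_distr vimage_def)
  show "positive (sets (lines_measure s t))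
     (\<lambda>A. emeasure lborel {v. Complex (- s) v \<in> A} + emeasure lborel {u. Complex u t \<in> A}
        + emeasure lborel {v. Complex s v \<in> A})"
    by (simp add: positive_def)
  show "countably_additive (sets (lines_measure s t))
     (\<lambda>A. emeasure lborel {v. Complex (- s) v \<in> A} + emeasure lborel {u. Complex u t \<in> A}
        + emeasure lborel {v. Complex s v \<in> A})"
  proof (rule countably_additiveI)
    fix A :: "nat \<Rightarrow> complex set"
    assume A: "range A \<subseteq> sets (lines_measure s t)" "disjoint_family A"
    then have A': "A i \<in> sets borel" "range A \<subseteq> sets borel" for i by auto
    then have U: "(\<Union>i. A i) \<in> sets borel" by auto
    have distr_sums: "(\<Sum>i. emeasure (distr lborel borel f) (A i)) =
        emeasure (distr lborel borel f) (\<Union>i. A i)" for f :: "real \<Rightarrow> complex"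
      using A(2) A'(2) by (intro suminf_emeasure) simp_all
    show "(\<Sum>i. emeasure lborel {v. Complex (- s) v \<in> A i} + emeasure lborel {u. Complex u t \<in> A i}
        + emeasure lborel {v. Complex s v \<in> A i}) =
      emeasure lborel {v. Complex (- s) v \<in> (\<Union>i. A i)} + emeasure lborel {u. Complex u t \<in> (\<Union>i. A i)}
        + emeasure lborel {v. Complex s v \<in> (\<Union>i. A i)}"
      unfolding eq[OF U] eq[OF A'(1)]
      unfolding distr_sums[symmetric]
      by (subst suminf_add[symmetric]; (intro summableI)?)+ (rule refl)
  qed
qed (simp_all add: assms)

definition arc_measure :: "real \<Rightarrow> real \<Rightarrow> complex measure" where
  "arc_measure s t = restrict_space (lines_measure s t) (Gamma_bd s t)"

definition gamma_measure :: "real \<Rightarrow> complex measure" where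
  "gamma_measure \<sigma> = lines_measure \<sigma> 0"

text \<open>
  The unit tangent of \<open>Gamma_bd s t\<close>, oriented so that the half-strip lies on the left:
  downwards on the left ray, to the right on the segment, upwards on the right ray.
  Thus \<open>dw\<close> is \<open>tangent s t w\<close> times arc length.
\<close>
definition tangent :: "real \<Rightarrow> real \<Rightarrow> complex \<Rightarrow> complex" where
  "tangent s t w = (if w \<in> Gamma1 s t then - \<i> else if w \<in> Gamma3 s t then \<i> else 1)"

definition arc_integrable :: "real \<Rightarrow> real \<Rightarrow> (complex \<Rightarrow> complex) \<Rightarrow> bool" where
  "arc_integrable s t f \<longleftrightarrow> integrable (arc_measure s t) (\<lambda>w. f w * tangent s t w)"

definition arc_integral :: "real \<Rightarrow> real \<Rightarrow> (complex \<Rightarrow> complex) \<Rightarrow> complex" where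
  "arc_integral s t f = (\<integral>w. f w * tangent s t w \<partial>arc_measure s t)"

section \<open>Lebesgue and Hardy spaces\<close>

definition Lp_norm :: "real \<Rightarrow> 'a measure \<Rightarrow> ('a \<Rightarrow> complex) \<Rightarrow> ennreal" where
  "Lp_norm p M f =
     (let I = (\<integral>\<^sup>+x. ennreal (norm (f x) powr p) \<partial>M)
      in if I = \<infinity> then \<infinity> else ennreal (enn2real I powr (1 / p)))"

definition Lp_space :: "real \<Rightarrow> 'a measure \<Rightarrow> ('a \<Rightarrow> complex) set" where
  "Lp_space p M = {f \<in> borel_measurable M. Lp_norm p M f < \<infinity>}"

definition Hp_norm :: "real \<Rightarrow> real \<Rightarrow> (complex \<Rightarrow> complex) \<Rightarrow> ennreal" where
  "Hp_norm \<sigma> p F = (SUP (s, t) \<in> {\<sigma><..} \<times> {..<0}. Lp_norm p (arc_measure s t) F)"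

definition Hp_space :: "real \<Rightarrow> real \<Rightarrow> (complex \<Rightarrow> complex) set" where
  "Hp_space \<sigma> p = {F. F analytic_on Omega_minus \<sigma> \<and> Hp_norm \<sigma> p F < \<infinity>}"

section \<open>Non-tangential limits\<close>

definition nt_region :: "real \<Rightarrow> real \<Rightarrow> complex \<Rightarrow> complex set" where
  "nt_region \<sigma> \<alpha> \<zeta> =
    (if \<zeta> \<in> Gamma1 \<sigma> 0 then {\<zeta> - Complex x y | x y. x > 0 \<and> \<bar>y\<bar> < \<alpha> * x}
     else if \<zeta> \<in> Gamma3 \<sigma> 0 then {\<zeta> - Complex x y | x y. x < 0 \<and> \<bar>y\<bar> < - \<alpha> * x}
     else {\<zeta> - Complex x y | x y. y > 0 \<and> \<bar>x\<bar> < \<alpha> * y})"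

definition has_nt_limit :: "real \<Rightarrow> (complex \<Rightarrow> complex) \<Rightarrow> complex \<Rightarrow> complex \<Rightarrow> bool" where
  "has_nt_limit \<sigma> F \<zeta> L \<longleftrightarrow>
     \<zeta> \<in> Gamma_bd \<sigma> 0 - {complex_of_real \<sigma>, - complex_of_real \<sigma>} \<and>
     (\<forall>\<alpha>>0. (F \<longlongrightarrow> L) (at \<zeta> within (nt_region \<sigma> \<alpha> \<zeta> \<inter> Omega_minus \<sigma>)))"

section \<open>Transport to the fixed lines\<close>

definition gamma1 :: "real \<Rightarrow> real \<Rightarrow> complex set" where
  "gamma1 \<sigma> t = {w. Re w = - \<sigma> \<and> Im w > t}"

definition gamma2 :: "real \<Rightarrow> complex set" where
  "gamma2 s = {w. Im w = 0 \<and> \<bar>Re w\<bar> \<le> s}"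

definition gamma3 :: "real \<Rightarrow> real \<Rightarrow> complex set" where
  "gamma3 \<sigma> t = {w. Re w = \<sigma> \<and> Im w > t}"

text \<open>
  The three pieces overlap at most in the null set of the two points \<open>\<sigma>\<close> and \<open>-\<sigma>\<close>, where the
  order of the cases is immaterial.
\<close>
definition shift_map :: "real \<Rightarrow> real \<Rightarrow> real \<Rightarrow> complex \<Rightarrow> complex" where
  "shift_map \<sigma> s t \<zeta> =
    (if \<zeta> \<in> gamma1 \<sigma> t then \<zeta> + of_real (\<sigma> - s)
     else if \<zeta> \<in> gamma3 \<sigma> t then \<zeta> - of_real (\<sigma> - s)
     else \<zeta> + \<i> * of_real t)"

definition transported :: "real \<Rightarrow> real \<Rightarrow> real \<Rightarrow> (complex \<Rightarrow> complex) \<Rightarrow> complex \<Rightarrow> complex" where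
  "transported \<sigma> s t G \<zeta> =
    (if \<zeta> \<in> gamma1 \<sigma> t \<union> gamma2 s \<union> gamma3 \<sigma> t then G (shift_map \<sigma> s t \<zeta>) else 0)"

definition extend_zero :: "complex set \<Rightarrow> (complex \<Rightarrow> complex) \<Rightarrow> complex \<Rightarrow> complex" where
  "extend_zero S F \<zeta> = (if \<zeta> \<in> S then F \<zeta> else 0)"

end

theory Submission
  imports Defs "HOL-Complex_Analysis.Complex_Analysis"
begin

text \<open>
The exterior of the half-strip is the union of the three half-planes \<open>Re w < -\<sigma>\<close>, \<open>Im w < 0\<close>
and \<open>Re w > \<sigma>\<close>. Letting \<open>s \<rightarrow> \<infinity>\<close> on the bottom side of \<open>\<Gamma>\<^sub>s\<^sub>,\<^sub>t\<close>, or \<open>t \<rightarrow> -\<infinity>\<close> on its vertical sides,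
shows that \<open>F\<close> has bounded \<open>L\<^sup>p\<close> means on every line parallel to the edge of each half-plane; so \<open>F\<close>
is a Hardy function on all three (lemma \<open>half_plane_Hp_halves\<close>), and the assertions about boundary
values concern a single function \<open>f\<close> on the upper half-plane, with slices \<open>f\<^sub>y(x) = f(x + iy)\<close>
bounded in \<open>L\<^sup>p\<close>.

The theory of such an \<open>f\<close> rests on uniform convexity and a maximal inequality. Averaging Cauchy's formula over squares gives
\<open>|f(z)| \<le> C (Im z)\<^bsup>-1/p\<^esup>\<close>, hence \<open>f\<close> is bounded on \<open>Im z \<ge> a > 0\<close> and reproduced there by the Poisson
kernel. By Jensen's inequality the \<open>L\<^sup>p\<close> norm of a slice does not increase with its height, and this
applies as well to \<open>f\<^sub>y - f\<^bsub>y+\<epsilon>\<^esub>\<close> and \<open>(f\<^sub>y + f\<^bsub>y+\<epsilon>\<^esub>)/2\<close>. The norms of the slices increase to a finite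
limit as \<open>y\<close> decreases to 0, and the midpoints have norms almost as large; uniform convexity of
\<open>|\<cdot>|\<^sup>p\<close> then forces \<open>f\<^sub>y - f\<^bsub>y+\<epsilon>\<^esub>\<close> to be small in \<open>L\<^sup>p\<close>, uniformly in \<open>y\<close> (lemma \<open>half_plane_Lp_Cauchy\<close>).
A weak-type inequality for the conical maximal function (lemma \<open>emeasure_large_set_le\<close>, from a
dyadic majorant of the Poisson kernel and Vitali's covering lemma), applied to \<open>f - f(\<cdot> + i\<epsilon>)\<close>, bounds
the set where \<open>f\<close> oscillates in cones, so \<open>f\<close> has non-tangential limits almost everywhere; Fatou's
lemma turns the Cauchy estimate into convergence in \<open>L\<^sup>p\<close>. This is \<open>half_plane_boundary_values\<close>.

For the Cauchy integral, the part of a large square outside the half-strip \<open>D\<^sub>s\<^sub>,\<^sub>t\<close>, with \<open>s > \<sigma>\<close> and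
\<open>t < 0\<close>, is cut into three rectangles in which \<open>F\<close> is holomorphic. The pointwise bound makes the
outer sides negligible, which gives the formula on \<open>\<Gamma>\<^sub>s\<^sub>,\<^sub>t\<close> (lemma \<open>Cauchy_integral_outer_lines\<close>). Along
\<open>s = \<sigma> + \<tau>\<close>, \<open>t = -\<tau>\<close> it passes to the limit \<open>\<tau> \<rightarrow> 0\<close>, because \<open>F\<close> converges in \<open>L\<^sup>p\<close> on each of the three
lines and the Cauchy kernels are dominated by a multiple of \<open>1/(1 + |v|)\<close>, which lies in the dual
\<open>L\<^sup>q\<close>. The norm bound is Fatou's lemma along \<open>\<Gamma>\<^sub>\<sigma>\<^sub>+\<^sub>\<tau>\<^sub>,\<^sub>-\<^sub>\<tau>\<close>, and the convergence of the transported
functions adds to the \<open>L\<^sup>p\<close> convergence on the lines only pieces of length \<open>\<tau>\<close>.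
\<close>

section \<open>Convexity of the power function\<close>

text \<open>
Integrated over an interval and optimized in \<open>c\<close>, this bounds the \<open>L\<^sup>1\<close> norm on the interval by the
\<open>L\<^sup>p\<close> norm, as Hoelder's inequality would.
\<close>
lemma le_add_powr:
  fixes p c h :: real
  assumes "1 < p" "c > 0" "h \<ge> 0"
  shows "h \<le> c + c powr (1 - p) * h powr p"
proof (cases "h \<le> c")
  case True
  then show ?thesis by (simp add: add_increasing2)
next
  case False
  with assms have h: "h > 0" "c < h" by auto
  have "h = h powr (1 - p) * h powr p"
    using h by (simp add: powr_add[symmetric])
  also have "\<dots> \<le> c powr (1 - p) * h powr p"
    using h assms by (intro mult_right_mono powr_mono2') auto
  finally show ?thesis using assms by linarith
qed

lemma powr_above_tangent_strict:
  fixes p m a :: real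
  assumes "1 < p" "m > 0" "a \<ge> 0" "a \<noteq> m"
  shows "m powr p + p * m powr (p - 1) * (a - m) < a powr p"
proof -
  have D: "((\<lambda>x. x powr p) has_real_derivative p * x powr (p - 1)) (at x)" if "x > 0" for x
    using that assms by (auto intro!: derivative_eq_intros)
  consider "a = 0" | "0 < a" "a < m" | "m < a" using assms by linarith
  then show ?thesis
  proof cases
    case 1
    have "m powr (p - 1) * m = m powr p" using powr_mult_base[of m "p - 1"] assms by (simp add: mult.commute)
    then have "m powr p + p * m powr (p - 1) * (a - m) = (1 - p) * m powr p"
      using 1 by (simp add: algebra_simps)
    also have "\<dots> < 0" using assms by (intro mult_neg_pos) auto
    finally show ?thesis using 1 by simp
  next
    case 2
    obtain z where z: "a < z" "z < m" "m powr p - a powr p = (m - a) * (p * z powr (p - 1))"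
      using MVT2[of a m "\<lambda>x. x powr p" "\<lambda>x. p * x powr (p - 1)"] 2 D by force
    have "z powr (p - 1) < m powr (p - 1)" using z 2 assms by (intro powr_less_mono2) auto
    then have "(m - a) * (p * z powr (p - 1)) < (m - a) * (p * m powr (p - 1))"
      using 2 assms by (intro mult_strict_left_mono) auto
    with z show ?thesis by (simp add: algebra_simps)
  next
    case 3
    obtain z where z: "m < z" "z < a" "a powr p - m powr p = (a - m) * (p * z powr (p - 1))"
      using MVT2[of m a "\<lambda>x. x powr p" "\<lambda>x. p * x powr (p - 1)"] 3 assms D by force
    have "m powr (p - 1) < z powr (p - 1)" using z 3 assms by (intro powr_less_mono2) auto
    then have "(a - m) * (p * m powr (p - 1)) < (a - m) * (p * z powr (p - 1))"
      using 3 assms by (intro mult_strict_left_mono) auto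
    with z show ?thesis by (simp add: algebra_simps)
  qed
qed

lemma powr_above_tangent:
  fixes p m a :: real
  assumes "1 < p" "m > 0" "a \<ge> 0"
  shows "m powr p + p * m powr (p - 1) * (a - m) \<le> a powr p"
  using powr_above_tangent_strict[OF assms] by (cases "a = m") auto

text \<open>
Integrate against \<open>k\<close> the tangent inequality for the power function at the mean of \<open>h\<close>; the linear
term integrates to 0.
\<close>
lemma Jensen_powr:
  fixes k h :: "'a \<Rightarrow> real"
  assumes p: "1 < p" and k: "\<And>x. k x \<ge> 0" "integrable M k" "(\<integral>x. k x \<partial>M) = 1"
    and h: "\<And>x. h x \<ge> 0" "integrable M (\<lambda>x. k x * h x)" "integrable M (\<lambda>x. k x * h x powr p)"
  shows "(\<integral>x. k x * h x \<partial>M) powr p \<le> (\<integral>x. k x * h x powr p \<partial>M)"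
proof -
  define m where "m = (\<integral>x. k x * h x \<partial>M)"
  have m0: "m \<ge> 0" unfolding m_def using k h by (intro integral_nonneg_AE) auto
  show ?thesis
  proof (cases "m = 0")
    case True
    then show ?thesis using k h p
      by (fold m_def) (auto intro!: integral_nonneg_AE)
  next
    case False
    with m0 have m: "m > 0" by auto
    let ?c = "p * m powr (p - 1)"
    have int: "integrable M (\<lambda>x. (m powr p - ?c * m) * k x + ?c * (k x * h x))"
      by (intro Bochner_Integration.integrable_add integrable_mult_right k h)
    have "m powr p = (\<integral>x. (m powr p - ?c * m) * k x + ?c * (k x * h x) \<partial>M)"
      using k h by (simp add: m_def[symmetric])
    also have "\<dots> \<le> (\<integral>x. k x * h x powr p \<partial>M)"
    proof (rule integral_mono[OF int h(3)])
      fix x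
      have "k x * (m powr p + ?c * (h x - m)) \<le> k x * h x powr p"
        by (intro mult_left_mono powr_above_tangent p m h k)
      then show "(m powr p - ?c * m) * k x + ?c * (k x * h x) \<le> k x * h x powr p"
        by (simp add: algebra_simps)
    qed
    finally show ?thesis by (simp add: m_def)
  qed
qed

text \<open>
If the moduli differ, the power function is strictly convex between them; if they agree, the triangle
inequality for \<open>a + b\<close> is strict.
\<close>
lemma midpoint_powr_less:
  fixes a b :: complex and p :: real
  assumes "1 < p" "a \<noteq> b"
  shows "norm ((a + b) / 2) powr p < (norm a powr p + norm b powr p) / 2"
proof -
  define m where "m = (norm a + norm b) / 2"
  have m: "m > 0" using assms by (cases "a = 0") (auto simp: m_def add_pos_nonneg)
  have le: "norm ((a + b) / 2) \<le> m" by (simp add: m_def norm_divide norm_triangle_ineq)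
  show ?thesis
  proof (cases "norm a = norm b")
    case True
    have "norm (a + b) \<noteq> norm a + norm b"
    proof
      assume "norm (a + b) = norm a + norm b"
      then have "norm a *\<^sub>R b = norm b *\<^sub>R a" by (simp add: norm_triangle_eq)
      with True assms show False by auto
    qed
    then have "norm ((a + b) / 2) < m"
      using norm_triangle_ineq[of a b] by (simp add: m_def norm_divide)
    then have "norm ((a + b) / 2) powr p < m powr p" using assms by (intro powr_less_mono2) auto
    then show ?thesis using True by (simp add: m_def)
  next
    case False
    have "norm ((a + b) / 2) powr p \<le> m powr p" using le assms by (intro powr_mono2) auto
    moreover have "m powr p + p * m powr (p - 1) * (norm a - m) < norm a powr p"
      using False m assms by (intro powr_above_tangent_strict) (auto simp: m_def)
    moreover have "m powr p + p * m powr (p - 1) * (norm b - m) < norm b powr p"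
      using False m assms by (intro powr_above_tangent_strict) (auto simp: m_def)
    moreover have "p * m powr (p - 1) * (norm a - m) + p * m powr (p - 1) * (norm b - m) = 0"
      by (simp add: m_def field_simps)
    moreover have "n < (A + B) / 2" if "n \<le> M" "M + u < A" "M + v < B" "u + v = 0" for n M A B u v :: real
      using that by simp
    ultimately show ?thesis by blast
  qed
qed

text \<open>
All terms are homogeneous of degree \<open>p\<close>, so it suffices to consider the unit sphere of pairs. On its
compact part where the first term does not already dominate, \<open>a \<noteq> b\<close>, hence the midpoint gap is
bounded below by a positive constant.
\<close>
lemma uniform_convexity_powr:
  fixes p \<eta> :: real
  assumes "1 < p" "\<eta> > 0"
  obtains C where "C > 0" "\<And>a b :: complex. norm (a - b) powr p \<le>
     \<eta> * (norm a powr p + norm b powr p)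
       + C * ((norm a powr p + norm b powr p) / 2 - norm ((a + b) / 2) powr p)"
proof -
  define S where "S = sphere (0 :: complex \<times> complex) 1"
  define U where "U = (\<lambda>z :: complex \<times> complex. norm (fst z) powr p + norm (snd z) powr p)"
  define V where "V = (\<lambda>z :: complex \<times> complex. norm (fst z - snd z) powr p)"
  define W where "W = (\<lambda>z :: complex \<times> complex. U z / 2 - norm ((fst z + snd z) / 2) powr p)"
  have contU: "continuous_on A U" for A unfolding U_def using assms
    by (intro continuous_intros continuous_on_powr') auto
  have contV: "continuous_on A V" for A unfolding V_def using assms
    by (intro continuous_intros continuous_on_powr') auto
  have contW: "continuous_on A W" for A unfolding W_def using assms
    by (intro continuous_intros continuous_on_powr' contU) auto
  have W0: "W z \<ge> 0" for z
    using midpoint_powr_less[OF assms(1), of "fst z" "snd z"]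
    by (cases "fst z = snd z") (auto simp: W_def U_def)
  have U0: "U z \<ge> 0" for z by (simp add: U_def)
  have Upos: "U z > 0" if "z \<in> S" for z
  proof -
    have "z \<noteq> 0" using that by (auto simp: S_def)
    then have "fst z \<noteq> 0 \<or> snd z \<noteq> 0" by (auto simp: prod_eq_iff)
    then show ?thesis by (auto simp: U_def add_pos_nonneg add_nonneg_pos)
  qed
  define T where "T = S \<inter> {z. \<eta> * U z \<le> V z}"
  have "closed {z. \<eta> * U z \<le> V z}"
    by (intro closed_Collect_le continuous_intros contU contV)
  then have T: "compact T" unfolding T_def S_def by (intro compact_Int_closed compact_sphere)
  have Wpos: "W z > 0" if "z \<in> T" for z
  proof -
    have "fst z \<noteq> snd z"
    proof
      assume "fst z = snd z"
      then have "V z = 0" by (simp add: V_def)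
      with that Upos[of z] assms show False by (auto simp: T_def mult_le_0_iff)
    qed
    then show ?thesis using midpoint_powr_less[OF assms(1), of "fst z" "snd z"] by (simp add: W_def U_def)
  qed
  obtain C where C: "C > 0" "\<And>z. z \<in> T \<Longrightarrow> V z \<le> C * W z"
  proof (cases "T = {}")
    case True
    then show ?thesis using that[of 1] by auto
  next
    case False
    have "continuous_on T (\<lambda>z. V z / W z)"
      using Wpos by (intro continuous_intros contV contW) force
    with T False obtain z0 where z0: "z0 \<in> T" "\<And>z. z \<in> T \<Longrightarrow> V z / W z \<le> V z0 / W z0"
      using continuous_attains_sup[of T "\<lambda>z. V z / W z"] by blast
    have "V z \<le> (\<bar>V z0 / W z0\<bar> + 1) * W z" if "z \<in> T" for z
    proof -
      have "V z / W z \<le> \<bar>V z0 / W z0\<bar> + 1" using z0(2)[OF that] by linarith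
      then show ?thesis using Wpos[OF that] by (simp add: pos_divide_le_eq)
    qed
    then show ?thesis by (intro that[of "\<bar>V z0 / W z0\<bar> + 1"]) linarith+
  qed
  have S_le: "V z \<le> \<eta> * U z + C * W z" if "z \<in> S" for z
  proof (cases "z \<in> T")
    case True
    then show ?thesis using C(2)[OF True] U0[of z] assms by (simp add: add_increasing)
  next
    case False
    then have "V z \<le> \<eta> * U z" using that by (auto simp: T_def)
    then show ?thesis using W0[of z] C by (simp add: add_increasing2)
  qed
  have all: "V z \<le> \<eta> * U z + C * W z" for z
  proof (cases "z = 0")
    case True
    then show ?thesis using assms by (simp add: V_def U_def W_def)
  next
    case False
    define r where "r = norm z"
    define z' where "z' = (1 / r) *\<^sub>R z"
    have r: "r > 0" and z: "z = r *\<^sub>R z'" and z': "z' \<in> S"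
      using False by (auto simp: r_def z'_def S_def)
    have "V z = r powr p * V z'"
      using r by (simp add: V_def z scaleR_diff_right[symmetric] powr_mult)
    moreover have "U z = r powr p * U z'"
      using r by (simp add: U_def z powr_mult algebra_simps)
    moreover have "norm ((fst z + snd z) / 2) powr p = r powr p * norm ((fst z' + snd z') / 2) powr p"
    proof -
      have "(fst z + snd z) / 2 = r *\<^sub>R ((fst z' + snd z') / 2)"
        by (simp add: z scaleR_conv_of_real field_simps)
      then have "norm ((fst z + snd z) / 2) = r * norm ((fst z' + snd z') / 2)"
        using r by (simp only: norm_scaleR abs_of_pos)
      then show ?thesis using r by (simp only: powr_mult norm_ge_zero)
    qed
    ultimately have "V z = r powr p * V z'" "\<eta> * U z + C * W z = r powr p * (\<eta> * U z' + C * W z')"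
      by (auto simp: W_def algebra_simps)
    then show ?thesis using S_le[OF z'] r by simp
  qed
  show ?thesis
    by (rule that[OF C(1)]) (use all in \<open>force simp: V_def U_def W_def\<close>)
qed

section \<open>Cauchy's formula on rectangles\<close>

text \<open>
The counterclockwise integral, as four integrals over intervals, so that the common sides of adjacent
rectangles cancel by algebra.
\<close>
definition box_integral :: "real \<Rightarrow> real \<Rightarrow> real \<Rightarrow> real \<Rightarrow> (complex \<Rightarrow> complex) \<Rightarrow> complex" where
  "box_integral a b c d f =
     integral {a..b} (\<lambda>x. f (Complex x c)) + \<i> * integral {c..d} (\<lambda>y. f (Complex b y))
       - integral {a..b} (\<lambda>x. f (Complex x d)) - \<i> * integral {c..d} (\<lambda>y. f (Complex a y))"

lemma contour_integral_linepath_same_Im: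
  assumes "a < b"
  shows "contour_integral (linepath (Complex a c) (Complex b c)) f =
         integral {a..b} (\<lambda>x. f (Complex x c))"
proof -
  let ?z = "Complex a c" and ?z' = "Complex b c"
  have line: "linepath ?z ?z' = (\<lambda>x. Complex (a + (b - a) * x) c)"
    by (auto simp: fun_eq_iff linepath_def complex_eq_iff algebra_simps)
  have "contour_integral (linepath ?z ?z') f =
         (?z' - ?z) * integral {0..1} (\<lambda>x. f (linepath ?z ?z' x))"
    by (simp add: contour_integral_integral)
  also have "?z' - ?z = of_real (b - a)"
    by (simp add: complex_eq_iff)
  also have "integral {0..1} (\<lambda>x. f (linepath ?z ?z' x)) =
             integral {0..(b - a) / (b - a)} (\<lambda>x. f (Complex (a + (b - a) * x) c))"
    unfolding line using \<open>a < b\<close> by simp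
  also have "{0..(b - a) / (b - a)} = (\<lambda>x. x / (b - a)) ` {0..b - a}"
    using \<open>a < b\<close> by simp
  also have "integral \<dots> (\<lambda>x. f (Complex (a + (b - a) * x) c)) =
             integral {a-a..b-a} (\<lambda>x. f (Complex (x + a) c)) / of_real (b - a)"
    using \<open>a < b\<close> by (subst integral_stretch_real) (auto simp: scaleR_conv_of_real add_ac)
  also have "\<dots> = integral {a..b} (\<lambda>x. f (Complex x c)) / of_real (b - a)"
    by (subst integral_shift_real_ivl) (rule refl)
  finally show ?thesis
    using \<open>a < b\<close> by simp
qed

lemma contour_integral_rectpath:
  assumes ab: "a < b" "c < d"
    and f: "continuous_on (path_image (rectpath (Complex a c) (Complex b d))) f"
  shows "contour_integral (rectpath (Complex a c) (Complex b d)) f = box_integral a b c d f"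
proof -
  let ?z1 = "Complex a c" and ?z2 = "Complex b c" and ?z3 = "Complex b d" and ?z4 = "Complex a d"
  have img: "path_image (rectpath ?z1 ?z3) =
      closed_segment ?z1 ?z2 \<union> closed_segment ?z2 ?z3 \<union> closed_segment ?z3 ?z4 \<union> closed_segment ?z4 ?z1"
    by (simp add: rectpath_def Let_def path_image_join Un_assoc)
  have cont: "continuous_on (closed_segment ?z1 ?z2) f" "continuous_on (closed_segment ?z2 ?z3) f"
     "continuous_on (closed_segment ?z3 ?z4) f" "continuous_on (closed_segment ?z4 ?z1) f"
    by (auto intro: continuous_on_subset[OF f] simp: img)
  have ci: "f contour_integrable_on linepath ?z1 ?z2" "f contour_integrable_on linepath ?z2 ?z3"
     "f contour_integrable_on linepath ?z3 ?z4" "f contour_integrable_on linepath ?z4 ?z1"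
    using cont by (auto intro: contour_integrable_continuous_linepath)
  have "contour_integral (rectpath ?z1 ?z3) f =
     contour_integral (linepath ?z1 ?z2) f + (contour_integral (linepath ?z2 ?z3) f
     + (contour_integral (linepath ?z3 ?z4) f + contour_integral (linepath ?z4 ?z1) f))"
    unfolding rectpath_def Let_def using ci
    by (simp add: contour_integral_join contour_integrable_joinI valid_path_join)
  moreover have "contour_integral (linepath ?z3 ?z4) f = - contour_integral (linepath ?z4 ?z3) f"
    using cont by (intro contour_integral_reverse_linepath)
  moreover have "contour_integral (linepath ?z4 ?z1) f = - contour_integral (linepath ?z1 ?z4) f"
    using cont by (intro contour_integral_reverse_linepath)
  moreover have "contour_integral (linepath ?z2 ?z3) f = \<i> * integral {c..d} (\<lambda>y. f (Complex b y))"
    using ab by (intro contour_integral_linepath_same_Re) auto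
  moreover have "contour_integral (linepath ?z1 ?z4) f = \<i> * integral {c..d} (\<lambda>y. f (Complex a y))"
    using ab by (intro contour_integral_linepath_same_Re) auto
  ultimately show ?thesis
    using contour_integral_linepath_same_Im[OF ab(1)] by (simp add: box_integral_def)
qed

lemma box_integral_eq_0:
  assumes "a < b" "c < d" "f holomorphic_on cbox (Complex a c) (Complex b d)"
  shows "box_integral a b c d f = 0"
proof -
  let ?r = "rectpath (Complex a c) (Complex b d)"
  have sub: "path_image ?r \<subseteq> cbox (Complex a c) (Complex b d)"
    using assms by (intro path_image_rectpath_subset_cbox) auto
  have "(f has_contour_integral 0) ?r"
    using assms sub by (intro Cauchy_theorem_convex_simple[OF assms(3)]) auto
  then have "contour_integral ?r f = 0" by (rule contour_integral_unique)
  then show ?thesis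
    using contour_integral_rectpath[of a b c d f] assms sub
    by (metis continuous_on_subset holomorphic_on_imp_continuous_on)
qed

lemma box_integral_Cauchy:
  assumes "f holomorphic_on cbox (Complex a c) (Complex b d)" "z \<in> box (Complex a c) (Complex b d)"
  shows "box_integral a b c d (\<lambda>w. f w / (w - z)) = 2 * of_real pi * \<i> * f z"
proof -
  let ?r = "rectpath (Complex a c) (Complex b d)"
  have ab: "a < b" "c < d" using assms by (auto simp: in_box_complex_iff)
  have sub: "path_image ?r \<subseteq> cbox (Complex a c) (Complex b d) - {z}"
    using assms ab by (subst path_image_rectpath_cbox_minus_box) auto
  have "((\<lambda>w. f w / (w - z)) has_contour_integral (2*pi * \<i> * winding_number ?r z * f z)) ?r"
    using assms sub by (intro Cauchy_integral_formula_convex_simple[OF _ assms(1)]) (auto simp: interior_cbox)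
  then have "contour_integral ?r (\<lambda>w. f w / (w - z)) = 2*pi * \<i> * winding_number ?r z * f z"
    by (rule contour_integral_unique)
  moreover have "winding_number ?r z = 1" by (rule winding_number_rectpath[OF assms(2)])
  moreover have "continuous_on (path_image ?r) (\<lambda>w. f w / (w - z))"
    using sub by (intro continuous_intros continuous_on_subset[OF holomorphic_on_imp_continuous_on[OF assms(1)]]) auto
  ultimately show ?thesis
    using contour_integral_rectpath[OF ab, of "\<lambda>w. f w / (w - z)"] by simp
qed

section \<open>Pointwise growth of Hardy functions on the upper half-plane\<close>

definition Lp_pow :: "real \<Rightarrow> (real \<Rightarrow> complex) \<Rightarrow> ennreal" where
  "Lp_pow p g = (\<integral>\<^sup>+x. ennreal (norm (g x) powr p) \<partial>lborel)"

definition half_plane_Hp :: "real \<Rightarrow> real \<Rightarrow> (complex \<Rightarrow> complex) \<Rightarrow> bool" where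
  "half_plane_Hp p K f \<longleftrightarrow> f holomorphic_on {z. Im z > 0} \<and>
     (\<forall>y>0. Lp_pow p (\<lambda>x. f (Complex x y)) \<le> ennreal K)"

lemma continuous_on_horizontal:
  assumes "f holomorphic_on {z. Im z > 0}" "y > 0"
  shows "continuous_on A (\<lambda>x. f (Complex x y))"
  by (rule continuous_on_compose2[OF holomorphic_on_imp_continuous_on[OF assms(1)]])
     (use assms in \<open>auto simp: Complex_eq intro!: continuous_intros\<close>)

lemma continuous_on_vertical:
  assumes "f holomorphic_on {z. Im z > 0}" "A \<subseteq> {0<..}"
  shows "continuous_on A (\<lambda>y. f (Complex x y))"
  by (rule continuous_on_compose2[OF holomorphic_on_imp_continuous_on[OF assms(1)]])
     (use assms in \<open>auto simp: Complex_eq intro!: continuous_intros\<close>)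

lemma borel_measurable_horizontal:
  assumes "f holomorphic_on {z. Im z > 0}" "y > 0"
  shows "(\<lambda>x. f (Complex x y)) \<in> borel_measurable borel"
  using continuous_on_horizontal[OF assms] by (rule borel_measurable_continuous_onI)

lemma measurable_Complex [measurable (raw)]:
  assumes [measurable]: "f \<in> borel_measurable M" "g \<in> borel_measurable M"
  shows "(\<lambda>x. Complex (f x) (g x)) \<in> borel_measurable M"
  unfolding Complex_eq by measurable

lemma norm_interval_integral_le_nn_integral:
  fixes g :: "real \<Rightarrow> complex"
  assumes g: "continuous_on {a..b} g" and le: "\<And>x. x \<in> {a..b} \<Longrightarrow> ennreal (norm (g x)) \<le> h x"
  shows "ennreal (norm (integral {a..b} g)) \<le> (\<integral>\<^sup>+x. h x \<partial>lborel)"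
proof -
  have int: "set_integrable lborel {a..b} g" by (rule borel_integrable_atLeastAtMost'[OF g])
  have "integral {a..b} g = (LBINT x:{a..b}. g x)"
    using set_borel_integral_eq_integral(2)[OF int] by simp
  then have "ennreal (norm (integral {a..b} g)) \<le> (\<integral>\<^sup>+x. norm (indicator {a..b} x *\<^sub>R g x) \<partial>lborel)"
    using int unfolding set_lebesgue_integral_def set_integrable_def
    by (simp only: integral_norm_bound_ennreal)
  also have "\<dots> \<le> (\<integral>\<^sup>+x. h x \<partial>lborel)"
    by (intro nn_integral_mono) (auto simp: indicator_def le)
  finally show ?thesis .
qed

text \<open>
Cauchy's formula on the square of half-side \<open>r\<close> about \<open>z\<close>. The sides are lengthened to \<open>2\<rho>\<close> so that
the bound can be averaged over \<open>r\<close>.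
\<close>
lemma norm_le_box_average:
  assumes f: "f holomorphic_on {z. Im z > 0}" and z: "Im z = y" "Re z = x" and r: "0 < r" "r \<le> \<rho>" "\<rho> < y"
    and F_def: "F = (\<lambda>w. if Im w > 0 then ennreal (norm (f w)) else 0)"
  shows "ennreal (2 * pi * r * norm (f z)) \<le>
     (\<integral>\<^sup>+u. F (Complex u (y - r)) * indicator {x-\<rho>..x+\<rho>} u \<partial>lborel) +
     (\<integral>\<^sup>+v. F (Complex (x + r) v) * indicator {y-\<rho>..y+\<rho>} v \<partial>lborel) +
     (\<integral>\<^sup>+u. F (Complex u (y + r)) * indicator {x-\<rho>..x+\<rho>} u \<partial>lborel) +
     (\<integral>\<^sup>+v. F (Complex (x - r) v) * indicator {y-\<rho>..y+\<rho>} v \<partial>lborel)"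
proof -
  let ?g = "\<lambda>w. f w / (w - z)"
  have holo: "f holomorphic_on cbox (Complex (x - r) (y - r)) (Complex (x + r) (y + r))"
    by (rule holomorphic_on_subset[OF f]) (use r in \<open>auto simp: in_cbox_complex_iff\<close>)
  have zbox: "z \<in> box (Complex (x - r) (y - r)) (Complex (x + r) (y + r))"
    using z r by (auto simp: in_box_complex_iff)
  have ne: "w - z \<noteq> 0" if "\<bar>Re w - x\<bar> = r \<or> \<bar>Im w - y\<bar> = r" for w
    using that z r by auto
  have ge: "r \<le> norm (w - z)" if "\<bar>Re w - x\<bar> = r \<or> \<bar>Im w - y\<bar> = r" for w
    using that z abs_Re_le_cmod[of "w - z"] abs_Im_le_cmod[of "w - z"] by auto
  have bd: "ennreal (norm (of_real r * ?g w)) \<le> F w"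
    if "\<bar>Re w - x\<bar> = r \<or> \<bar>Im w - y\<bar> = r" "Im w > 0" for w
  proof -
    have "norm (of_real r * ?g w) = norm (f w) * (r / norm (w - z))"
      using r by (simp add: norm_mult norm_divide)
    also have "\<dots> \<le> norm (f w) * 1"
      using ge[OF that(1)] r by (intro mult_left_mono) (auto simp: divide_le_eq_1)
    finally show ?thesis using that by (simp add: F_def)
  qed
  have hor: "ennreal (norm (of_real r * integral {x - r..x + r} (\<lambda>u. ?g (Complex u c)))) \<le>
      (\<integral>\<^sup>+u. F (Complex u c) * indicator {x-\<rho>..x+\<rho>} u \<partial>lborel)" if "\<bar>c - y\<bar> = r" for c
  proof -
    have "c > 0" using that r by auto
    have "continuous_on {x - r..x + r} (\<lambda>u. of_real r * ?g (Complex u c))"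
      using ne[of "Complex _ c"] that
      by (intro continuous_intros continuous_on_horizontal[OF f \<open>c > 0\<close>])
         (auto simp: Complex_eq intro!: continuous_intros)
    then have "ennreal (norm (integral {x - r..x + r} (\<lambda>u. of_real r * ?g (Complex u c)))) \<le>
      (\<integral>\<^sup>+u. F (Complex u c) * indicator {x-\<rho>..x+\<rho>} u \<partial>lborel)"
      using bd[of "Complex _ c"] that r \<open>c > 0\<close>
      by (intro norm_interval_integral_le_nn_integral) (auto simp: indicator_def)
    then show ?thesis by (subst (asm) integral_mult_right)
  qed
  have ver: "ennreal (norm (of_real r * (\<i> * integral {y - r..y + r} (\<lambda>v. ?g (Complex c v))))) \<le>
      (\<integral>\<^sup>+v. F (Complex c v) * indicator {y-\<rho>..y+\<rho>} v \<partial>lborel)" if "\<bar>c - x\<bar> = r" for c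
  proof -
    have "continuous_on {y - r..y + r} (\<lambda>v. of_real r * ?g (Complex c v))"
      using ne[of "Complex c _"] that r
      by (intro continuous_intros continuous_on_vertical[OF f])
         (auto simp: Complex_eq intro!: continuous_intros)
    then have "ennreal (norm (integral {y - r..y + r} (\<lambda>v. of_real r * ?g (Complex c v)))) \<le>
      (\<integral>\<^sup>+v. F (Complex c v) * indicator {y-\<rho>..y+\<rho>} v \<partial>lborel)"
      using bd[of "Complex c _"] that r
      by (intro norm_interval_integral_le_nn_integral) (auto simp: indicator_def)
    then show ?thesis by (subst (asm) integral_mult_right) (simp add: norm_mult)
  qed
  have "of_real r * (2 * of_real pi * \<i> * f z) =
     of_real r * integral {x - r..x + r} (\<lambda>u. ?g (Complex u (y - r))) +
     of_real r * (\<i> * integral {y - r..y + r} (\<lambda>v. ?g (Complex (x + r) v))) -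
     of_real r * integral {x - r..x + r} (\<lambda>u. ?g (Complex u (y + r))) -
     of_real r * (\<i> * integral {y - r..y + r} (\<lambda>v. ?g (Complex (x - r) v)))" (is "_ = ?a + ?b - ?c - ?d")
    unfolding box_integral_Cauchy[OF holo zbox, symmetric] by (simp add: box_integral_def algebra_simps)
  note eq = this
  have "2 * pi * r * norm (f z) = norm (of_real r * (2 * of_real pi * \<i> * f z))"
    using r by (simp add: norm_mult)
  also have "\<dots> = norm (?a + ?b - ?c - ?d)"
    by (rule arg_cong[OF eq])
  also have "\<dots> \<le> norm ?a + norm ?b + norm ?c + norm ?d"
    using norm_triangle_ineq4[of "?a + ?b - ?c" ?d] norm_triangle_ineq4[of "?a + ?b" ?c] norm_triangle_ineq[of ?a ?b]
    by linarith
  finally have "ennreal (2 * pi * r * norm (f z)) \<le> ennreal (norm ?a) + ennreal (norm ?b) + ennreal (norm ?c) + ennreal (norm ?d)"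
    by (simp flip: ennreal_plus add: ennreal_leI)
  also have "\<dots> \<le> (\<integral>\<^sup>+u. F (Complex u (y - r)) * indicator {x-\<rho>..x+\<rho>} u \<partial>lborel) +
     (\<integral>\<^sup>+v. F (Complex (x + r) v) * indicator {y-\<rho>..y+\<rho>} v \<partial>lborel) +
     (\<integral>\<^sup>+u. F (Complex u (y + r)) * indicator {x-\<rho>..x+\<rho>} u \<partial>lborel) +
     (\<integral>\<^sup>+v. F (Complex (x - r) v) * indicator {y-\<rho>..y+\<rho>} v \<partial>lborel)"
    using r by (intro add_mono hor ver) auto
  finally show ?thesis .
qed

text \<open>
Average the preceding bound over \<open>r \<in> [\<rho>/2, \<rho>]\<close> with \<open>\<rho> = Im z / 2\<close>. The horizontal sides are controlled by the slices
directly; the vertical sides sweep out rectangles, which Tonelli's theorem slices horizontally again.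
\<close>
lemma half_plane_Hp_pointwise:
  assumes p: "1 < p" and K: "K > 0" and f: "half_plane_Hp p K f"
  obtains C where "C > 0" "\<And>z. Im z > 0 \<Longrightarrow> norm (f z) \<le> C * Im z powr (- 1 / p)"
proof -
  from f have holo: "f holomorphic_on {z. Im z > 0}"
    and Lp: "\<And>y. y > 0 \<Longrightarrow> Lp_pow p (\<lambda>x. f (Complex x y)) \<le> ennreal K"
    by (auto simp: half_plane_Hp_def)
  define F where "F = (\<lambda>w. if Im w > 0 then ennreal (norm (f w)) else 0)"
  have F[measurable]: "F \<in> borel_measurable borel"
  proof -
    have "(\<lambda>w. if w \<in> {z. Im z > 0} then f w else 0) \<in> borel_measurable borel"
      by (intro borel_measurable_continuous_on_if holomorphic_on_imp_continuous_on[OF holo])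
         (auto intro!: borel_open open_halfspace_Im_gt)
    then have "(\<lambda>w. ennreal (norm (if w \<in> {z. Im z > 0} then f w else 0))) \<in> borel_measurable borel"
      by measurable
    also have "(\<lambda>w. ennreal (norm (if w \<in> {z. Im z > 0} then f w else 0))) = F"
      by (auto simp: F_def)
    finally show ?thesis .
  qed
  have C: "norm (f z) \<le> 10 / pi * (2 + K) * \<rho> powr (- 1 / p)"
    if \<rho>: "0 < \<rho>" "2 * \<rho> \<le> Im z" for z \<rho>
  proof -
    let ?x = "Re z" and ?y = "Im z"
    define B where "B = \<rho> powr (1 - 1 / p) * (2 + K)"
    have B: "B \<ge> 0" using K by (simp add: B_def)
    have hor: "(\<integral>\<^sup>+u. F (Complex u v) * indicator {a..b} u \<partial>lborel) \<le> ennreal B"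
      if ab: "a \<le> b" "b - a \<le> 2 * \<rho>" for v a b
    proof (cases "v > 0")
      case False
      then show ?thesis by (simp add: F_def)
    next
      case True
      \<comment> \<open>This choice balances the two terms of the elementary inequality: both become multiples of \<open>\<rho>\<^bsup>1-1/p\<^esup>\<close>.\<close>
      define c where "c = \<rho> powr (- 1 / p)"
      have c: "c > 0" using \<rho> by (simp add: c_def)
      note [measurable] = borel_measurable_horizontal[OF holo True]
      have "(\<integral>\<^sup>+u. F (Complex u v) * indicator {a..b} u \<partial>lborel) \<le>
         (\<integral>\<^sup>+u. ennreal c * indicator {a..b} u + ennreal (c powr (1 - p)) * ennreal (norm (f (Complex u v)) powr p) \<partial>lborel)"
      proof (intro nn_integral_mono)
        fix u
        have "F (Complex u v) \<le> ennreal (c + c powr (1 - p) * norm (f (Complex u v)) powr p)"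
          using True by (simp add: F_def ennreal_leI le_add_powr p c)
        then show "F (Complex u v) * indicator {a..b} u \<le>
            ennreal c * indicator {a..b} u + ennreal (c powr (1 - p)) * ennreal (norm (f (Complex u v)) powr p)"
          using c by (auto simp: indicator_def ennreal_plus ennreal_mult)
      qed
      also have "\<dots> = ennreal c * ennreal (b - a) + ennreal (c powr (1 - p)) * Lp_pow p (\<lambda>u. f (Complex u v))"
        using ab by (simp add: nn_integral_add nn_integral_cmult nn_integral_cmult_indicator Lp_pow_def)
      also have "\<dots> \<le> ennreal c * ennreal (2 * \<rho>) + ennreal (c powr (1 - p)) * ennreal K"
        using ab True by (intro add_mono mult_left_mono Lp ennreal_leI) auto
      also have "\<dots> = ennreal (c * (2 * \<rho>) + c powr (1 - p) * K)"
        using c \<rho> K by (simp add: ennreal_plus ennreal_mult)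
      also have "c * (2 * \<rho>) + c powr (1 - p) * K = B"
      proof -
        have "c * \<rho> = \<rho> powr (1 - 1 / p)"
          using \<rho> powr_mult_base[of \<rho> "- 1 / p"] by (simp add: c_def mult.commute)
        moreover have "c powr (1 - p) = \<rho> powr (1 - 1 / p)"
        proof -
          have "- 1 / p * (1 - p) = 1 - 1 / p" using p by (simp add: field_simps)
          then show ?thesis by (simp only: c_def powr_powr)
        qed
        ultimately show ?thesis by (simp add: B_def algebra_simps)
      qed
      finally show ?thesis .
    qed
    let ?I = "indicator {\<rho> / 2..\<rho>} :: real \<Rightarrow> ennreal"
    have V: "(\<integral>\<^sup>+r. (\<integral>\<^sup>+v. F (Complex (?x + s * r) v) * indicator {?y-\<rho>..?y+\<rho>} v \<partial>lborel) * ?I r \<partial>lborel)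
        \<le> ennreal (B * (2 * \<rho>))" if s: "s = 1 \<or> s = -1" for s :: real
    proof -
      have "(\<integral>\<^sup>+r. (\<integral>\<^sup>+v. F (Complex (?x + s * r) v) * indicator {?y-\<rho>..?y+\<rho>} v \<partial>lborel) * ?I r \<partial>lborel)
         = (\<integral>\<^sup>+r. (\<integral>\<^sup>+v. F (Complex (?x + s * r) v) * ?I r * indicator {?y-\<rho>..?y+\<rho>} v \<partial>lborel) \<partial>lborel)"
        by (intro nn_integral_cong, subst nn_integral_multc[symmetric]) (auto simp: mult_ac)
      also have "\<dots> = (\<integral>\<^sup>+v. (\<integral>\<^sup>+r. F (Complex (?x + s * r) v) * ?I r * indicator {?y-\<rho>..?y+\<rho>} v \<partial>lborel) \<partial>lborel)"
        by (rule lborel_pair.Fubini') measurable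
      also have "\<dots> = (\<integral>\<^sup>+v. (\<integral>\<^sup>+r. F (Complex (?x + s * r) v) * ?I r \<partial>lborel) * indicator {?y-\<rho>..?y+\<rho>} v \<partial>lborel)"
        by (intro nn_integral_cong nn_integral_multc) measurable
      also have "\<dots> \<le> (\<integral>\<^sup>+v. ennreal B * indicator {?y-\<rho>..?y+\<rho>} v \<partial>lborel)"
      proof (intro nn_integral_mono mult_right_mono)
        fix v
        have "(\<integral>\<^sup>+r. F (Complex (?x + s * r) v) * ?I r \<partial>lborel) =
          (\<integral>\<^sup>+u. F (Complex u v) * ?I (s * (u - ?x)) \<partial>lborel)"
          using s by (subst nn_integral_real_affine[where c = s and t = ?x and f = "\<lambda>u. F (Complex u v) * ?I (s * (u - ?x))"]) auto
        also have "\<dots> \<le> (\<integral>\<^sup>+u. F (Complex u v) * indicator {?x - \<rho>..?x+\<rho>} u \<partial>lborel)"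
          using s \<rho> by (intro nn_integral_mono) (auto simp: indicator_def)
        also have "\<dots> \<le> ennreal B" using \<rho> by (intro hor) auto
        finally show "(\<integral>\<^sup>+r. F (Complex (?x + s * r) v) * ?I r \<partial>lborel) \<le> ennreal B" .
      qed auto
      also have "\<dots> = ennreal (B * (2 * \<rho>))"
        using \<rho> B by (simp add: nn_integral_cmult_indicator ennreal_mult)
      finally show ?thesis .
    qed
    have H: "(\<integral>\<^sup>+r. (\<integral>\<^sup>+u. F (Complex u (?y + s * r)) * indicator {?x-\<rho>..?x+\<rho>} u \<partial>lborel) * ?I r \<partial>lborel)
        \<le> ennreal (B * (\<rho> / 2))" for s :: real
    proof -
      have "(\<integral>\<^sup>+r. (\<integral>\<^sup>+u. F (Complex u (?y + s * r)) * indicator {?x-\<rho>..?x+\<rho>} u \<partial>lborel) * ?I r \<partial>lborel) \<le>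
         (\<integral>\<^sup>+r. ennreal B * ?I r \<partial>lborel)"
        using \<rho> by (intro nn_integral_mono mult_right_mono hor) auto
      also have "\<dots> = ennreal (B * (\<rho> / 2))"
        using \<rho> B by (simp add: nn_integral_cmult_indicator flip: ennreal_mult)
      finally show ?thesis .
    qed
    have "ennreal (pi * \<rho> * norm (f z) * (\<rho> / 2)) = (\<integral>\<^sup>+r. ennreal (pi * \<rho> * norm (f z)) * ?I r \<partial>lborel)"
      using \<rho> by (simp add: nn_integral_cmult_indicator flip: ennreal_mult)
    also have "\<dots> \<le> (\<integral>\<^sup>+r.
       (\<integral>\<^sup>+u. F (Complex u (?y + (-1) * r)) * indicator {?x-\<rho>..?x+\<rho>} u \<partial>lborel) * ?I r +
       (\<integral>\<^sup>+v. F (Complex (?x + 1 * r) v) * indicator {?y-\<rho>..?y+\<rho>} v \<partial>lborel) * ?I r +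
       (\<integral>\<^sup>+u. F (Complex u (?y + 1 * r)) * indicator {?x-\<rho>..?x+\<rho>} u \<partial>lborel) * ?I r +
       (\<integral>\<^sup>+v. F (Complex (?x + (-1) * r) v) * indicator {?y-\<rho>..?y+\<rho>} v \<partial>lborel) * ?I r \<partial>lborel)"
    proof (intro nn_integral_mono)
      fix r :: real
      show "ennreal (pi * \<rho> * norm (f z)) * ?I r \<le>
       (\<integral>\<^sup>+u. F (Complex u (?y + (-1) * r)) * indicator {?x-\<rho>..?x+\<rho>} u \<partial>lborel) * ?I r +
       (\<integral>\<^sup>+v. F (Complex (?x + 1 * r) v) * indicator {?y-\<rho>..?y+\<rho>} v \<partial>lborel) * ?I r +
       (\<integral>\<^sup>+u. F (Complex u (?y + 1 * r)) * indicator {?x-\<rho>..?x+\<rho>} u \<partial>lborel) * ?I r +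
       (\<integral>\<^sup>+v. F (Complex (?x + (-1) * r) v) * indicator {?y-\<rho>..?y+\<rho>} v \<partial>lborel) * ?I r"
      proof (cases "r \<in> {\<rho> / 2..\<rho>}")
        case True
        have "ennreal (pi * \<rho> * norm (f z)) \<le> ennreal (2 * pi * r * norm (f z))"
          using True by (intro ennreal_leI mult_right_mono) auto
        also note norm_le_box_average[OF holo refl refl _ _ _ F_def, of r \<rho> z]
        finally show ?thesis using True \<rho> by simp
      qed simp
    qed
    also have "\<dots> = (\<integral>\<^sup>+r. (\<integral>\<^sup>+u. F (Complex u (?y + (-1) * r)) * indicator {?x-\<rho>..?x+\<rho>} u \<partial>lborel) * ?I r \<partial>lborel) +
       (\<integral>\<^sup>+r. (\<integral>\<^sup>+v. F (Complex (?x + 1 * r) v) * indicator {?y-\<rho>..?y+\<rho>} v \<partial>lborel) * ?I r \<partial>lborel) +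
       (\<integral>\<^sup>+r. (\<integral>\<^sup>+u. F (Complex u (?y + 1 * r)) * indicator {?x-\<rho>..?x+\<rho>} u \<partial>lborel) * ?I r \<partial>lborel) +
       (\<integral>\<^sup>+r. (\<integral>\<^sup>+v. F (Complex (?x + (-1) * r) v) * indicator {?y-\<rho>..?y+\<rho>} v \<partial>lborel) * ?I r \<partial>lborel)"
      by (simp add: nn_integral_add)
    also have "\<dots> \<le> ennreal (B * (\<rho> / 2)) + ennreal (B * (2 * \<rho>)) + ennreal (B * (\<rho> / 2)) + ennreal (B * (2 * \<rho>))"
      by (intro add_mono H V) auto
    also have "\<dots> = ennreal (B * 5 * \<rho>)"
      using B \<rho> by (subst ennreal_plus[symmetric]; (intro add_nonneg_nonneg mult_nonneg_nonneg)?; simp)+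
    finally have "pi * \<rho> * norm (f z) * (\<rho> / 2) \<le> B * 5 * \<rho>"
      using B \<rho> by (subst (asm) ennreal_le_iff) auto
    then have "norm (f z) \<le> 10 / pi * (B / \<rho>)"
      using \<rho> by (simp add: field_simps)
    also have "B / \<rho> = (2 + K) * \<rho> powr (- 1 / p)"
      using \<rho> by (simp add: B_def powr_diff powr_minus field_simps)
    finally show ?thesis by (simp only: mult.assoc)
  qed
  show ?thesis
  proof (rule that)
    show "0 < 10 / pi * (2 + K) * (1 / 2) powr (- 1 / p)" using K by simp
    fix z assume z: "Im z > 0"
    have "norm (f z) \<le> 10 / pi * (2 + K) * (1 / 2 * Im z) powr (- 1 / p)"
      using z by (intro C) auto
    also have "(1 / 2 * Im z) powr (- 1 / p) = (1 / 2) powr (- 1 / p) * Im z powr (- 1 / p)"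
      using z by (subst powr_mult) auto
    finally show "norm (f z) \<le> 10 / pi * (2 + K) * (1 / 2) powr (- 1 / p) * Im z powr (- 1 / p)"
      by (simp only: mult.assoc)
  qed
qed

section \<open>Integrals over the real line\<close>

text \<open>
This yields both the integrability of the Poisson kernel (\<open>q = 2\<close>) and the membership of the Cauchy
kernel in the dual space \<open>L\<^sup>q\<close>.
\<close>
lemma integrable_powr_tail:
  fixes q :: real
  assumes q: "q > 1"
  shows "integrable lborel (\<lambda>v. (1 + \<bar>v\<bar>) powr - q)"
proof -
  let ?h = "\<lambda>v::real. ennreal ((1 + \<bar>v\<bar>) powr - q)"
  have half: "(\<integral>\<^sup>+v. ?h v * indicator {0..} v \<partial>lborel) < \<infinity>"
  proof -
    let ?F = "\<lambda>v::real. - ((1 + v) powr (1 - q) / (q - 1))"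
    have "(\<integral>\<^sup>+v. ?h v * indicator {0..} v \<partial>lborel) = (\<integral>\<^sup>+v. ennreal ((1 + v) powr - q) * indicator {0..} v \<partial>lborel)"
      by (intro nn_integral_cong) (auto simp: indicator_def)
    also have "\<dots> = ennreal (0 - ?F 0)"
    proof (rule nn_integral_FTC_atLeast)
      show "(?F has_real_derivative (1 + x) powr - q) (at x)" if "0 \<le> x" for x
      proof -
        have "((\<lambda>v. (1 + v) powr (1 - q)) has_real_derivative (1 - q) * (1 + x) powr - q) (at x)"
          using that by (auto intro!: derivative_eq_intros)
        note DERIV_minus[OF DERIV_cdivide[OF this, of "q - 1"]]
        moreover have "(1 - q) * P / (q - 1) = - P" for P
          using q by (simp add: divide_eq_eq) (simp add: algebra_simps)
        ultimately show ?thesis by simp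
      qed
      have "((\<lambda>v. (1 + v) powr (1 - q)) \<longlongrightarrow> 0) at_top"
        using q by (intro tendsto_neg_powr filterlim_tendsto_add_at_top[OF tendsto_const] filterlim_ident) auto
      then have "((\<lambda>v. - ((1 + v) powr (1 - q) / (q - 1))) \<longlongrightarrow> - (0 / (q - 1))) at_top"
        using q by (intro tendsto_intros) auto
      then show "(?F \<longlongrightarrow> 0) at_top" by simp
    qed auto
    finally show ?thesis by simp
  qed
  have "(\<integral>\<^sup>+v. ?h v \<partial>lborel) \<le> (\<integral>\<^sup>+v. ?h v * indicator {0..} v + ?h (- v) * indicator {0..} (- v) \<partial>lborel)"
    by (intro nn_integral_mono) (auto simp: indicator_def)
  also have "\<dots> = (\<integral>\<^sup>+v. ?h v * indicator {0..} v \<partial>lborel) + (\<integral>\<^sup>+v. ?h (- v) * indicator {0..} (- v) \<partial>lborel)"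
    by (intro nn_integral_add) auto
  also have "(\<integral>\<^sup>+v. ?h (- v) * indicator {0..} (- v) \<partial>lborel) = (\<integral>\<^sup>+v. ?h v * indicator {0..} v \<partial>lborel)"
    by (subst nn_integral_real_affine[of _ "-1" 0]) auto
  also have "(\<integral>\<^sup>+v. ?h v * indicator {0..} v \<partial>lborel) + (\<integral>\<^sup>+v. ?h v * indicator {0..} v \<partial>lborel) < \<infinity>"
    using half by simp
  finally show ?thesis by (intro integrableI_bounded) auto
qed

lemma tendsto_integral_symmetric:
  fixes h :: "real \<Rightarrow> complex"
  assumes h: "integrable lborel h"
  shows "((\<lambda>R. integral {x - R..x + R} h) \<longlongrightarrow> (\<integral>u. h u \<partial>lborel)) at_top"
proof -
  have eq: "integral {x - R..x + R} h = (\<integral>u. indicator {x - R..x + R} u *\<^sub>R h u \<partial>lborel)" for R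
  proof -
    have "set_integrable lborel {x - R..x + R} h"
      unfolding set_integrable_def using h by (intro integrable_mult_indicator) auto
    from set_borel_integral_eq_integral(2)[OF this] show ?thesis
      by (simp add: set_lebesgue_integral_def)
  qed
  show ?thesis unfolding eq
  proof (rule integral_dominated_convergence_at_top[where w = "\<lambda>u. norm (h u)"])
    show "AE u in lborel. ((\<lambda>R. indicator {x - R..x + R} u *\<^sub>R h u) \<longlongrightarrow> h u) at_top"
    proof (rule AE_I2)
      fix u
      have "eventually (\<lambda>R. indicator {x - R..x + R} u *\<^sub>R h u = h u) at_top"
        using eventually_ge_at_top[of "\<bar>u - x\<bar>"] by eventually_elim (auto simp: indicator_def)
      then show "((\<lambda>R. indicator {x - R..x + R} u *\<^sub>R h u) \<longlongrightarrow> h u) at_top"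
        by (rule tendsto_eventually)
    qed
  qed (use h in \<open>auto simp: indicator_def\<close>)
qed

section \<open>The Poisson kernel\<close>

definition Poisson_kernel :: "real \<Rightarrow> real \<Rightarrow> real" where
  "Poisson_kernel b t = b / (pi * (t\<^sup>2 + b\<^sup>2))"

lemma Poisson_kernel_nonneg: "b \<ge> 0 \<Longrightarrow> Poisson_kernel b t \<ge> 0"
  by (simp add: Poisson_kernel_def)

lemma Poisson_kernel_minus: "Poisson_kernel b (x - u) = Poisson_kernel b (u - x)"
  by (simp add: Poisson_kernel_def power2_commute)

lemma borel_measurable_Poisson_kernel [measurable]: "Poisson_kernel b \<in> borel_measurable borel"
  unfolding Poisson_kernel_def by measurable

lemma integrable_Poisson_kernel:
  assumes b: "b > 0"
  shows "integrable lborel (\<lambda>u. Poisson_kernel b (x - u))"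
proof -
  have "integrable lborel (Poisson_kernel b)"
  proof (rule Bochner_Integration.integrable_bound)
    let ?C = "2 * (1 + 1 / b\<^sup>2) * b / pi"
    show "integrable lborel (\<lambda>v. ?C * (1 + \<bar>v\<bar>) powr - 2)"
      by (intro integrable_mult_right integrable_powr_tail) auto
    show "AE v in lborel. norm (Poisson_kernel b v) \<le> norm (?C * (1 + \<bar>v\<bar>) powr - 2)"
    proof (rule AE_I2)
      fix v :: real
      have "(1 + \<bar>v\<bar>)\<^sup>2 \<le> 2 * (1 + v\<^sup>2)"
        using sum_squares_ge_zero[of "1 - \<bar>v\<bar>" 0] by (simp add: power2_eq_square algebra_simps)
      also have "\<dots> \<le> 2 * ((1 + 1 / b\<^sup>2) * (v\<^sup>2 + b\<^sup>2))"
        using b by (simp add: field_simps)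
      finally have "b * (1 + \<bar>v\<bar>)\<^sup>2 \<le> b * (2 * ((1 + 1 / b\<^sup>2) * (v\<^sup>2 + b\<^sup>2)))"
        using b by (intro mult_left_mono) auto
      then have "Poisson_kernel b v \<le> ?C / (1 + \<bar>v\<bar>)\<^sup>2"
        unfolding Poisson_kernel_def
        using b by (simp add: divide_simps add_nonneg_pos) (simp add: algebra_simps)
      also have "\<dots> = ?C * (1 + \<bar>v\<bar>) powr - 2"
        by (simp add: powr_minus powr_numeral divide_inverse)
      finally show "norm (Poisson_kernel b v) \<le> norm (?C * (1 + \<bar>v\<bar>) powr - 2)"
        using b by (simp add: Poisson_kernel_nonneg)
    qed
  qed simp
  from lborel_integrable_real_affine[OF this, of "-1" x] show ?thesis by simp
qed

lemma norm_add_diff_le: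
  fixes t l r :: complex
  assumes "norm t \<le> A" "norm l \<le> B" "norm r \<le> C"
  shows "norm (t + l - r) \<le> A + B + C"
  using assms norm_triangle_ineq4[of "t + l" r] norm_triangle_ineq[of t l] by linarith

text \<open>
The Poisson kernel is the difference of the Cauchy kernels at \<open>z = x + i(a + b)\<close> and at the mirror
image \<open>z'\<close> of \<open>z\<close> in the line \<open>Im w = a\<close>. The point \<open>z'\<close> lies below the rectangle, so only the pole at
\<open>z\<close> counts, and the difference decays like \<open>R\<^bsup>-2\<^esup>\<close>, so that boundedness of \<open>g\<close> makes the three far sides
negligible.
\<close>
lemma half_plane_Poisson_formula:
  assumes g: "g holomorphic_on {z. Im z > 0}" and a: "a > 0" and b: "b > 0"
    and B: "\<And>z. Im z \<ge> a \<Longrightarrow> norm (g z) \<le> B"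
  shows "integrable lborel (\<lambda>u. of_real (Poisson_kernel b (x - u)) * g (Complex u a))"
    and "(\<integral>u. of_real (Poisson_kernel b (x - u)) * g (Complex u a) \<partial>lborel) = g (Complex x (a + b))"
proof -
  let ?P = "\<lambda>u. of_real (Poisson_kernel b (x - u)) * g (Complex u a)"
  note [measurable] = borel_measurable_horizontal[OF g a]
  have B0: "B \<ge> 0" using order_trans[OF norm_ge_zero B[of "Complex 0 a"]] by simp
  show int: "integrable lborel ?P"
  proof (rule Bochner_Integration.integrable_bound)
    show "integrable lborel (\<lambda>u. Poisson_kernel b (x - u) * B)"
      using b by (intro integrable_mult_left integrable_Poisson_kernel)
    show "AE u in lborel. norm (?P u) \<le> norm (Poisson_kernel b (x - u) * B)"
    proof (rule AE_I2)
      fix u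
      have "Poisson_kernel b (x - u) * norm (g (Complex u a)) \<le> Poisson_kernel b (x - u) * B"
        using b by (intro mult_left_mono B Poisson_kernel_nonneg) auto
      then show "norm (?P u) \<le> norm (Poisson_kernel b (x - u) * B)"
        using b B0 by (simp add: norm_mult Poisson_kernel_nonneg)
    qed
  qed measurable
  define z z' where "z = Complex x (a + b)" and "z' = Complex x (a - b)"
  \<comment> \<open>\<open>(z - z') / ((w - z') (w - z))\<close> is the difference of the two Cauchy kernels.\<close>
  define h where "h = (\<lambda>w. g w * (z - z') / (w - z') / (w - z))"
  have zz': "z - z' = 2 * of_real b * \<i>" by (simp add: z_def z'_def complex_eq_iff)
  have bottom: "h (Complex u a) = 2 * of_real pi * \<i> * ?P u" for u
  proof -
    have "(Complex u a - z') * (Complex u a - z) = of_real ((x - u)\<^sup>2 + b\<^sup>2)"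
      by (simp add: z_def z'_def complex_eq_iff power2_eq_square algebra_simps)
    then show ?thesis unfolding h_def zz' Poisson_kernel_def divide_divide_eq_left by simp
  qed
  have formula: "box_integral (x - R) (x + R) a (a + R) h = 2 * of_real pi * \<i> * g z" if R: "R > b" for R
  proof -
    have "(\<lambda>w. g w * (z - z') / (w - z')) holomorphic_on cbox (Complex (x - R) a) (Complex (x + R) (a + R))"
      using a b by (intro holomorphic_intros holomorphic_on_subset[OF g])
         (auto simp: in_cbox_complex_iff z'_def)
    moreover have "z \<in> box (Complex (x - R) a) (Complex (x + R) (a + R))"
      using R b by (simp add: in_box_complex_iff z_def)
    ultimately have "box_integral (x - R) (x + R) a (a + R) h = 2 * of_real pi * \<i> * (g z * (z - z') / (z - z'))"
      unfolding h_def by (rule box_integral_Cauchy)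
    moreover have "z - z' \<noteq> 0" unfolding zz' using b by simp
    ultimately show ?thesis by simp
  qed
  let ?E = "\<lambda>R. 8 * B * b / R\<^sup>2"
  have bound: "norm (h w) \<le> ?E R"
    if R: "R \<ge> 2 * b" and w: "Im w \<ge> a" "\<bar>Re w - x\<bar> = R \<or> Im w = a + R" for w R
  proof -
    have R0: "R > 0" using R b by auto
    have "R / 2 \<le> norm (w - z)" "R / 2 \<le> norm (w - z')"
      using w R R0 b abs_Re_le_cmod[of "w - z"] abs_Im_le_cmod[of "w - z"]
        abs_Re_le_cmod[of "w - z'"] abs_Im_le_cmod[of "w - z'"] by (auto simp: z_def z'_def)
    then have "(R / 2) * (R / 2) \<le> norm (w - z') * norm (w - z)"
      using R0 by (intro mult_mono) auto
    moreover have "norm (h w) = norm (g w) * (2 * b) / (norm (w - z') * norm (w - z))"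
      unfolding h_def norm_divide norm_mult divide_divide_eq_left zz' using b by simp
    moreover have "norm (g w) * (2 * b) \<le> B * (2 * b)"
      using B[OF w(1)] b by (intro mult_right_mono) auto
    ultimately have "norm (h w) \<le> B * (2 * b) / ((R / 2) * (R / 2))"
      using B0 b R0 by (simp only:) (intro frac_le; simp)
    then show ?thesis by (simp add: power2_eq_square)
  qed
  have cont: "continuous_on A (\<lambda>t. h (\<phi> t))" if "continuous_on A \<phi>"
    "\<And>t. t \<in> A \<Longrightarrow> Im (\<phi> t) \<ge> a \<and> (\<bar>Re (\<phi> t) - x\<bar> = R \<or> Im (\<phi> t) = a + R)" "R > b" for A R and \<phi> :: "real \<Rightarrow> complex"
  proof -
    have "\<phi> t \<noteq> z" "\<phi> t \<noteq> z'" "Im (\<phi> t) > 0" if "t \<in> A" for t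
      using that(1) \<open>t \<in> A \<Longrightarrow> Im (\<phi> t) \<ge> a \<and> (\<bar>Re (\<phi> t) - x\<bar> = R \<or> Im (\<phi> t) = a + R)\<close> \<open>R > b\<close> a b
      by (auto simp: z_def z'_def)
    then show ?thesis
      unfolding h_def
      by (intro continuous_intros that(1) continuous_on_compose2[OF holomorphic_on_imp_continuous_on[OF g] that(1)]) auto
  qed
  have diff: "norm (integral {x - R..x + R} (\<lambda>u. h (Complex u a)) - 2 * of_real pi * \<i> * g z) \<le> ?E R * (4 * R)"
    if R: "R \<ge> 2 * b" for R
  proof -
    have R0: "R > b" "R > 0" using R b by auto
    let ?t = "integral {x - R..x + R} (\<lambda>u. h (Complex u (a + R)))"
    let ?l = "\<i> * integral {a..a + R} (\<lambda>v. h (Complex (x - R) v))"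
    let ?r = "\<i> * integral {a..a + R} (\<lambda>v. h (Complex (x + R) v))"
    have "integral {x - R..x + R} (\<lambda>u. h (Complex u a)) - 2 * of_real pi * \<i> * g z = ?t + ?l - ?r"
      using formula[OF R0(1)] by (simp add: box_integral_def algebra_simps)
    moreover have "norm ?t \<le> ?E R * ((x + R) - (x - R))"
      using R0 by (intro integral_bound cont[of _ _ R] bound[OF R])
         (auto simp: Complex_eq intro!: continuous_intros)
    moreover have "norm ?l \<le> ?E R * ((a + R) - a)"
      unfolding norm_mult norm_ii mult_1
      using R0 by (intro integral_bound cont[of _ _ R] bound[OF R])
         (auto simp: Complex_eq intro!: continuous_intros)
    moreover have "norm ?r \<le> ?E R * ((a + R) - a)"
      unfolding norm_mult norm_ii mult_1
      using R0 by (intro integral_bound cont[of _ _ R] bound[OF R])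
         (auto simp: Complex_eq intro!: continuous_intros)
    ultimately have "norm (integral {x - R..x + R} (\<lambda>u. h (Complex u a)) - 2 * of_real pi * \<i> * g z)
       \<le> ?E R * ((x + R) - (x - R)) + ?E R * ((a + R) - a) + ?E R * ((a + R) - a)"
      by (simp only: norm_add_diff_le)
    also have "\<dots> = ?E R * (4 * R)" by (simp add: algebra_simps)
    finally show ?thesis .
  qed
  have "((\<lambda>R. integral {x - R..x + R} (\<lambda>u. h (Complex u a)) - 2 * of_real pi * \<i> * g z) \<longlongrightarrow> 0) at_top"
  proof (rule Lim_null_comparison)
    show "eventually (\<lambda>R. norm (integral {x - R..x + R} (\<lambda>u. h (Complex u a)) - 2 * of_real pi * \<i> * g z) \<le> 32 * B * b * inverse R) at_top"
      using eventually_ge_at_top[of "2 * b"] eventually_gt_at_top[of 0]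
      by eventually_elim (use diff in \<open>force simp: power2_eq_square field_simps\<close>)
    show "((\<lambda>R. 32 * B * b * inverse R) \<longlongrightarrow> 0) at_top"
      using tendsto_mult_right_zero[OF tendsto_inverse_0_at_top[OF filterlim_ident]] by blast
  qed
  then have "((\<lambda>R. integral {x - R..x + R} (\<lambda>u. 2 * of_real pi * \<i> * ?P u)) \<longlongrightarrow> 2 * of_real pi * \<i> * g z) at_top"
    unfolding bottom by (simp add: LIM_zero_iff)
  moreover have "((\<lambda>R. integral {x - R..x + R} (\<lambda>u. 2 * of_real pi * \<i> * ?P u)) \<longlongrightarrow>
      (\<integral>u. 2 * of_real pi * \<i> * ?P u \<partial>lborel)) at_top"
    by (intro tendsto_integral_symmetric integrable_mult_right int)
  ultimately have "2 * of_real pi * \<i> * g z = (\<integral>u. 2 * of_real pi * \<i> * ?P u \<partial>lborel)"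
    using tendsto_unique trivial_limit_at_top_linorder by blast
  then show "(\<integral>u. ?P u \<partial>lborel) = g (Complex x (a + b))"
    unfolding integral_mult_right_zero by (simp add: z_def)
qed

text \<open>
This is the Poisson formula for the constant function 1.
\<close>
lemma integral_Poisson_kernel:
  assumes "b > 0"
  shows "(\<integral>u. Poisson_kernel b (x - u) \<partial>lborel) = 1"
proof -
  have "(\<integral>u. of_real (Poisson_kernel b (x - u)) * 1 \<partial>lborel) = (1::complex)"
    by (rule half_plane_Poisson_formula(2)[where a = 1 and B = 1]) (use assms in auto)
  then have "complex_of_real (\<integral>u. Poisson_kernel b (x - u) \<partial>lborel) = 1"
    by simp
  then show ?thesis using of_real_eq_1_iff by blast
qed

lemma nn_integral_Poisson_kernel:
  assumes "b > 0"
  shows "(\<integral>\<^sup>+u. ennreal (Poisson_kernel b (x - u)) \<partial>lborel) = 1"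
proof -
  have "(\<integral>\<^sup>+u. ennreal (Poisson_kernel b (x - u)) \<partial>lborel) = ennreal (\<integral>u. Poisson_kernel b (x - u) \<partial>lborel)"
    using assms by (intro nn_integral_eq_integral integrable_Poisson_kernel AE_I2 Poisson_kernel_nonneg) auto
  then show ?thesis using integral_Poisson_kernel[OF assms] by simp
qed

lemma half_plane_Poisson_Jensen:
  assumes p: "1 < p" and g: "g holomorphic_on {z. Im z > 0}" and a: "a > 0" and b: "b > 0"
    and B: "\<And>z. Im z \<ge> a \<Longrightarrow> norm (g z) \<le> B"
  shows "ennreal (norm (g (Complex x (a + b))) powr p) \<le>
     (\<integral>\<^sup>+u. ennreal (Poisson_kernel b (x - u)) * ennreal (norm (g (Complex u a)) powr p) \<partial>lborel)"
proof -
  let ?k = "\<lambda>u. Poisson_kernel b (x - u)" and ?h = "\<lambda>u. norm (g (Complex u a))"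
  note [measurable] = borel_measurable_horizontal[OF g a]
  have k0: "?k u \<ge> 0" for u using b by (simp add: Poisson_kernel_nonneg)
  have B0: "B \<ge> 0" using order_trans[OF norm_ge_zero B[of "Complex 0 a"]] by simp
  have int: "integrable lborel (\<lambda>u. ?k u * ?h u)"
    using integrable_norm[OF half_plane_Poisson_formula(1)[OF g a b B, of x]] k0
    by (simp add: norm_mult)
  have int_p: "integrable lborel (\<lambda>u. ?k u * ?h u powr p)"
  proof (rule Bochner_Integration.integrable_bound)
    show "integrable lborel (\<lambda>u. ?k u * B powr p)"
      using b by (intro integrable_mult_left integrable_Poisson_kernel)
    show "AE u in lborel. norm (?k u * ?h u powr p) \<le> norm (?k u * B powr p)"
    proof (rule AE_I2)
      fix u
      have "?k u * ?h u powr p \<le> ?k u * B powr p"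
        using p by (intro mult_left_mono powr_mono2 B k0) auto
      then show "norm (?k u * ?h u powr p) \<le> norm (?k u * B powr p)"
        using k0 by (simp add: norm_mult)
    qed
  qed measurable
  have "norm (g (Complex x (a + b))) \<le> (\<integral>u. norm (of_real (?k u) * g (Complex u a)) \<partial>lborel)"
    by (subst half_plane_Poisson_formula(2)[OF g a b B, of x, symmetric]) (assumption | rule integral_norm_bound)+
  also have "\<dots> = (\<integral>u. ?k u * ?h u \<partial>lborel)" using k0 by (simp add: norm_mult)
  finally have "norm (g (Complex x (a + b))) powr p \<le> (\<integral>u. ?k u * ?h u \<partial>lborel) powr p"
    using p by (intro powr_mono2) auto
  also have "\<dots> \<le> (\<integral>u. ?k u * ?h u powr p \<partial>lborel)"
    using p k0 int int_p b
    by (intro Jensen_powr) (auto simp: integral_Poisson_kernel integrable_Poisson_kernel)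
  finally have "ennreal (norm (g (Complex x (a + b))) powr p) \<le> ennreal (\<integral>u. ?k u * ?h u powr p \<partial>lborel)"
    by (rule ennreal_leI)
  also have "\<dots> = (\<integral>\<^sup>+u. ennreal (?k u * ?h u powr p) \<partial>lborel)"
    using k0 by (intro nn_integral_eq_integral[symmetric] int_p) auto
  finally show ?thesis using k0 by (simp add: ennreal_mult)
qed

text \<open>
A higher slice is the Poisson average of a lower one: integrate the Jensen bound over \<open>x\<close> and exchange
the integrals.
\<close>
lemma Lp_pow_horizontal_antimono:
  assumes p: "1 < p" and g: "g holomorphic_on {z. Im z > 0}" and a: "0 < a" "a \<le> c"
    and B: "\<And>z. Im z \<ge> a \<Longrightarrow> norm (g z) \<le> B"
  shows "Lp_pow p (\<lambda>x. g (Complex x c)) \<le> Lp_pow p (\<lambda>x. g (Complex x a))"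
proof (cases "a = c")
  case False
  define b where "b = c - a"
  have b: "b > 0" "c = a + b" using False a by (auto simp: b_def)
  note [measurable] = borel_measurable_horizontal[OF g a(1)]
  have "Lp_pow p (\<lambda>x. g (Complex x c)) \<le>
     (\<integral>\<^sup>+x. \<integral>\<^sup>+u. ennreal (Poisson_kernel b (x - u)) * ennreal (norm (g (Complex u a)) powr p) \<partial>lborel \<partial>lborel)"
    unfolding Lp_pow_def b(2) by (intro nn_integral_mono half_plane_Poisson_Jensen[where B = B] p g a b B)
  also have "\<dots> = (\<integral>\<^sup>+u. \<integral>\<^sup>+x. ennreal (Poisson_kernel b (x - u)) * ennreal (norm (g (Complex u a)) powr p) \<partial>lborel \<partial>lborel)"
    by (rule lborel_pair.Fubini') measurable
  also have "\<dots> = (\<integral>\<^sup>+u. (\<integral>\<^sup>+x. ennreal (Poisson_kernel b (u - x)) \<partial>lborel) * ennreal (norm (g (Complex u a)) powr p) \<partial>lborel)"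
    unfolding Poisson_kernel_minus[of b _ _] by (intro nn_integral_cong nn_integral_multc) measurable
  also have "\<dots> = Lp_pow p (\<lambda>x. g (Complex x a))"
    using b by (simp add: nn_integral_Poisson_kernel Lp_pow_def)
  finally show ?thesis .
qed simp

section \<open>Fatou's lemma for convergent sequences\<close>

lemma nn_integral_le_of_AE_tendsto:
  fixes h :: "nat \<Rightarrow> 'a \<Rightarrow> ennreal"
  assumes [measurable]: "\<And>n. h n \<in> borel_measurable M"
    and lim: "AE x in M. (\<lambda>n. h n x) \<longlonglongrightarrow> h' x"
    and le: "\<And>n. n \<ge> N \<Longrightarrow> (\<integral>\<^sup>+x. h n x \<partial>M) \<le> c"
  shows "(\<integral>\<^sup>+x. h' x \<partial>M) \<le> c"
proof -
  have "(\<integral>\<^sup>+x. h' x \<partial>M) = (\<integral>\<^sup>+x. liminf (\<lambda>n. h n x) \<partial>M)"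
  proof (rule nn_integral_cong_AE)
    show "AE x in M. h' x = liminf (\<lambda>n. h n x)"
      using lim by eventually_elim (auto intro!: lim_imp_Liminf[symmetric])
  qed
  also have "\<dots> \<le> liminf (\<lambda>n. \<integral>\<^sup>+x. h n x \<partial>M)"
    by (intro nn_integral_liminf) measurable
  also have "\<dots> \<le> limsup (\<lambda>n. \<integral>\<^sup>+x. h n x \<partial>M)" by (intro Liminf_le_Limsup) auto
  also have "\<dots> \<le> c" by (intro Limsup_bounded) (auto simp: eventually_sequentially intro: le)
  finally show ?thesis .
qed

lemma tendsto_norm_powr_ennreal:
  fixes f :: "'b \<Rightarrow> complex"
  assumes "p > 0" "(f \<longlongrightarrow> l) \<F>"
  shows "((\<lambda>x. ennreal (norm (f x) powr p)) \<longlongrightarrow> ennreal (norm l powr p)) \<F>"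
  using assms by (intro tendsto_ennrealI tendsto_powr' tendsto_norm tendsto_const) auto

lemma Lp_pow_Fatou:
  assumes p: "p > 0" and u: "\<And>n. u n \<in> borel_measurable borel"
    and lim: "AE x in lborel. (\<lambda>n. u n x) \<longlonglongrightarrow> v x"
    and le: "\<And>n. n \<ge> N \<Longrightarrow> Lp_pow p (u n) \<le> c"
  shows "Lp_pow p v \<le> c"
  unfolding Lp_pow_def
proof (rule nn_integral_le_of_AE_tendsto)
  show "(\<lambda>x. ennreal (norm (u n x) powr p)) \<in> borel_measurable lborel" for n
    using u by measurable
  show "AE x in lborel. (\<lambda>n. ennreal (norm (u n x) powr p)) \<longlonglongrightarrow> ennreal (norm (v x) powr p)"
    using lim by eventually_elim (rule tendsto_norm_powr_ennreal[OF p])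
  show "(\<integral>\<^sup>+x. ennreal (norm (u n x) powr p) \<partial>lborel) \<le> c" if "n \<ge> N" for n
    using le[OF that] by (simp add: Lp_pow_def)
qed

section \<open>Uniform convexity makes the horizontal slices Cauchy\<close>

definition raise :: "real \<Rightarrow> (complex \<Rightarrow> complex) \<Rightarrow> complex \<Rightarrow> complex" where
  "raise \<epsilon> f z = f (z + \<i> * of_real \<epsilon>)"

lemma raise_Complex [simp]: "raise \<epsilon> f (Complex x y) = f (Complex x (y + \<epsilon>))"
  by (simp add: raise_def complex_eq_iff arg_cong[where f = f] Complex_eq algebra_simps)

lemma holomorphic_raise:
  assumes "f holomorphic_on {z. Im z > 0}" "\<epsilon> \<ge> 0"
  shows "raise \<epsilon> f holomorphic_on {z. Im z > 0}"
  unfolding raise_def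
  by (rule holomorphic_on_compose_gen[OF _ assms(1), unfolded o_def])
     (use assms in \<open>auto intro!: holomorphic_intros\<close>)

lemma half_plane_Hp_bounded:
  assumes p: "1 < p" and K: "K > 0" and f: "half_plane_Hp p K f" and a: "a > 0"
  obtains B where "\<And>z. Im z \<ge> a \<Longrightarrow> norm (f z) \<le> B"
proof -
  obtain C where C: "C > 0" "\<And>z. Im z > 0 \<Longrightarrow> norm (f z) \<le> C * Im z powr (- 1 / p)"
    using half_plane_Hp_pointwise[OF p K f] by blast
  have "norm (f z) \<le> C * a powr (- 1 / p)" if "Im z \<ge> a" for z
  proof -
    have "norm (f z) \<le> C * Im z powr (- 1 / p)" using that a by (intro C) auto
    also have "\<dots> \<le> C * a powr (- 1 / p)" using that a p C(1) by (intro mult_left_mono powr_mono2') auto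
    finally show ?thesis .
  qed
  then show ?thesis using that by blast
qed

text \<open>
Let \<open>L\<close> be the supremum of \<open>\<parallel>f\<^sub>y\<parallel>\<^sup>p\<close> over \<open>y > 0\<close>, and write \<open>D\<close> and \<open>M\<close> for the \<open>p\<close>-th powers of the
norms of the differences \<open>f\<^sub>y - f\<^bsub>y+\<epsilon>\<^esub>\<close> and of the midpoints. Uniform convexity bounds \<open>D\<close> by a small multiple of
the norms plus a multiple of \<open>L - M\<close>, so \<open>M\<close> must be shown to be close to \<open>L\<close>. At a fixed height \<open>t\<close> with
\<open>\<parallel>f\<^sub>t\<parallel>\<^sup>p\<close> close to \<open>L\<close> this holds for small \<open>\<epsilon>\<close> by Fatou's lemma; monotonicity in the height carries it
down to all \<open>y \<le> t\<close>, and then carries the bound on \<open>D\<close> up to all \<open>y\<close>.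
\<close>
lemma half_plane_Lp_Cauchy:
  assumes p: "1 < p" and K: "K > 0" and f: "half_plane_Hp p K f" and e: "e > 0"
  obtains d where "d > 0"
    "\<And>\<epsilon> y. \<lbrakk>0 < \<epsilon>; \<epsilon> < d; y > 0\<rbrakk> \<Longrightarrow> Lp_pow p (\<lambda>x. f (Complex x y) - f (Complex x (y + \<epsilon>))) \<le> ennreal e"
proof -
  from f have holo: "f holomorphic_on {z. Im z > 0}"
    and Lp: "\<And>y. y > 0 \<Longrightarrow> Lp_pow p (\<lambda>x. f (Complex x y)) \<le> ennreal K"
    by (auto simp: half_plane_Hp_def)
  define \<Phi> where "\<Phi> = (\<lambda>y. Lp_pow p (\<lambda>x. f (Complex x y)))"
  define D where "D = (\<lambda>\<epsilon> y. Lp_pow p (\<lambda>x. f (Complex x y) - f (Complex x (y + \<epsilon>))))"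
  define M where "M = (\<lambda>\<epsilon> y. Lp_pow p (\<lambda>x. (f (Complex x y) + f (Complex x (y + \<epsilon>))) / 2))"
  have D_mono: "D \<epsilon> y \<le> D \<epsilon> t" and M_mono: "M \<epsilon> y \<le> M \<epsilon> t"
    if ty: "0 < t" "t \<le> y" "\<epsilon> \<ge> 0" for \<epsilon> t y
  proof -
    obtain B where B: "\<And>z. Im z \<ge> t \<Longrightarrow> norm (f z) \<le> B"
      using half_plane_Hp_bounded[OF p K f ty(1)] by blast
    have B': "norm (raise \<epsilon> f z) \<le> B" if "Im z \<ge> t" for z
      unfolding raise_def using that \<open>\<epsilon> \<ge> 0\<close> by (intro B) auto
    have "norm (f z - raise \<epsilon> f z) \<le> B + B" if "Im z \<ge> t" for z
      using B[OF that] B'[OF that] norm_triangle_ineq4[of "f z" "raise \<epsilon> f z"] by linarith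
    moreover have "(\<lambda>z. f z - raise \<epsilon> f z) holomorphic_on {z. Im z > 0}"
      using ty holo by (intro holomorphic_intros holomorphic_raise) auto
    ultimately show "D \<epsilon> y \<le> D \<epsilon> t"
      using Lp_pow_horizontal_antimono[OF p _ ty(1,2), of "\<lambda>z. f z - raise \<epsilon> f z" "B + B"] by (simp add: D_def)
    have "norm ((f z + raise \<epsilon> f z) / 2) \<le> B" if "Im z \<ge> t" for z
      using B[OF that] B'[OF that] norm_triangle_ineq[of "f z" "raise \<epsilon> f z"] by (simp add: norm_divide)
    moreover have "(\<lambda>z. (f z + raise \<epsilon> f z) / 2) holomorphic_on {z. Im z > 0}"
      using ty holo by (intro holomorphic_intros holomorphic_raise) auto
    ultimately show "M \<epsilon> y \<le> M \<epsilon> t"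
      using Lp_pow_horizontal_antimono[OF p _ ty(1,2), of "\<lambda>z. (f z + raise \<epsilon> f z) / 2" B] by (simp add: M_def)
  qed
  define \<phi> where "\<phi> = (\<lambda>y. enn2real (\<Phi> y))"
  have \<Phi>: "\<Phi> y = ennreal (\<phi> y)" "\<phi> y \<le> K" "\<phi> y \<ge> 0" if "y > 0" for y
  proof -
    have "\<Phi> y \<le> ennreal K" using Lp[OF that] by (simp add: \<Phi>_def)
    then show "\<Phi> y = ennreal (\<phi> y)" "\<phi> y \<le> K" "\<phi> y \<ge> 0"
      using K unfolding \<phi>_def by (auto simp: enn2real_leI ennreal_enn2real_if top_unique)
  qed
  define L where "L = (SUP y\<in>{0<..}. \<phi> y)"
  have bdd: "bdd_above (\<phi> ` {0<..})" using \<Phi>(2) by (auto intro!: bdd_aboveI2)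
  have le_L: "\<phi> y \<le> L" if "y > 0" for y unfolding L_def using that bdd by (intro cSUP_upper) auto
  \<comment> \<open>Two slices contribute at most \<open>2K\<close>, so the first term is at most \<open>e / 2\<close>.\<close>
  define \<eta> where "\<eta> = e / (4 * K)"
  have \<eta>: "\<eta> > 0" using e K by (simp add: \<eta>_def)
  obtain C where C: "C > 0" "\<And>a b :: complex. norm (a - b) powr p \<le>
     \<eta> * (norm a powr p + norm b powr p) + C * ((norm a powr p + norm b powr p) / 2 - norm ((a + b) / 2) powr p)"
    using uniform_convexity_powr[OF p \<eta>] by blast
  \<comment> \<open>The gap \<open>L - M\<close> will be less than \<open>2\<kappa>\<close>, once for \<open>t\<close> and once for \<open>\<epsilon>\<close>.\<close>
  define \<kappa> where "\<kappa> = e / (4 * C)"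
  have \<kappa>: "\<kappa> > 0" using e C by (simp add: \<kappa>_def)
  have conv: "D \<epsilon> y + ennreal C * M \<epsilon> y \<le> ennreal (e / 2 + C * L)" if "y > 0" "\<epsilon> > 0" for \<epsilon> y
  proof -
    have "y + \<epsilon> > 0" using that by simp
    note [measurable] = borel_measurable_horizontal[OF holo \<open>y > 0\<close>] borel_measurable_horizontal[OF holo \<open>y + \<epsilon> > 0\<close>]
    let ?a = "\<lambda>x. f (Complex x y)" and ?b = "\<lambda>x. f (Complex x (y + \<epsilon>))"
    have "D \<epsilon> y + ennreal C * M \<epsilon> y =
       (\<integral>\<^sup>+x. ennreal (norm (?a x - ?b x) powr p) + ennreal C * ennreal (norm ((?a x + ?b x) / 2) powr p) \<partial>lborel)"
      by (simp add: D_def M_def Lp_pow_def nn_integral_add nn_integral_cmult del: norm_divide_numeral)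
    also have "\<dots> \<le> (\<integral>\<^sup>+x. ennreal (\<eta> + C / 2) * ennreal (norm (?a x) powr p) + ennreal (\<eta> + C / 2) * ennreal (norm (?b x) powr p) \<partial>lborel)"
    proof (intro nn_integral_mono)
      fix x
      have "norm (?a x - ?b x) powr p + C * norm ((?a x + ?b x) / 2) powr p \<le>
          (\<eta> + C / 2) * norm (?a x) powr p + (\<eta> + C / 2) * norm (?b x) powr p"
      proof -
        have "X + C * N \<le> (\<eta> + C / 2) * A + (\<eta> + C / 2) * B"
          if "X \<le> \<eta> * (A + B) + C * ((A + B) / 2 - N)" for X A B N
          using that by (simp add: field_simps)
        then show ?thesis using C(2) .
      qed
      then have "ennreal (norm (?a x - ?b x) powr p + C * norm ((?a x + ?b x) / 2) powr p) \<le>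
          ennreal ((\<eta> + C / 2) * norm (?a x) powr p + (\<eta> + C / 2) * norm (?b x) powr p)"
        by (rule ennreal_leI)
      then show "ennreal (norm (?a x - ?b x) powr p) + ennreal C * ennreal (norm ((?a x + ?b x) / 2) powr p)
         \<le> ennreal (\<eta> + C / 2) * ennreal (norm (?a x) powr p) + ennreal (\<eta> + C / 2) * ennreal (norm (?b x) powr p)"
        using C(1) \<eta> by (simp only: ennreal_plus ennreal_mult mult_nonneg_nonneg add_nonneg_nonneg powr_ge_zero less_imp_le divide_nonneg_pos zero_less_numeral)
    qed
    also have "\<dots> = ennreal (\<eta> + C / 2) * \<Phi> y + ennreal (\<eta> + C / 2) * \<Phi> (y + \<epsilon>)"
      by (simp add: \<Phi>_def Lp_pow_def nn_integral_add nn_integral_cmult)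
    also have "\<dots> = ennreal ((\<eta> + C / 2) * \<phi> y + (\<eta> + C / 2) * \<phi> (y + \<epsilon>))"
      using \<Phi>[OF that(1)] \<Phi>[OF \<open>y + \<epsilon> > 0\<close>] C(1) \<eta> by (simp add: ennreal_mult ennreal_plus)
    also have "\<dots> \<le> ennreal (e / 2 + C * L)"
    proof (rule ennreal_leI)
      have "(\<eta> + C / 2) * \<phi> y + (\<eta> + C / 2) * \<phi> (y + \<epsilon>) = \<eta> * (\<phi> y + \<phi> (y + \<epsilon>)) + C * ((\<phi> y + \<phi> (y + \<epsilon>)) / 2)"
        by (simp add: field_simps)
      also have "\<dots> \<le> \<eta> * (K + K) + C * ((L + L) / 2)"
        using \<Phi>(2)[OF that(1)] \<Phi>(2)[OF \<open>y + \<epsilon> > 0\<close>] le_L[OF that(1)] le_L[OF \<open>y + \<epsilon> > 0\<close>] \<eta> C(1)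
        by (intro add_mono mult_left_mono) auto
      also have "\<dots> = e / 2 + C * L" using K by (simp add: \<eta>_def)
      finally show "(\<eta> + C / 2) * \<phi> y + (\<eta> + C / 2) * \<phi> (y + \<epsilon>) \<le> e / 2 + C * L" .
    qed
    finally show ?thesis .
  qed
  obtain t where t: "t > 0" "\<phi> t > L - \<kappa>"
    using less_cSUP_iff[of "{0<..}" \<phi> "L - \<kappa>"] bdd \<kappa> by (auto simp: L_def[symmetric])
  have "\<exists>d>0. \<forall>\<epsilon>. 0 < \<epsilon> \<longrightarrow> \<epsilon> < d \<longrightarrow> ennreal (\<phi> t) < M \<epsilon> t + ennreal \<kappa>"
  proof (rule ccontr)
    assume "\<not> ?thesis"
    then have "\<forall>n. \<exists>\<epsilon>. 0 < \<epsilon> \<and> \<epsilon> < inverse (real (Suc n)) \<and> M \<epsilon> t + ennreal \<kappa> \<le> ennreal (\<phi> t)"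
      by (meson inverse_positive_iff_positive not_le of_nat_0_less_iff zero_less_Suc)
    then obtain \<epsilon> where \<epsilon>: "\<And>n. 0 < \<epsilon> n" "\<And>n. \<epsilon> n < inverse (real (Suc n))"
      "\<And>n. M (\<epsilon> n) t + ennreal \<kappa> \<le> ennreal (\<phi> t)"
      by metis
    have M_le: "M (\<epsilon> n) t \<le> ennreal (\<phi> t - \<kappa>)" and \<kappa>_le: "\<kappa> \<le> \<phi> t" for n
    proof -
      have "M (\<epsilon> n) t \<noteq> top" using \<epsilon>(3)[of n] by (auto simp: top_unique)
      then obtain r where r: "r \<ge> 0" "M (\<epsilon> n) t = ennreal r" by (cases "M (\<epsilon> n) t") auto
      then have "r + \<kappa> \<le> \<phi> t"
        using \<epsilon>(3)[of n] \<kappa> \<Phi>(3)[OF t(1)] by (simp flip: ennreal_plus)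
      then show "M (\<epsilon> n) t \<le> ennreal (\<phi> t - \<kappa>)" "\<kappa> \<le> \<phi> t"
        using r by (auto intro: ennreal_leI)
    qed
    have lim: "\<epsilon> \<longlonglongrightarrow> 0"
      by (rule real_tendsto_sandwich[OF _ _ tendsto_const LIMSEQ_inverse_real_of_nat])
         (use \<epsilon> in \<open>auto intro!: always_eventually less_imp_le simp del: of_nat_Suc\<close>)
    have "\<Phi> t \<le> ennreal (\<phi> t - \<kappa>)"
      unfolding \<Phi>_def
    proof (rule Lp_pow_Fatou[where u = "\<lambda>n x. (f (Complex x t) + f (Complex x (t + \<epsilon> n))) / 2" and N = 0])
      show "(\<lambda>x. (f (Complex x t) + f (Complex x (t + \<epsilon> n))) / 2) \<in> borel_measurable borel" for n
      proof -
        have "t + \<epsilon> n > 0" using t(1) \<epsilon>(1)[of n] by simp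
        note [measurable] = borel_measurable_horizontal[OF holo t(1)] borel_measurable_horizontal[OF holo this]
        show ?thesis by measurable
      qed
      show "AE x in lborel. (\<lambda>n. (f (Complex x t) + f (Complex x (t + \<epsilon> n))) / 2) \<longlonglongrightarrow> f (Complex x t)"
      proof (rule AE_I2)
        fix x
        have "isCont f (Complex x t)"
          using holomorphic_on_imp_continuous_on[OF holo] t(1)
          by (simp add: continuous_on_eq_continuous_at open_halfspace_Im_gt)
        moreover have "(\<lambda>n. Complex x (t + \<epsilon> n)) \<longlonglongrightarrow> Complex x (t + 0)"
          by (intro tendsto_Complex tendsto_intros lim)
        ultimately have "(\<lambda>n. f (Complex x (t + \<epsilon> n))) \<longlonglongrightarrow> f (Complex x t)"
          by (auto intro: isCont_tendsto_compose)
        then have "(\<lambda>n. (f (Complex x t) + f (Complex x (t + \<epsilon> n))) / 2) \<longlonglongrightarrow> (f (Complex x t) + f (Complex x t)) / 2"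
          by (intro tendsto_intros) auto
        then show "(\<lambda>n. (f (Complex x t) + f (Complex x (t + \<epsilon> n))) / 2) \<longlonglongrightarrow> f (Complex x t)" by simp
      qed
    qed (use M_le p in \<open>auto simp: M_def\<close>)
    then show False
      using \<Phi>(1)[OF t(1)] \<kappa>_le \<kappa> by simp
  qed
  then obtain d where d: "d > 0" "\<And>\<epsilon>. 0 < \<epsilon> \<Longrightarrow> \<epsilon> < d \<Longrightarrow> ennreal (\<phi> t) < M \<epsilon> t + ennreal \<kappa>"
    by blast
  show ?thesis
  proof (rule that[OF d(1)])
    fix \<epsilon> y :: real assume \<epsilon>: "0 < \<epsilon>" "\<epsilon> < d" and y: "y > 0"
    define y' where "y' = min y t"
    have y': "y' > 0" "y' \<le> y" "y' \<le> t" using y t by (auto simp: y'_def)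
    have "M \<epsilon> t \<le> M \<epsilon> y'" using M_mono[OF y'(1,3), of \<epsilon>] \<epsilon> by simp
    then have "ennreal (\<phi> t) \<le> M \<epsilon> y' + ennreal \<kappa>"
      using d(2)[OF \<epsilon>] by (meson add_right_mono less_imp_le order_trans)
    moreover have *: "D \<epsilon> y' + ennreal C * M \<epsilon> y' \<le> ennreal (e / 2 + C * L)"
      by (rule conv[OF y'(1) \<epsilon>(1)])
    moreover have "M \<epsilon> y' \<noteq> top" using * C(1) by (auto simp: top_unique ennreal_mult_top)
    then obtain m where m: "m \<ge> 0" "M \<epsilon> y' = ennreal m" by (cases "M \<epsilon> y'") auto
    moreover have "D \<epsilon> y' \<noteq> top" using * by (auto simp: top_unique)
    then obtain r where r: "r \<ge> 0" "D \<epsilon> y' = ennreal r" by (cases "D \<epsilon> y'") auto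
    have L0: "L \<ge> 0" using le_L[OF t(1)] \<Phi>(3)[OF t(1)] by simp
    ultimately have "\<phi> t \<le> m + \<kappa>" "r + C * m \<le> e / 2 + C * L"
      using \<kappa> C(1) e r \<Phi>(3)[OF t(1)] by (simp_all flip: ennreal_plus ennreal_mult)
    moreover have "C * (L - \<kappa>) \<le> C * (m + \<kappa>)"
      using \<open>\<phi> t \<le> m + \<kappa>\<close> t(2) C(1) by (intro mult_left_mono) auto
    moreover have "C * \<kappa> = e / 4"
      using C(1) by (simp add: \<kappa>_def)
    ultimately have "r \<le> e" by (simp add: algebra_simps)
    then have "D \<epsilon> y' \<le> ennreal e" using r by (simp add: ennreal_leI)
    then show "Lp_pow p (\<lambda>x. f (Complex x y) - f (Complex x (y + \<epsilon>))) \<le> ennreal e"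
      using D_mono[OF y'(1,2), of \<epsilon>] \<epsilon> by (simp add: D_def)
  qed
qed

section \<open>A weak-type bound for the conical maximal function\<close>

text \<open>
For the least \<open>k\<close> with \<open>|t| \<le> 2\<^sup>k b\<close>, the \<open>k\<close>-th term alone majorizes the kernel.
\<close>
lemma Poisson_kernel_le_dyadic:
  assumes b: "b > 0"
  shows "ennreal (Poisson_kernel b t) \<le> (\<Sum>k. ennreal (4 / (pi * b) * (1 / 4) ^ k) * indicator {t. \<bar>t\<bar> \<le> 2 ^ k * b} t)"
proof -
  obtain k0 where "\<bar>t\<bar> / b < 2 ^ k0"
    using real_arch_pow[of 2 "\<bar>t\<bar> / b"] by auto
  then have k0: "\<bar>t\<bar> \<le> 2 ^ k0 * b" using b by (simp add: divide_less_eq)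
  define k where "k = (LEAST k. \<bar>t\<bar> \<le> 2 ^ k * b)"
  have k: "\<bar>t\<bar> \<le> 2 ^ k * b" unfolding k_def using k0 by (rule LeastI)
  have "Poisson_kernel b t \<le> 4 / (pi * b) * (1 / 4) ^ k"
  proof (cases k)
    case 0
    have "b / (pi * (t\<^sup>2 + b\<^sup>2)) \<le> b / (pi * b\<^sup>2)"
      using b by (intro divide_left_mono mult_left_mono mult_pos_pos add_nonneg_pos) auto
    also have "\<dots> \<le> 4 / (pi * b)" using b by (simp add: power2_eq_square divide_right_mono)
    finally show ?thesis using 0 by (simp add: Poisson_kernel_def)
  next
    case (Suc j)
    then have "\<not> \<bar>t\<bar> \<le> 2 ^ j * b" using not_less_Least[of j "\<lambda>k. \<bar>t\<bar> \<le> 2 ^ k * b"] by (simp add: k_def)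
    then have "(2 ^ j * b)\<^sup>2 \<le> \<bar>t\<bar>\<^sup>2" using b by (intro power_mono) auto
    moreover have "(2 ^ j * b)\<^sup>2 = 4 ^ j * b\<^sup>2"
    proof -
      have "(2 ^ j)\<^sup>2 = ((2::real)\<^sup>2) ^ j" by (simp only: power_mult[symmetric] mult.commute)
      then show ?thesis by (simp add: power_mult_distrib)
    qed
    ultimately have le: "4 ^ j * b\<^sup>2 \<le> t\<^sup>2 + b\<^sup>2" by (simp add: add_increasing2)
    have "b / (pi * (t\<^sup>2 + b\<^sup>2)) \<le> b / (pi * (4 ^ j * b\<^sup>2))"
      using b le by (intro divide_left_mono mult_left_mono mult_pos_pos add_nonneg_pos) auto
    also have "\<dots> = 4 / (pi * b) * (1 / 4) ^ k"
      using b Suc by (simp add: power2_eq_square power_divide)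
    finally show ?thesis by (simp add: Poisson_kernel_def)
  qed
  define f where "f = (\<lambda>i. ennreal (4 / (pi * b) * (1 / 4) ^ i) * indicator {t. \<bar>t\<bar> \<le> 2 ^ i * b} t)"
  have "ennreal (Poisson_kernel b t) \<le> f k"
    using \<open>Poisson_kernel b t \<le> _\<close> k by (simp add: f_def ennreal_leI)
  also have "f k \<le> (\<Sum>i. f i)" using sum_le_suminf[of f "{k}"] by simp
  finally show ?thesis by (simp only: f_def)
qed

text \<open>
If no dyadic interval of radius \<open>2\<^sup>k b\<close> about \<open>s\<close> carried a large integral, summing the dyadic majorant would
give the geometric series with sum \<open>8c/\<pi>\<close>.
\<close>
lemma large_Poisson_integral_imp_large_average:
  assumes b: "b > 0" and c: "c > 0" and h[measurable]: "h \<in> borel_measurable borel"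
    and large: "ennreal (8 * c / pi) < (\<integral>\<^sup>+u. ennreal (Poisson_kernel b (s - u)) * h u \<partial>lborel)"
  obtains r where "r \<ge> b" "ennreal (c * r) < (\<integral>\<^sup>+u. h u * indicator (cball s r) u \<partial>lborel)"
proof (rule ccontr)
  assume neg: "\<not> thesis"
  let ?a = "\<lambda>k. ennreal (4 / (pi * b) * (1 / 4) ^ k)"
  have [measurable]: "cball s r \<in> sets borel" for r by (intro borel_closed closed_cball)
  have le: "(\<integral>\<^sup>+u. h u * indicator (cball s (2 ^ k * b)) u \<partial>lborel) \<le> ennreal (c * (2 ^ k * b))" for k :: nat
  proof (rule ccontr)
    assume "\<not> ?thesis"
    moreover have "2 ^ k * b \<ge> b" using b by (simp add: mult_le_cancel_right1)
    ultimately show False using neg that[of "2 ^ k * b"] by (auto simp: not_le)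
  qed
  have "(\<integral>\<^sup>+u. ennreal (Poisson_kernel b (s - u)) * h u \<partial>lborel) \<le>
     (\<integral>\<^sup>+u. (\<Sum>k. ?a k * (h u * indicator (cball s (2 ^ k * b)) u)) \<partial>lborel)"
  proof (intro nn_integral_mono)
    fix u
    have "ennreal (Poisson_kernel b (s - u)) * h u \<le>
      (\<Sum>k. ?a k * indicator {t. \<bar>t\<bar> \<le> 2 ^ k * b} (s - u)) * h u"
      by (intro mult_right_mono Poisson_kernel_le_dyadic b) auto
    also have "\<dots> = (\<Sum>k. ?a k * indicator {t. \<bar>t\<bar> \<le> 2 ^ k * b} (s - u) * h u)"
      by (rule ennreal_suminf_multc[symmetric])
    also have "\<dots> = (\<Sum>k. ?a k * (h u * indicator (cball s (2 ^ k * b)) u))"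
      by (intro suminf_cong) (auto simp: indicator_def dist_real_def)
    finally show "ennreal (Poisson_kernel b (s - u)) * h u \<le> (\<Sum>k. ?a k * (h u * indicator (cball s (2 ^ k * b)) u))" .
  qed
  also have "\<dots> = (\<Sum>k. ?a k * (\<integral>\<^sup>+u. h u * indicator (cball s (2 ^ k * b)) u \<partial>lborel))"
    by (subst nn_integral_suminf) (auto simp: nn_integral_cmult)
  also have "\<dots> \<le> (\<Sum>k. ?a k * ennreal (c * (2 ^ k * b)))"
    by (intro suminf_le mult_left_mono le) auto
  also have "\<dots> = (\<Sum>k. ennreal (4 * c / pi * (1 / 2) ^ k))"
  proof (intro suminf_cong)
    fix k :: nat
    have "4 / (pi * b) * (1 / 4) ^ k * (c * (2 ^ k * b)) = 4 * c / pi * (1 / 2) ^ k"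
      using b by (simp add: power_divide field_simps flip: power_mult_distrib)
    moreover have "?a k * ennreal (c * (2 ^ k * b)) = ennreal (4 / (pi * b) * (1 / 4) ^ k * (c * (2 ^ k * b)))"
      by (rule ennreal_mult[symmetric]) (use b c in auto)
    ultimately show "?a k * ennreal (c * (2 ^ k * b)) = ennreal (4 * c / pi * (1 / 2) ^ k)" by simp
  qed
  also have "\<dots> = ennreal (8 * c / pi)"
  proof (rule suminf_ennreal_eq)
    have "(\<lambda>k. 4 * c / pi * (1 / 2) ^ k) sums (4 * c / pi * (1 / (1 - 1 / 2)))"
      by (intro sums_mult geometric_sums) auto
    then show "(\<lambda>k. 4 * c / pi * (1 / 2) ^ k) sums (8 * c / pi)" by simp
  qed (use c in auto)
  finally show False using large by simp
qed

text \<open>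
The maximal inequality of Hardy and Littlewood for intervals enlarged by the factor \<open>\<beta>\<close>: Vitali's
lemma selects disjoint enlarged intervals whose fivefold dilates cover \<open>S\<close>, and the integrals of \<open>h\<close> over the
original intervals, disjoint as well, sum to at most \<open>K\<close>.
\<close>
lemma emeasure_union_large_averages:
  assumes c: "c > 0" and h[measurable]: "h \<in> borel_measurable borel" and K: "K \<ge> 0" "(\<integral>\<^sup>+u. h u \<partial>lborel) \<le> ennreal K"
    and \<beta>: "\<beta> \<ge> 1" and S: "S \<in> sets borel"
    and cov: "\<And>x. x \<in> S \<Longrightarrow> \<exists>s r. r > 0 \<and> \<bar>s - x\<bar> \<le> \<beta> * r \<and> ennreal (c * r) < (\<integral>\<^sup>+u. h u * indicator (cball s r) u \<partial>lborel)"
  shows "emeasure lborel S \<le> ennreal (10 * \<beta> * K / c)"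
proof -
  let ?\<nu> = "density lborel h"
  define I where "I = {(s, r). r > 0 \<and> ennreal (c * r) < (\<integral>\<^sup>+u. h u * indicator (cball s r) u \<partial>lborel)}"
  have \<nu>: "emeasure ?\<nu> (cball s r) = (\<integral>\<^sup>+u. h u * indicator (cball s r) u \<partial>lborel)" for s r
    by (simp add: emeasure_density)
  have Ipos: "0 < \<beta> * snd i \<and> \<beta> * snd i \<le> \<beta> * (K / c)" if "i \<in> I" for i
  proof -
    have i: "snd i > 0" "ennreal (c * snd i) < (\<integral>\<^sup>+u. h u * indicator (cball (fst i) (snd i)) u \<partial>lborel)"
      using that by (auto simp: I_def case_prod_beta)
    note i(2)
    also have "(\<integral>\<^sup>+u. h u * indicator (cball (fst i) (snd i)) u \<partial>lborel) \<le> (\<integral>\<^sup>+u. h u \<partial>lborel)"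
      by (intro nn_integral_mono) (auto simp: indicator_def)
    also note K(2)
    finally have "c * snd i < K" using K by (simp add: ennreal_less_iff c i(1) less_imp_le)
    then have "snd i \<le> K / c" using c by (simp add: pos_le_divide_eq mult.commute)
    then have "\<beta> * snd i \<le> \<beta> * (K / c)" using \<beta> by (intro mult_left_mono) auto
    then show ?thesis using i(1) \<beta> by simp
  qed
  have "S \<subseteq> (\<Union>i\<in>I. cball (fst i) (\<beta> * snd i))"
  proof
    fix x assume "x \<in> S"
    from cov[OF this] obtain s r where "(s, r) \<in> I" "\<bar>s - x\<bar> \<le> \<beta> * r" by (auto simp: I_def)
    then show "x \<in> (\<Union>i\<in>I. cball (fst i) (\<beta> * snd i))"
      by (intro UN_I[of "(s, r)"]) (auto simp: dist_real_def)
  qed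
  then obtain C where C: "countable C" "C \<subseteq> I"
     "pairwise (\<lambda>i j. disjnt (cball (fst i) (\<beta> * snd i)) (cball (fst j) (\<beta> * snd j))) C"
     "S \<subseteq> (\<Union>i\<in>C. cball (fst i) (5 * (\<beta> * snd i)))"
    using Vitali_covering_lemma_cballs[where S = S and K = I and a = fst and r = "\<lambda>i. \<beta> * snd i" and B = "\<beta> * (K / c)"] Ipos by blast
  \<comment> \<open>Index the disjoint intervals by natural numbers, with empty sets at the unused indices.\<close>
  define J where "J = to_nat_on C ` C"
  define e where "e = from_nat_into C"
  have e: "e n \<in> C" if "n \<in> J" for n
    using that C(1) by (auto simp: J_def e_def)
  have e_inj: "n = m" if "n \<in> J" "m \<in> J" "e n = e m" for n m
    using that C(1) by (auto simp: J_def e_def)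
  have e_surj: "\<exists>n\<in>J. e n = i" if "i \<in> C" for i
    using that C(1) by (auto simp: J_def e_def)
  define U where "U = (\<lambda>n. if n \<in> J then cball (fst (e n)) (snd (e n)) else {})"
  define V where "V = (\<lambda>n. if n \<in> J then cball (fst (e n)) (5 * (\<beta> * snd (e n))) else {})"
  have disj: "disjoint_family U"
    unfolding disjoint_family_on_def
  proof (intro ballI impI)
    fix m n :: nat assume "m \<noteq> n"
    show "U m \<inter> U n = {}"
    proof (cases "m \<in> J \<and> n \<in> J")
      case True
      then have "disjnt (cball (fst (e m)) (\<beta> * snd (e m))) (cball (fst (e n)) (\<beta> * snd (e n)))"
        using C(3) e e_inj \<open>m \<noteq> n\<close> unfolding pairwise_def by blast
      moreover have "cball (fst (e k)) (snd (e k)) \<subseteq> cball (fst (e k)) (\<beta> * snd (e k))" if "k \<in> J" for k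
        using e[OF that] C(2) \<beta> by (intro subset_cball) (auto simp: I_def mult_le_cancel_right1)
      ultimately show ?thesis using True by (auto simp: U_def disjnt_def)
    qed (auto simp: U_def)
  qed
  have "S \<subseteq> (\<Union>n. V n)"
  proof
    fix x assume "x \<in> S"
    then obtain i where "i \<in> C" "x \<in> cball (fst i) (5 * (\<beta> * snd i))" using C(4) by blast
    then obtain n where "n \<in> J" "x \<in> cball (fst (e n)) (5 * (\<beta> * snd (e n)))" using e_surj by blast
    then show "x \<in> (\<Union>n. V n)" by (auto simp: V_def)
  qed
  then have "emeasure lborel S \<le> emeasure lborel (\<Union>n. V n)"
    by (intro emeasure_mono sets.countable_UN) (auto simp: V_def)
  also have "\<dots> \<le> (\<Sum>n. emeasure lborel (V n))"
    by (intro emeasure_subadditive_countably) (auto simp: V_def)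
  also have "\<dots> \<le> (\<Sum>n. ennreal (10 * \<beta> / c) * emeasure ?\<nu> (U n))"
  proof (intro suminf_le)
    fix n
    show "emeasure lborel (V n) \<le> ennreal (10 * \<beta> / c) * emeasure ?\<nu> (U n)"
    proof (cases "n \<in> J")
      case True
      let ?r = "snd (e n)"
      have r: "?r > 0" "ennreal (c * ?r) < emeasure ?\<nu> (U n)"
        using e[OF True] C(2) True by (auto simp: I_def U_def \<nu> case_prod_beta)
      have "emeasure lborel (V n) = ennreal (10 * \<beta> * ?r)"
        using True r(1) \<beta> by (simp add: V_def cball_eq_atLeastAtMost)
      also have "\<dots> = ennreal (10 * \<beta> / c) * ennreal (c * ?r)"
        using r(1) \<beta> c by (simp flip: ennreal_mult)
      also have "\<dots> \<le> ennreal (10 * \<beta> / c) * emeasure ?\<nu> (U n)"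
        using r(2) by (intro mult_left_mono) auto
      finally show ?thesis .
    qed (simp add: V_def)
  qed auto
  also have "\<dots> = ennreal (10 * \<beta> / c) * (\<Sum>n. emeasure ?\<nu> (U n))" by simp
  also have "(\<Sum>n. emeasure ?\<nu> (U n)) = emeasure ?\<nu> (\<Union>n. U n)"
    using disj by (intro suminf_emeasure) (auto simp: U_def)
  also have "\<dots> \<le> emeasure ?\<nu> (space ?\<nu>)" by (rule emeasure_space)
  also have "\<dots> = (\<integral>\<^sup>+u. h u \<partial>lborel)" by (simp add: emeasure_density)
  also have "\<dots> \<le> ennreal K" by (rule K(2))
  also have "ennreal (10 * \<beta> / c) * ennreal K = ennreal (10 * \<beta> * K / c)"
    using \<beta> c K(1) by (simp flip: ennreal_mult)
  finally show ?thesis by (simp add: mult_left_mono)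
qed

definition nt_cone :: "real \<Rightarrow> real \<Rightarrow> complex set" where
  "nt_cone \<alpha> x = {z. Im z > 0 \<and> \<bar>Re z - x\<bar> < \<alpha> * Im z}"

definition large_set :: "real \<Rightarrow> real \<Rightarrow> (complex \<Rightarrow> complex) \<Rightarrow> real set" where
  "large_set \<alpha> \<mu> g = {x. \<exists>z \<in> nt_cone \<alpha> x. norm (g z) > \<mu>}"

lemma open_large_set: "open (large_set \<alpha> \<mu> g)"
proof -
  have "large_set \<alpha> \<mu> g = (\<Union>z\<in>{z. Im z > 0 \<and> norm (g z) > \<mu>}. {x. \<bar>Re z - x\<bar> < \<alpha> * Im z})"
    by (auto simp: large_set_def nt_cone_def)
  also have "open \<dots>"
    by (intro open_UN ballI open_Collect_less continuous_intros)
  finally show ?thesis .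
qed

text \<open>
If \<open>|g(z)| > \<mu>\<close> at a point of the cone over \<open>x\<close>, the Poisson integral of \<open>|g|\<^sup>p\<close> at \<open>z\<close> is large, so
the average of \<open>|g|\<^sup>p\<close> over some interval centred at \<open>Re z\<close> is large; its radius is at least \<open>Im z\<close>,
so the \<open>(1 + \<alpha>)\<close>-fold enlargement contains \<open>x\<close>. The Poisson formula needs a line inside the half-plane;
hence the estimate is first proved for the functions raised by \<open>1/(n + 1)\<close>, whose exceptional sets increase
to the given one.
\<close>
lemma emeasure_large_set_le:
  assumes p: "1 < p" and K: "K > 0" and g: "half_plane_Hp p K g" and \<alpha>: "\<alpha> > 0" and \<mu>: "\<mu> > 0"
  shows "emeasure lborel (large_set \<alpha> \<mu> g) \<le> ennreal (80 * (1 + \<alpha>) / (pi * \<mu> powr p) * K)"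
proof -
  from g have holo: "g holomorphic_on {z. Im z > 0}"
    and Lp: "\<And>y. y > 0 \<Longrightarrow> Lp_pow p (\<lambda>x. g (Complex x y)) \<le> ennreal K"
    by (auto simp: half_plane_Hp_def)
  define E where "E = (\<lambda>n. large_set \<alpha> \<mu> (raise (inverse (real (Suc n))) g))"
  have E_le: "emeasure lborel (E n) \<le> ennreal (80 * (1 + \<alpha>) / (pi * \<mu> powr p) * K)" for n
  proof -
    define a where "a = inverse (real (Suc n))"
    have a: "a > 0" by (simp add: a_def)
    note [measurable] = borel_measurable_horizontal[OF holo a]
    obtain B where B: "\<And>z. Im z \<ge> a \<Longrightarrow> norm (g z) \<le> B"
      using half_plane_Hp_bounded[OF p K g a] by blast
    \<comment> \<open>Chosen so that the threshold \<open>8c/\<pi>\<close> equals \<open>\<mu>\<^sup>p\<close>.\<close>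
    define c where "c = pi * \<mu> powr p / 8"
    have c: "c > 0" using \<mu> by (simp add: c_def)
    let ?h = "\<lambda>u. ennreal (norm (g (Complex u a)) powr p)"
    have "emeasure lborel (E n) \<le> ennreal (10 * (1 + \<alpha>) * K / c)"
    proof (rule emeasure_union_large_averages[where h = ?h])
      show "(\<integral>\<^sup>+u. ?h u \<partial>lborel) \<le> ennreal K" using Lp[OF a] by (simp add: Lp_pow_def)
      show "E n \<in> sets borel" unfolding E_def by (intro borel_open open_large_set)
      fix x assume "x \<in> E n"
      then obtain z where z: "Im z > 0" "\<bar>Re z - x\<bar> < \<alpha> * Im z" "norm (raise a g z) > \<mu>"
        by (auto simp: E_def large_set_def nt_cone_def a_def)
      have "z = Complex (Re z) (Im z)" by simp
      then have "raise a g z = g (Complex (Re z) (a + Im z))"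
        by (metis raise_Complex add.commute)
      then have "\<mu> powr p < norm (g (Complex (Re z) (a + Im z))) powr p"
        using z \<mu> p by (intro powr_less_mono2) auto
      then have "ennreal (8 * c / pi) < ennreal (norm (g (Complex (Re z) (a + Im z))) powr p)"
        using \<mu> by (simp add: c_def ennreal_less_iff)
      also have "\<dots> \<le> (\<integral>\<^sup>+u. ennreal (Poisson_kernel (Im z) (Re z - u)) * ?h u \<partial>lborel)"
        by (rule half_plane_Poisson_Jensen[OF p holo a z(1) B])
      finally obtain r where r: "r \<ge> Im z" "ennreal (c * r) < (\<integral>\<^sup>+u. ?h u * indicator (cball (Re z) r) u \<partial>lborel)"
        using large_Poisson_integral_imp_large_average[OF z(1) c, of ?h "Re z"] by auto
      have "\<alpha> * Im z \<le> \<alpha> * r" using r(1) \<alpha> by simp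
      then have "\<bar>Re z - x\<bar> \<le> (1 + \<alpha>) * r" using z r(1) by (simp add: distrib_right)
      then show "\<exists>s r. r > 0 \<and> \<bar>s - x\<bar> \<le> (1 + \<alpha>) * r \<and> ennreal (c * r) < (\<integral>\<^sup>+u. ?h u * indicator (cball s r) u \<partial>lborel)"
        using r z(1) by (intro exI[of _ "Re z"] exI[of _ r]) auto
    qed (use K \<alpha> c in auto)
    then show ?thesis by (simp add: c_def field_simps)
  qed
  have "incseq E"
  proof (rule incseq_SucI, rule subsetI)
    fix n x assume "x \<in> E n"
    then obtain z where z: "z \<in> nt_cone \<alpha> x" "norm (raise (inverse (real (Suc n))) g z) > \<mu>"
      by (auto simp: E_def large_set_def)
    define \<delta> where "\<delta> = inverse (real (Suc n)) - inverse (real (Suc (Suc n)))"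
    have \<delta>: "\<delta> \<ge> 0" by (simp add: \<delta>_def field_simps)
    have "z + \<i> * of_real \<delta> \<in> nt_cone \<alpha> x"
      using z \<delta> \<alpha> by (auto simp: nt_cone_def distrib_left add_strict_increasing2 intro: less_le_trans)
    moreover have "raise (inverse (real (Suc (Suc n)))) g (z + \<i> * of_real \<delta>) = raise (inverse (real (Suc n))) g z"
      by (simp add: raise_def \<delta>_def algebra_simps)
    ultimately show "x \<in> E (Suc n)" using z(2) by (auto simp: E_def large_set_def intro!: bexI[of _ "z + \<i> * of_real \<delta>"])
  qed
  have "large_set \<alpha> \<mu> g \<subseteq> (\<Union>n. E n)"
  proof
    fix x assume "x \<in> large_set \<alpha> \<mu> g"
    then obtain z where z: "Im z > 0" "\<bar>Re z - x\<bar> < \<alpha> * Im z" "norm (g z) > \<mu>"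
      by (auto simp: large_set_def nt_cone_def)
    define \<delta> where "\<delta> = min (Im z) (Im z - \<bar>Re z - x\<bar> / \<alpha>)"
    have "\<bar>Re z - x\<bar> / \<alpha> < Im z" using z \<alpha> by (simp add: divide_less_eq mult.commute)
    then have "\<delta> > 0" using z by (simp add: \<delta>_def)
    then obtain n where n: "inverse (real (Suc n)) < \<delta>" using reals_Archimedean by blast
    define a where "a = inverse (real (Suc n))"
    have "a < Im z" "a < Im z - \<bar>Re z - x\<bar> / \<alpha>" using n by (auto simp: \<delta>_def a_def)
    then have "\<bar>Re z - x\<bar> / \<alpha> < Im z - a" by linarith
    then have "\<bar>Re z - x\<bar> < \<alpha> * (Im z - a)" using \<alpha> by (simp add: divide_less_eq mult.commute)
    then have "z - \<i> * of_real a \<in> nt_cone \<alpha> x"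
      using \<open>a < Im z\<close> by (simp add: nt_cone_def)
    moreover have "raise a g (z - \<i> * of_real a) = g z" by (simp add: raise_def)
    ultimately have "x \<in> E n" using z(3) unfolding E_def large_set_def a_def[symmetric]
      by (intro CollectI bexI[of _ "z - \<i> * of_real a"]) auto
    then show "x \<in> (\<Union>n. E n)" by blast
  qed
  moreover have Em: "E n \<in> sets lborel" for n
    unfolding E_def using open_large_set by simp
  ultimately have "emeasure lborel (large_set \<alpha> \<mu> g) \<le> emeasure lborel (\<Union>n. E n)"
    by (intro emeasure_mono) auto
  also have "\<dots> = (SUP n. emeasure lborel (E n))"
    using \<open>incseq E\<close> Em by (intro SUP_emeasure_incseq[symmetric]) auto
  also have "\<dots> \<le> ennreal (80 * (1 + \<alpha>) / (pi * \<mu> powr p) * K)" by (intro SUP_least E_le)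
  finally show ?thesis .
qed

section \<open>Boundary values in the half-plane\<close>

definition oscillating :: "real \<Rightarrow> real \<Rightarrow> (complex \<Rightarrow> complex) \<Rightarrow> real \<Rightarrow> bool" where
  "oscillating \<alpha> \<mu> f x \<longleftrightarrow> (\<forall>\<delta>>0. \<exists>z\<in>nt_cone \<alpha> x. \<exists>w\<in>nt_cone \<alpha> x.
     dist z (Complex x 0) < \<delta> \<and> dist w (Complex x 0) < \<delta> \<and> norm (f z - f w) \<ge> \<mu>)"

text \<open>
The raised function is continuous at \<open>x\<close>, so oscillation of \<open>f\<close> near \<open>x\<close> must come from the difference.
\<close>
lemma oscillating_imp_large_set:
  assumes f: "f holomorphic_on {z. Im z > 0}" and \<epsilon>: "\<epsilon> > 0" and \<mu>: "\<mu> > 0"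
    and osc: "oscillating \<alpha> (4 * \<mu>) f x"
  shows "x \<in> large_set \<alpha> \<mu> (\<lambda>z. f z - raise \<epsilon> f z)"
proof (rule ccontr)
  assume "\<not> ?thesis"
  then have small: "norm (f z - raise \<epsilon> f z) \<le> \<mu>" if "z \<in> nt_cone \<alpha> x" for z
    using that by (auto simp: large_set_def not_less)
  have "isCont f (Complex x \<epsilon>)"
    using holomorphic_on_imp_continuous_on[OF f] \<epsilon>
    by (simp add: continuous_on_eq_continuous_at open_halfspace_Im_gt)
  then obtain \<delta> where \<delta>: "\<delta> > 0" "\<And>w. dist w (Complex x \<epsilon>) < \<delta> \<Longrightarrow> dist (f w) (f (Complex x \<epsilon>)) < \<mu>"
    unfolding continuous_at_eps_delta using \<mu> by blast
  have near: "dist (raise \<epsilon> f z) (f (Complex x \<epsilon>)) < \<mu>" if "dist z (Complex x 0) < \<delta>" for z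
  proof -
    have "z + \<i> * of_real \<epsilon> - Complex x \<epsilon> = z - Complex x 0" by (simp add: complex_eq_iff)
    then have "dist (z + \<i> * of_real \<epsilon>) (Complex x \<epsilon>) < \<delta>" using that by (simp only: dist_norm)
    then show ?thesis unfolding raise_def by (rule \<delta>(2))
  qed
  obtain z w where zw: "z \<in> nt_cone \<alpha> x" "w \<in> nt_cone \<alpha> x" "dist z (Complex x 0) < \<delta>" "dist w (Complex x 0) < \<delta>"
    "norm (f z - f w) \<ge> 4 * \<mu>"
    using osc \<delta>(1) unfolding oscillating_def by blast
  have "norm (a - d) \<le> norm (a - b) + norm (b - c) + (norm (d - e) + norm (e - c))" for a b c d e :: complex
    using norm_triangle_ineq4[of "(a - b) + (b - c)" "(d - e) + (e - c)"]
      norm_triangle_ineq[of "a - b" "b - c"] norm_triangle_ineq[of "d - e" "e - c"] by simp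
  from this[of "f z" "f w" "raise \<epsilon> f z" "f (Complex x \<epsilon>)" "raise \<epsilon> f w"]
  show False
    using small[OF zw(1)] small[OF zw(2)] near[OF zw(3)] near[OF zw(4)] zw(5) by (simp add: dist_norm)
qed

text \<open>
The oscillation set is contained in the large sets of \<open>f - f(\<cdot> + i\<epsilon>)\<close> for every \<open>\<epsilon>\<close>, and their measure tends to 0
with \<open>\<epsilon>\<close> by the weak-type bound and the Cauchy property of the slices.
\<close>
lemma AE_not_oscillating:
  assumes p: "1 < p" and K: "K > 0" and f: "half_plane_Hp p K f" and \<alpha>: "\<alpha> > 0" and \<mu>: "\<mu> > 0"
  shows "AE x in lborel. \<not> oscillating \<alpha> (4 * \<mu>) f x"
proof -
  from f have holo: "f holomorphic_on {z. Im z > 0}" by (auto simp: half_plane_Hp_def)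
  have "\<exists>\<epsilon>>0. emeasure lborel (large_set \<alpha> \<mu> (\<lambda>z. f z - raise \<epsilon> f z)) \<le> ennreal e" if e: "e > 0" for e
  proof -
    define A where "A = 80 * (1 + \<alpha>) / (pi * \<mu> powr p)"
    have A: "A > 0" using \<alpha> \<mu> by (simp add: A_def)
    have eA: "e / A > 0" using e A by simp
    obtain d where d: "d > 0" "\<And>\<epsilon> y. \<lbrakk>0 < \<epsilon>; \<epsilon> < d; y > 0\<rbrakk> \<Longrightarrow>
        Lp_pow p (\<lambda>x. f (Complex x y) - f (Complex x (y + \<epsilon>))) \<le> ennreal (e / A)"
      using half_plane_Lp_Cauchy[OF p K f eA] by blast
    define \<epsilon> where "\<epsilon> = d / 2"
    have \<epsilon>: "0 < \<epsilon>" "\<epsilon> < d" using d(1) by (auto simp: \<epsilon>_def)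
    have "half_plane_Hp p (e / A) (\<lambda>z. f z - raise \<epsilon> f z)"
      unfolding half_plane_Hp_def using d(2)[OF \<epsilon>] holo \<epsilon>(1)
      by (auto intro!: holomorphic_intros holomorphic_raise)
    from emeasure_large_set_le[OF p eA this \<alpha> \<mu>, folded A_def]
    have "emeasure lborel (large_set \<alpha> \<mu> (\<lambda>z. f z - raise \<epsilon> f z)) \<le> ennreal e"
      using A by simp
    then show ?thesis using \<epsilon>(1) by blast
  qed
  then have "\<forall>n. \<exists>\<epsilon>>0. emeasure lborel (large_set \<alpha> \<mu> (\<lambda>z. f z - raise \<epsilon> f z)) \<le> ennreal (inverse (real (Suc n)))"
    by simp
  then obtain \<epsilon> where \<epsilon>: "\<And>n. \<epsilon> n > 0"
    "\<And>n. emeasure lborel (large_set \<alpha> \<mu> (\<lambda>z. f z - raise (\<epsilon> n) f z)) \<le> ennreal (inverse (real (Suc n)))"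
    by metis
  define N where "N = (\<Inter>n. large_set \<alpha> \<mu> (\<lambda>z. f z - raise (\<epsilon> n) f z))"
  have N: "N \<in> sets lborel" unfolding N_def using open_large_set by (intro sets.countable_INT) auto
  have "emeasure lborel N \<le> ennreal (inverse (real (Suc n)))" for n
  proof -
    have "emeasure lborel N \<le> emeasure lborel (large_set \<alpha> \<mu> (\<lambda>z. f z - raise (\<epsilon> n) f z))"
      using open_large_set by (intro emeasure_mono) (auto simp: N_def)
    then show ?thesis using \<epsilon>(2)[of n] by (rule order_trans)
  qed
  then have "emeasure lborel N \<le> ennreal 0"
    by (intro LIMSEQ_le_const[OF tendsto_ennrealI[OF LIMSEQ_inverse_real_of_nat]]) auto
  then have "N \<in> null_sets lborel" using N by (auto simp: null_sets_def)
  moreover have "{x \<in> space lborel. \<not> \<not> oscillating \<alpha> (4 * \<mu>) f x} \<subseteq> N"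
    using oscillating_imp_large_set[OF holo \<epsilon>(1) \<mu>] by (auto simp: N_def)
  ultimately show ?thesis by (rule AE_I')
qed

text \<open>
Taking the limit along one fixed sequence makes the boundary function Borel measurable without further argument; its
value is arbitrary where the limit does not exist.
\<close>
definition boundary_value :: "(complex \<Rightarrow> complex) \<Rightarrow> real \<Rightarrow> complex" where
  "boundary_value f x = lim (\<lambda>n. f (Complex x (inverse (real (Suc n)))))"

lemma borel_measurable_boundary_value:
  assumes "f holomorphic_on {z. Im z > 0}"
  shows "boundary_value f \<in> borel_measurable borel"
  unfolding boundary_value_def
  by (intro borel_measurable_lim_metric borel_measurable_horizontal[OF assms]) simp

lemma vertical_in_nt_cone: "\<alpha> > 0 \<Longrightarrow> y > 0 \<Longrightarrow> Complex x y \<in> nt_cone \<alpha> x"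
  by (simp add: nt_cone_def)

lemma tendsto_boundary_value:
  assumes \<alpha>: "\<alpha> > 0" and no: "\<And>\<mu>. \<mu> > 0 \<Longrightarrow> \<not> oscillating \<alpha> \<mu> f x"
  shows "(f \<longlongrightarrow> boundary_value f x) (at (Complex x 0) within nt_cone \<alpha> x)"
    and "(\<lambda>n. f (Complex x (inverse (real (Suc n))))) \<longlonglongrightarrow> boundary_value f x"
proof -
  let ?s = "\<lambda>n. f (Complex x (inverse (real (Suc n))))"
  have small: "\<exists>\<delta>>0. \<forall>z\<in>nt_cone \<alpha> x. \<forall>w\<in>nt_cone \<alpha> x. dist z (Complex x 0) < \<delta> \<longrightarrow> dist w (Complex x 0) < \<delta> \<longrightarrow> norm (f z - f w) < \<mu>"
    if "\<mu> > 0" for \<mu>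
    using no[OF that] unfolding oscillating_def by (meson not_le)
  have near: "\<forall>\<^sub>F n in sequentially. dist (Complex x (inverse (real (Suc n)))) (Complex x 0) < \<delta>" if "\<delta> > 0" for \<delta>
  proof -
    have "dist (Complex x (inverse (real (Suc n)))) (Complex x 0) = inverse (real (Suc n))" for n
      by (simp add: dist_norm Complex_eq norm_mult del: of_nat_Suc flip: of_real_inverse)
    moreover have "\<forall>\<^sub>F n in sequentially. inverse (real (Suc n)) < \<delta>"
      using order_tendstoD(2)[OF LIMSEQ_inverse_real_of_nat that] .
    ultimately show ?thesis by simp
  qed
  have incone: "Complex x (inverse (real (Suc n))) \<in> nt_cone \<alpha> x" for n
    using \<alpha> by (intro vertical_in_nt_cone) auto
  have "Cauchy ?s"
  proof (rule metric_CauchyI)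
    fix e :: real assume "e > 0"
    then obtain \<delta> where \<delta>: "\<delta> > 0" "\<And>z w. z \<in> nt_cone \<alpha> x \<Longrightarrow> w \<in> nt_cone \<alpha> x \<Longrightarrow>
      dist z (Complex x 0) < \<delta> \<Longrightarrow> dist w (Complex x 0) < \<delta> \<Longrightarrow> norm (f z - f w) < e"
      using small by meson
    obtain M where "\<And>n. n \<ge> M \<Longrightarrow> dist (Complex x (inverse (real (Suc n)))) (Complex x 0) < \<delta>"
      using near[OF \<delta>(1)] by (auto simp: eventually_sequentially)
    then show "\<exists>M. \<forall>m\<ge>M. \<forall>n\<ge>M. dist (?s m) (?s n) < e"
      unfolding dist_norm using \<delta>(2) incone by (metis dist_norm)
  qed
  then have "convergent ?s" by (rule Cauchy_convergent)
  then show lim: "?s \<longlonglongrightarrow> boundary_value f x"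
    unfolding boundary_value_def by (rule convergent_LIMSEQ_iff[THEN iffD1])
  show "(f \<longlongrightarrow> boundary_value f x) (at (Complex x 0) within nt_cone \<alpha> x)"
  proof (rule tendstoI)
    fix e :: real assume e: "e > 0"
    then obtain \<delta> where \<delta>: "\<delta> > 0" "\<And>z w. z \<in> nt_cone \<alpha> x \<Longrightarrow> w \<in> nt_cone \<alpha> x \<Longrightarrow>
      dist z (Complex x 0) < \<delta> \<Longrightarrow> dist w (Complex x 0) < \<delta> \<Longrightarrow> norm (f z - f w) < e / 2"
      using small[of "e / 2"] by (meson half_gt_zero)
    have "dist (f z) (boundary_value f x) < e" if z: "z \<in> nt_cone \<alpha> x" "dist z (Complex x 0) < \<delta>" for z
    proof -
      have "norm (f z - boundary_value f x) \<le> e / 2"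
      proof (rule tendsto_upperbound)
        show "(\<lambda>n. norm (f z - ?s n)) \<longlonglongrightarrow> norm (f z - boundary_value f x)"
          by (intro tendsto_intros lim)
        show "\<forall>\<^sub>F n in sequentially. norm (f z - ?s n) \<le> e / 2"
          using near[OF \<delta>(1)] by eventually_elim (use \<delta>(2)[OF z(1) incone z(2)] in \<open>auto intro: less_imp_le\<close>)
      qed auto
      then show ?thesis using e by (simp add: dist_norm)
    qed
    then show "\<forall>\<^sub>F z in at (Complex x 0) within nt_cone \<alpha> x. dist (f z) (boundary_value f x) < e"
      unfolding eventually_at using \<delta>(1) by blast
  qed
qed

text \<open>
Oscillation is monotone in the aperture and in the level, so countably many of each suffice for the
non-tangential limits. The convergence in \<open>L\<^sup>p\<close> follows from the Cauchy property of the slices by Fatou's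
lemma, letting the lower of two slices descend to the boundary.
\<close>
theorem half_plane_boundary_values:
  assumes p: "1 < p" and K: "K > 0" and f: "half_plane_Hp p K f"
  shows half_plane_nt_limit: "AE x in lborel. \<forall>\<alpha>>0. (f \<longlongrightarrow> boundary_value f x) (at (Complex x 0) within nt_cone \<alpha> x)"
    and half_plane_vertical_limit: "AE x in lborel. (\<lambda>n. f (Complex x (inverse (real (Suc n))))) \<longlonglongrightarrow> boundary_value f x"
    and half_plane_boundary_Lp: "Lp_pow p (boundary_value f) \<le> ennreal K"
    and half_plane_Lp_convergence: "((\<lambda>\<tau>. Lp_pow p (\<lambda>x. f (Complex x \<tau>) - boundary_value f x)) \<longlongrightarrow> 0) (at_right 0)"
proof -
  from f have holo: "f holomorphic_on {z. Im z > 0}"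
    and Lp: "\<And>y. y > 0 \<Longrightarrow> Lp_pow p (\<lambda>x. f (Complex x y)) \<le> ennreal K"
    by (auto simp: half_plane_Hp_def)
  have "AE x in lborel. \<forall>k m. \<not> oscillating (real (Suc k)) (4 * inverse (real (Suc m))) f x"
    unfolding AE_all_countable by (intro allI AE_not_oscillating[OF p K f]) auto
  then have AE: "AE x in lborel. \<forall>\<alpha>>0. \<forall>\<mu>>0. \<not> oscillating \<alpha> \<mu> f x"
  proof eventually_elim
    case (elim x)
    show ?case
    proof (intro allI impI notI)
      fix \<alpha> \<mu> :: real assume \<alpha>: "\<alpha> > 0" and \<mu>: "\<mu> > 0" and osc: "oscillating \<alpha> \<mu> f x"
      obtain k where k: "\<alpha> \<le> real (Suc k)" using real_nat_ceiling_ge[of \<alpha>] that[of "nat \<lceil>\<alpha>\<rceil>"] by simp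
      obtain m where m: "inverse (real (Suc m)) < \<mu> / 4" using reals_Archimedean[of "\<mu> / 4"] \<mu> by auto
      have "nt_cone \<alpha> x \<subseteq> nt_cone (real (Suc k)) x"
      proof
        fix z assume z: "z \<in> nt_cone \<alpha> x"
        then have "\<alpha> * Im z \<le> real (Suc k) * Im z" using k by (intro mult_right_mono) (auto simp: nt_cone_def)
        moreover have "Im z > 0" "\<bar>Re z - x\<bar> < \<alpha> * Im z" using z by (auto simp: nt_cone_def)
        ultimately show "z \<in> nt_cone (real (Suc k)) x" unfolding nt_cone_def by (intro CollectI conjI) linarith+
      qed
      moreover have "4 * inverse (real (Suc m)) \<le> \<mu>" using m by simp
      ultimately have "oscillating (real (Suc k)) (4 * inverse (real (Suc m))) f x"
        using osc unfolding oscillating_def by (meson order_trans subsetD)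
      then show False using elim by blast
    qed
  qed
  then show "AE x in lborel. \<forall>\<alpha>>0. (f \<longlongrightarrow> boundary_value f x) (at (Complex x 0) within nt_cone \<alpha> x)"
    by eventually_elim (auto intro: tendsto_boundary_value)
  show AE_lim: "AE x in lborel. (\<lambda>n. f (Complex x (inverse (real (Suc n))))) \<longlonglongrightarrow> boundary_value f x"
    using AE by eventually_elim (rule tendsto_boundary_value(2)[of 1], auto)
  have meas: "(\<lambda>x. f (Complex x y)) \<in> borel_measurable borel" if "y > 0" for y
    using that by (rule borel_measurable_horizontal[OF holo])
  show "Lp_pow p (boundary_value f) \<le> ennreal K"
    by (rule Lp_pow_Fatou[OF _ meas AE_lim, where N = 0]) (use p Lp in auto)
  show "((\<lambda>\<tau>. Lp_pow p (\<lambda>x. f (Complex x \<tau>) - boundary_value f x)) \<longlongrightarrow> 0) (at_right 0)"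
  proof (rule tendsto_zero_ennreal)
    fix r :: real assume r: "r > 0"
    obtain d where d: "d > 0" "\<And>\<epsilon> y. \<lbrakk>0 < \<epsilon>; \<epsilon> < d; y > 0\<rbrakk> \<Longrightarrow>
        Lp_pow p (\<lambda>x. f (Complex x y) - f (Complex x (y + \<epsilon>))) \<le> ennreal (r / 2)"
      using half_plane_Lp_Cauchy[OF p K f, of "r / 2"] r by auto
    have "Lp_pow p (\<lambda>x. f (Complex x \<tau>) - boundary_value f x) < ennreal r" if \<tau>: "0 < \<tau>" "\<tau> < d" for \<tau>
    proof -
      obtain N where N: "inverse (real (Suc N)) < \<tau>" using reals_Archimedean[OF \<tau>(1)] by blast
      have "Lp_pow p (\<lambda>x. f (Complex x \<tau>) - boundary_value f x) \<le> ennreal (r / 2)"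
      proof (rule Lp_pow_Fatou[where u = "\<lambda>n x. f (Complex x \<tau>) - f (Complex x (inverse (real (Suc n))))" and N = N])
        show "(\<lambda>x. f (Complex x \<tau>) - f (Complex x (inverse (real (Suc n))))) \<in> borel_measurable borel" for n
          using \<tau> by (intro borel_measurable_diff meas) auto
        show "AE x in lborel. (\<lambda>n. f (Complex x \<tau>) - f (Complex x (inverse (real (Suc n))))) \<longlonglongrightarrow> f (Complex x \<tau>) - boundary_value f x"
          using AE_lim by eventually_elim (intro tendsto_intros)
        fix n assume "n \<ge> N"
        then have "inverse (real (Suc n)) \<le> inverse (real (Suc N))" by (intro le_imp_inverse_le) auto
        then have n: "inverse (real (Suc n)) < \<tau>" using N by linarith
        define y where "y = inverse (real (Suc n))"
        have y: "y > 0" "y < \<tau>" using n by (auto simp: y_def)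
        have "Lp_pow p (\<lambda>x. f (Complex x y) - f (Complex x (y + (\<tau> - y)))) \<le> ennreal (r / 2)"
          using \<tau> y by (intro d(2)) auto
        then show "Lp_pow p (\<lambda>x. f (Complex x \<tau>) - f (Complex x (inverse (real (Suc n))))) \<le> ennreal (r / 2)"
          unfolding y_def[symmetric] Lp_pow_def by (simp add: norm_minus_commute)
      qed (use p in auto)
      also have "\<dots> < ennreal r" using r by (simp add: ennreal_less_iff)
      finally show ?thesis .
    qed
    then show "\<forall>\<^sub>F \<tau> in at_right 0. Lp_pow p (\<lambda>x. f (Complex x \<tau>) - boundary_value f x) < ennreal r"
      unfolding eventually_at_right_field using d(1) by blast
  qed
qed

section \<open>Integration over the boundary of a half-strip\<close>

lemma nn_integral_lines_measure:
  assumes "f \<in> borel_measurable borel"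
  shows "(\<integral>\<^sup>+w. f w \<partial>lines_measure s t) =
    (\<integral>\<^sup>+v. f (Complex (- s) v) \<partial>lborel) + (\<integral>\<^sup>+u. f (Complex u t) \<partial>lborel) + (\<integral>\<^sup>+v. f (Complex s v) \<partial>lborel)"
  using assms
proof (induction rule: borel_measurable_induct)
  case (cong f g)
  then show ?case by simp
next
  case (set A)
  have ind: "(\<integral>\<^sup>+v. indicator A (c v) \<partial>lborel) = emeasure lborel {v. c v \<in> A}" if [measurable]: "c \<in> borel_measurable borel" for c :: "real \<Rightarrow> complex"
  proof -
    have "{v. c v \<in> A} \<in> sets borel" using measurable_sets[OF that set] by (simp add: vimage_def)
    then have "(\<integral>\<^sup>+v. indicator {v. c v \<in> A} v \<partial>lborel) = emeasure lborel {v. c v \<in> A}" by simp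
    moreover have "indicator {v. c v \<in> A} = (\<lambda>v. indicator A (c v) :: ennreal)" by (auto simp: indicator_def)
    ultimately show ?thesis by simp
  qed
  show ?case using set by (simp add: emeasure_lines_measure ind)
next
  case (mult u c)
  note [measurable] = mult.hyps(2)
  show ?case using mult by (simp add: nn_integral_cmult distrib_left)
next
  case (add u v)
  note [measurable] = add.hyps(1,3)
  show ?case using add by (simp add: nn_integral_add ac_simps)
next
  case (seq U)
  note [measurable] = seq.hyps(1)
  have U: "incseq (\<lambda>i. U i (c v))" for c :: "real \<Rightarrow> complex" and v
    using seq.hyps(3) by (auto simp: incseq_def le_fun_def)
  have mono: "(\<integral>\<^sup>+v. (SUP i. U i (c v)) \<partial>lborel) = (SUP i. \<integral>\<^sup>+v. U i (c v) \<partial>lborel)"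
    if [measurable]: "c \<in> borel_measurable borel" for c :: "real \<Rightarrow> complex"
    using seq.hyps(3) by (intro nn_integral_monotone_convergence_SUP) (auto simp: incseq_def le_fun_def)
  have inc: "incseq (\<lambda>i. \<integral>\<^sup>+v. U i (c v) \<partial>lborel)" for c :: "real \<Rightarrow> complex"
    using seq.hyps(3) by (auto simp: incseq_def le_fun_def intro!: nn_integral_mono)
  have "(\<integral>\<^sup>+w. (SUP i. U i w) \<partial>lines_measure s t) = (SUP i. \<integral>\<^sup>+w. U i w \<partial>lines_measure s t)"
    using seq.hyps(3) by (intro nn_integral_monotone_convergence_SUP) auto
  also have "\<dots> = (SUP i. (\<integral>\<^sup>+v. U i (Complex (- s) v) \<partial>lborel) + (\<integral>\<^sup>+u. U i (Complex u t) \<partial>lborel) + (\<integral>\<^sup>+v. U i (Complex s v) \<partial>lborel))"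
    by (simp only: seq.IH)
  also have "\<dots> = (SUP i. \<integral>\<^sup>+v. U i (Complex (- s) v) \<partial>lborel) + (SUP i. \<integral>\<^sup>+u. U i (Complex u t) \<partial>lborel) + (SUP i. \<integral>\<^sup>+v. U i (Complex s v) \<partial>lborel)"
  proof -
    have "incseq (\<lambda>i. (\<integral>\<^sup>+v. U i (Complex (- s) v) \<partial>lborel) + (\<integral>\<^sup>+u. U i (Complex u t) \<partial>lborel))"
      using inc[of "Complex (- s)"] inc[of "\<lambda>u. Complex u t"] by (auto simp: incseq_def intro!: add_mono)
    then show ?thesis by (simp only: ennreal_SUP_add inc)
  qed
  finally show ?case by (simp add: mono SUP_apply image_image)
qed

lemma integral_lines_measure:
  fixes f :: "complex \<Rightarrow> complex"
  assumes f[measurable]: "f \<in> borel_measurable borel"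
    and i: "integrable lborel (\<lambda>v. f (Complex (- s) v))" "integrable lborel (\<lambda>u. f (Complex u t))"
      "integrable lborel (\<lambda>v. f (Complex s v))"
  shows "integrable (lines_measure s t) f"
    and "(\<integral>w. f w \<partial>lines_measure s t) =
       (\<integral>v. f (Complex (- s) v) \<partial>lborel) + (\<integral>u. f (Complex u t) \<partial>lborel) + (\<integral>v. f (Complex s v) \<partial>lborel)"
proof -
  have fin: "(\<integral>\<^sup>+w. ennreal (norm (f w)) \<partial>lines_measure s t) < \<infinity>"
    using i by (subst nn_integral_lines_measure) (auto simp: integrable_iff_bounded)
  then show int: "integrable (lines_measure s t) f"
    by (simp add: integrable_iff_bounded)
  have pieces: "integrable lborel (\<lambda>v. g (Complex (- s) v)) \<and> integrable lborel (\<lambda>u. g (Complex u t)) \<and> integrable lborel (\<lambda>v. g (Complex s v))"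
    if g: "integrable (lines_measure s t) g" for g :: "complex \<Rightarrow> complex"
  proof -
    have [measurable]: "g \<in> borel_measurable borel"
      using borel_measurable_integrable[OF g] by simp
    have "(\<integral>\<^sup>+w. ennreal (norm (g w)) \<partial>lines_measure s t) < \<infinity>" using g by (simp add: integrable_iff_bounded)
    then show ?thesis
      by (subst (asm) nn_integral_lines_measure) (auto simp: integrable_iff_bounded)
  qed
  show "(\<integral>w. f w \<partial>lines_measure s t) =
       (\<integral>v. f (Complex (- s) v) \<partial>lborel) + (\<integral>u. f (Complex u t) \<partial>lborel) + (\<integral>v. f (Complex s v) \<partial>lborel)"
    using int
  proof (induction rule: integrable_induct)
    case (base A c)
    have A: "A \<in> sets borel" using base(1) by simp
    have meas: "{v. c v \<in> A} \<in> sets borel" if "c \<in> borel_measurable borel" for c :: "real \<Rightarrow> complex"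
      using measurable_sets[OF that A] by (simp add: vimage_def)
    have ind: "(\<integral>v. indicator A (k v) *\<^sub>R c \<partial>lborel) = measure lborel {v. k v \<in> A} *\<^sub>R c"
      if k[measurable]: "k \<in> borel_measurable borel" and fin: "emeasure lborel {v. k v \<in> A} < \<infinity>" for k :: "real \<Rightarrow> complex"
    proof -
      have "(\<integral>v. indicator {v. k v \<in> A} v *\<^sub>R c \<partial>lborel) = measure lborel {v. k v \<in> A} *\<^sub>R c"
        using meas[OF k] fin by simp
      moreover have "indicator {v. k v \<in> A} = (\<lambda>v. indicator A (k v) :: real)" by (auto simp: indicator_def)
      ultimately show ?thesis by simp
    qed
    have fin: "emeasure lborel {v. Complex (- s) v \<in> A} < \<infinity>" "emeasure lborel {u. Complex u t \<in> A} < \<infinity>"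
      "emeasure lborel {v. Complex s v \<in> A} < \<infinity>"
      using base(2) by (auto simp: emeasure_lines_measure[OF A])
    have "measure (lines_measure s t) A = measure lborel {v. Complex (- s) v \<in> A} + measure lborel {u. Complex u t \<in> A} + measure lborel {v. Complex s v \<in> A}"
      unfolding measure_def emeasure_lines_measure[OF A] using fin by (simp add: enn2real_plus)
    then show ?case using base fin
      by (simp add: ind scaleR_add_left)
  next
    case (add f g)
    show ?case using add pieces[OF add.hyps(1)] pieces[OF add.hyps(2)] by simp
  next
    case (lim f u)
    have [measurable]: "f \<in> borel_measurable borel" "\<And>i. u i \<in> borel_measurable borel"
      using borel_measurable_integrable[OF lim.hyps(4)] borel_measurable_integrable[OF lim.hyps(1)] by simp_all
    note pf = pieces[OF lim.hyps(4)]
    have conv: "(\<lambda>i. \<integral>v. u i (k v) \<partial>lborel) \<longlonglongrightarrow> (\<integral>v. f (k v) \<partial>lborel)"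
      if k[measurable]: "k \<in> borel_measurable borel" and int: "integrable lborel (\<lambda>v. f (k v))" for k :: "real \<Rightarrow> complex"
      by (rule integral_dominated_convergence[where w = "\<lambda>v. 2 * norm (f (k v))"])
         (use lim.hyps(2,3) int in auto)
    have "(\<lambda>i. \<integral>w. u i w \<partial>lines_measure s t) \<longlonglongrightarrow> (\<integral>w. f w \<partial>lines_measure s t)"
      by (rule integral_dominated_convergence[where w = "\<lambda>w. 2 * norm (f w)"])
         (use lim.hyps(2,3,4) in auto)
    moreover have "(\<lambda>i. \<integral>w. u i w \<partial>lines_measure s t) \<longlonglongrightarrow>
       (\<integral>v. f (Complex (- s) v) \<partial>lborel) + (\<integral>u. f (Complex u t) \<partial>lborel) + (\<integral>v. f (Complex s v) \<partial>lborel)"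
      unfolding lim.IH using pf by (intro tendsto_add conv) auto
    ultimately show ?case by (rule LIMSEQ_unique)
  qed
qed

lemma Complex_in_Gamma_bd:
  assumes "s > 0"
  shows "Complex (- s) v \<in> Gamma_bd s t \<longleftrightarrow> v \<ge> t" "Complex s v \<in> Gamma_bd s t \<longleftrightarrow> v \<ge> t"
    "Complex u t \<in> Gamma_bd s t \<longleftrightarrow> \<bar>u\<bar> \<le> s"
  using assms by (auto simp: Gamma_bd_def Gamma1_def Gamma2_def Gamma3_def)

lemma closed_Gamma_bd: "s > 0 \<Longrightarrow> closed (Gamma_bd s t)"
  using frontier_half_strip[of s t] frontier_closed by metis

lemma Gamma_bd_borel [measurable]: "s > 0 \<Longrightarrow> Gamma_bd s t \<in> sets borel"
  by (intro borel_closed closed_Gamma_bd)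

text \<open>
Membership in \<open>Gamma_bd s t\<close> differs from the conditions on the right only at the two corners.
\<close>
lemma nn_integral_arc_measure:
  assumes s: "s > 0" and f: "(\<lambda>w. f w * indicator (Gamma_bd s t) w) \<in> borel_measurable borel"
  shows "(\<integral>\<^sup>+w. f w \<partial>arc_measure s t) =
    (\<integral>\<^sup>+v. f (Complex (- s) v) * indicator {t<..} v \<partial>lborel) + (\<integral>\<^sup>+u. f (Complex u t) * indicator {-s..s} u \<partial>lborel)
      + (\<integral>\<^sup>+v. f (Complex s v) * indicator {t<..} v \<partial>lborel)"
proof -
  have "(\<integral>\<^sup>+w. f w \<partial>arc_measure s t) = (\<integral>\<^sup>+w. f w * indicator (Gamma_bd s t) w \<partial>lines_measure s t)"
    unfolding arc_measure_def using s by (intro nn_integral_restrict_space) simp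
  also have "\<dots> = (\<integral>\<^sup>+v. f (Complex (- s) v) * indicator (Gamma_bd s t) (Complex (- s) v) \<partial>lborel)
     + (\<integral>\<^sup>+u. f (Complex u t) * indicator (Gamma_bd s t) (Complex u t) \<partial>lborel)
     + (\<integral>\<^sup>+v. f (Complex s v) * indicator (Gamma_bd s t) (Complex s v) \<partial>lborel)"
    by (rule nn_integral_lines_measure[OF f])
  also have "(\<integral>\<^sup>+v. f (Complex (- s) v) * indicator (Gamma_bd s t) (Complex (- s) v) \<partial>lborel)
      = (\<integral>\<^sup>+v. f (Complex (- s) v) * indicator {t<..} v \<partial>lborel)"
    using AE_lborel_singleton[of t]
    by (intro nn_integral_cong_AE, eventually_elim) (auto simp: indicator_def Complex_in_Gamma_bd[OF s])
  also have "(\<integral>\<^sup>+v. f (Complex s v) * indicator (Gamma_bd s t) (Complex s v) \<partial>lborel)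
      = (\<integral>\<^sup>+v. f (Complex s v) * indicator {t<..} v \<partial>lborel)"
    using AE_lborel_singleton[of t]
    by (intro nn_integral_cong_AE, eventually_elim) (auto simp: indicator_def Complex_in_Gamma_bd[OF s])
  also have "(\<integral>\<^sup>+u. f (Complex u t) * indicator (Gamma_bd s t) (Complex u t) \<partial>lborel)
      = (\<integral>\<^sup>+u. f (Complex u t) * indicator {-s..s} u \<partial>lborel)"
    by (intro nn_integral_cong) (auto simp: indicator_def Complex_in_Gamma_bd[OF s])
  finally show ?thesis .
qed

lemma tangent_Complex:
  assumes "s > 0"
  shows "v > t \<Longrightarrow> tangent s t (Complex (- s) v) = - \<i>" "v > t \<Longrightarrow> tangent s t (Complex s v) = \<i>"
    "tangent s t (Complex u t) = 1"
  using assms by (auto simp: tangent_def Gamma1_def Gamma3_def)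

lemma Gamma13_borel [measurable]: "Gamma1 s t \<in> sets borel" "Gamma3 s t \<in> sets borel"
proof -
  have "Gamma1 s t = {w. Re w = - s} \<inter> {w. Im w > t}" "Gamma3 s t = {w. Re w = s} \<inter> {w. Im w > t}"
    by (auto simp: Gamma1_def Gamma3_def complex_eq_iff intro: exI[of _ "Im _"])
  moreover have "{w. Re w = c} \<inter> {w. Im w > t} \<in> sets borel" for c t
    by (intro sets.Int borel_closed borel_open closed_Collect_eq open_halfspace_Im_gt continuous_intros)
  ultimately show "Gamma1 s t \<in> sets borel" "Gamma3 s t \<in> sets borel" by simp_all
qed

lemma borel_measurable_tangent [measurable]: "tangent s t \<in> borel_measurable borel"
  unfolding tangent_def by measurable

lemma arc_integral_eq:
  fixes f :: "complex \<Rightarrow> complex"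
  assumes s: "s > 0" and f: "(\<lambda>w. indicator (Gamma_bd s t) w *\<^sub>R f w) \<in> borel_measurable borel"
    and int: "set_integrable lborel {t<..} (\<lambda>v. f (Complex (- s) v))"
      "set_integrable lborel {-s..s} (\<lambda>u. f (Complex u t))"
      "set_integrable lborel {t<..} (\<lambda>v. f (Complex s v))"
  shows "arc_integrable s t f"
    and "arc_integral s t f = - \<i> * (LBINT v:{t<..}. f (Complex (- s) v)) + (LBINT u:{-s..s}. f (Complex u t))
      + \<i> * (LBINT v:{t<..}. f (Complex s v))"
proof -
  define g where "g = (\<lambda>w. indicator (Gamma_bd s t) w *\<^sub>R (f w * tangent s t w))"
  have "g = (\<lambda>w. (indicator (Gamma_bd s t) w *\<^sub>R f w) * tangent s t w)" by (simp add: g_def)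
  then have g[measurable]: "g \<in> borel_measurable borel"
    using borel_measurable_times[OF f borel_measurable_tangent] by simp
  have AE1: "AE v in lborel. g (Complex (- s) v) = - \<i> * (indicator {t<..} v *\<^sub>R f (Complex (- s) v))"
    using AE_lborel_singleton[of t] 
    by eventually_elim (auto simp: g_def indicator_def Complex_in_Gamma_bd[OF s] tangent_Complex[OF s])
  have AE3: "AE v in lborel. g (Complex s v) = \<i> * (indicator {t<..} v *\<^sub>R f (Complex s v))"
    using AE_lborel_singleton[of t] 
    by eventually_elim (auto simp: g_def indicator_def Complex_in_Gamma_bd[OF s] tangent_Complex[OF s])
  have g2: "g (Complex u t) = indicator {-s..s} u *\<^sub>R f (Complex u t)" for u
    by (auto simp: g_def indicator_def Complex_in_Gamma_bd[OF s] tangent_Complex[OF s])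
  have m: "(\<lambda>v. g (Complex c v)) \<in> borel_measurable borel" "(\<lambda>v. g (Complex v c)) \<in> borel_measurable borel" for c
    by measurable
  note int' = int[unfolded set_integrable_def]
  have i1: "integrable lborel (\<lambda>v. g (Complex (- s) v))"
    by (rule integrable_cong_AE_imp[OF integrable_mult_right[OF int'(1)] _ AE1[THEN AE_symmetric]]) (use m in auto)
  have i3: "integrable lborel (\<lambda>v. g (Complex s v))"
    by (rule integrable_cong_AE_imp[OF integrable_mult_right[OF int'(3)] _ AE3[THEN AE_symmetric]]) (use m in auto)
  have i2: "integrable lborel (\<lambda>u. g (Complex u t))"
    unfolding g2 using int'(2) .
  note L = integral_lines_measure[OF g i1 i2 i3]
  show "arc_integrable s t f"
    unfolding arc_integrable_def arc_measure_def using s L(1)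
    by (subst integrable_restrict_space) (simp_all add: g_def)
  have "arc_integral s t f = (\<integral>w. g w \<partial>lines_measure s t)"
    unfolding arc_integral_def arc_measure_def g_def using s by (intro integral_restrict_space) simp
  also note L(2)
  also have "(\<integral>v. g (Complex (- s) v) \<partial>lborel) = (\<integral>v. - \<i> * (indicator {t<..} v *\<^sub>R f (Complex (- s) v)) \<partial>lborel)"
    using borel_measurable_integrable[OF i1] borel_measurable_integrable[OF integrable_mult_right[OF int'(1)]]
    by (rule integral_cong_AE[OF _ _ AE1])
  also have "(\<integral>v. g (Complex s v) \<partial>lborel) = (\<integral>v. \<i> * (indicator {t<..} v *\<^sub>R f (Complex s v)) \<partial>lborel)"
    using borel_measurable_integrable[OF i3] borel_measurable_integrable[OF integrable_mult_right[OF int'(3)]]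
    by (rule integral_cong_AE[OF _ _ AE3])
  finally show "arc_integral s t f = - \<i> * (LBINT v:{t<..}. f (Complex (- s) v)) + (LBINT u:{-s..s}. f (Complex u t))
      + \<i> * (LBINT v:{t<..}. f (Complex s v))"
    unfolding g2 set_lebesgue_integral_def integral_mult_right_zero by simp
qed

section \<open>The Lebesgue norm\<close>

lemma Lp_norm_le_iff:
  assumes "p > 0" "A \<ge> 0"
  shows "Lp_norm p M f \<le> ennreal A \<longleftrightarrow> (\<integral>\<^sup>+x. ennreal (norm (f x) powr p) \<partial>M) \<le> ennreal (A powr p)"
proof -
  define I where "I = (\<integral>\<^sup>+x. ennreal (norm (f x) powr p) \<partial>M)"
  show ?thesis
  proof (cases "I = \<infinity>")
    case True
    then show ?thesis by (simp add: Lp_norm_def Let_def I_def[symmetric] top_unique)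
  next
    case False
    then obtain r where r: "r \<ge> 0" "I = ennreal r" by (cases I) auto
    have "r powr (1 / p) \<le> A \<longleftrightarrow> r \<le> A powr p"
    proof
      assume "r powr (1 / p) \<le> A"
      then have "(r powr (1 / p)) powr p \<le> A powr p" using assms by (intro powr_mono2) auto
      then show "r \<le> A powr p" using assms r by (simp add: powr_powr)
    next
      assume "r \<le> A powr p"
      then have "r powr (1 / p) \<le> (A powr p) powr (1 / p)" using assms r by (intro powr_mono2) auto
      then show "r powr (1 / p) \<le> A" using assms by (simp add: powr_powr)
    qed
    then show ?thesis using r assms by (simp add: Lp_norm_def Let_def I_def[symmetric])
  qed
qed

lemma tendsto_Lp_norm_0:
  assumes p: "p > 0" and lim: "((\<lambda>\<tau>. \<integral>\<^sup>+x. ennreal (norm (f \<tau> x) powr p) \<partial>M) \<longlongrightarrow> 0) \<F>"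
  shows "((\<lambda>\<tau>. Lp_norm p M (f \<tau>)) \<longlongrightarrow> 0) \<F>"
proof (rule tendsto_zero_ennreal)
  fix r :: real assume r: "r > 0"
  have "ennreal ((r / 2) powr p) > 0" using r by simp
  from order_tendstoD(2)[OF lim this]
  show "\<forall>\<^sub>F \<tau> in \<F>. Lp_norm p M (f \<tau>) < ennreal r"
  proof eventually_elim
    case (elim \<tau>)
    then have "Lp_norm p M (f \<tau>) \<le> ennreal (r / 2)" using r p by (subst Lp_norm_le_iff) auto
    also have "\<dots> < ennreal r" using r by (simp add: ennreal_less_iff)
    finally show ?case .
  qed
qed

section \<open>The exterior of the half-strip as a union of three half-planes\<close>

lemma Omega_plus_iff: "w \<in> Omega_plus \<sigma> \<longleftrightarrow> \<bar>Re w\<bar> < \<sigma> \<and> Im w > 0"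
  by (cases w) (auto simp: Omega_plus_def half_strip_def)

lemma Omega_minus_iff:
  assumes "\<sigma> > 0"
  shows "w \<in> Omega_minus \<sigma> \<longleftrightarrow> Re w < - \<sigma> \<or> Im w < 0 \<or> Re w > \<sigma>"
proof -
  have "closure (half_strip \<sigma> 0) = half_strip \<sigma> 0 \<union> Gamma_bd \<sigma> 0"
    using closure_Un_frontier[of "half_strip \<sigma> 0"] frontier_half_strip[OF assms, of 0] by simp
  then show ?thesis
    using assms by (cases w) (auto simp: Omega_minus_def half_strip_def Gamma_bd_def Gamma1_def Gamma2_def Gamma3_def)
qed

lemma open_Omega_minus: "open (Omega_minus \<sigma>)"
  by (simp add: Omega_minus_def open_Compl)

lemma Gamma_bd_subset_Omega_minus:
  assumes "\<sigma> > 0" "s > \<sigma>" "t < 0"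
  shows "Gamma_bd s t \<subseteq> Omega_minus \<sigma>"
  using assms by (auto simp: Omega_minus_iff Gamma_bd_def Gamma1_def Gamma2_def Gamma3_def)

definition left_half :: "real \<Rightarrow> (complex \<Rightarrow> complex) \<Rightarrow> complex \<Rightarrow> complex" where
  "left_half \<sigma> F z = F (\<i> * z - of_real \<sigma>)"

definition lower_half :: "(complex \<Rightarrow> complex) \<Rightarrow> complex \<Rightarrow> complex" where
  "lower_half F z = F (- z)"

definition right_half :: "real \<Rightarrow> (complex \<Rightarrow> complex) \<Rightarrow> complex \<Rightarrow> complex" where
  "right_half \<sigma> F z = F (of_real \<sigma> - \<i> * z)"

lemma half_Complex:
  "left_half \<sigma> F (Complex v y) = F (Complex (- \<sigma> - y) v)"
  "lower_half F (Complex u y) = F (Complex (- u) (- y))"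
  "right_half \<sigma> F (Complex v y) = F (Complex (\<sigma> + y) (- v))"
proof -
  have "\<i> * Complex v y - of_real \<sigma> = Complex (- \<sigma> - y) v" "- Complex u y = Complex (- u) (- y)"
    "of_real \<sigma> - \<i> * Complex v y = Complex (\<sigma> + y) (- v)" by (auto simp: complex_eq_iff)
  then show "left_half \<sigma> F (Complex v y) = F (Complex (- \<sigma> - y) v)"
    "lower_half F (Complex u y) = F (Complex (- u) (- y))"
    "right_half \<sigma> F (Complex v y) = F (Complex (\<sigma> + y) (- v))"
    by (simp_all only: left_half_def lower_half_def right_half_def)
qed

lemma Lp_pow_reflect:
  assumes "g \<in> borel_measurable borel"
  shows "Lp_pow p (\<lambda>x. g (- x)) = Lp_pow p g"
proof -
  note [measurable] = assms
  have "Lp_pow p g = (\<integral>\<^sup>+x. ennreal (norm (g (0 + (-1) * x)) powr p) \<partial>lborel)"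
    unfolding Lp_pow_def by (subst nn_integral_real_affine[of _ "-1" 0]) auto
  then show ?thesis by (simp add: Lp_pow_def)
qed

lemma holomorphic_halves:
  assumes \<sigma>: "\<sigma> > 0" and F: "F holomorphic_on Omega_minus \<sigma>"
  shows "left_half \<sigma> F holomorphic_on {z. Im z > 0}" "lower_half F holomorphic_on {z. Im z > 0}"
    "right_half \<sigma> F holomorphic_on {z. Im z > 0}"
  unfolding left_half_def lower_half_def right_half_def
  by (rule holomorphic_on_compose_gen[OF _ F, unfolded o_def];
      auto intro!: holomorphic_intros simp: Omega_minus_iff[OF \<sigma>])+

lemma borel_measurable_on_Gamma_bd:
  assumes "\<sigma> > 0" "s > \<sigma>" "t < 0" and F: "F holomorphic_on Omega_minus \<sigma>"
  shows "(\<lambda>w. indicator (Gamma_bd s t) w *\<^sub>R F w) \<in> borel_measurable borel"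
  using assms(1-3)
  by (intro borel_measurable_continuous_on_indicator Gamma_bd_borel
      continuous_on_subset[OF holomorphic_on_imp_continuous_on[OF F]] Gamma_bd_subset_Omega_minus) auto

lemma nn_integral_arc_powr:
  assumes s: "s > 0" and p: "p > 0" and F: "(\<lambda>w. indicator (Gamma_bd s t) w *\<^sub>R F w) \<in> borel_measurable borel"
  shows "(\<integral>\<^sup>+w. ennreal (norm (F w) powr p) \<partial>arc_measure s t) =
    Lp_pow p (\<lambda>v. indicator {t<..} v *\<^sub>R F (Complex (- s) v)) + Lp_pow p (\<lambda>u. indicator {-s..s} u *\<^sub>R F (Complex u t))
      + Lp_pow p (\<lambda>v. indicator {t<..} v *\<^sub>R F (Complex s v))"
proof -
  have ind: "ennreal (norm (indicator A x *\<^sub>R z) powr p) = ennreal (norm z powr p) * indicator A x" for A x and z :: complex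
    by (simp add: indicator_def)
  have "(\<lambda>w. ennreal (norm (indicator (Gamma_bd s t) w *\<^sub>R F w) powr p)) \<in> borel_measurable borel"
    using F by measurable
  then have "(\<lambda>w. ennreal (norm (F w) powr p) * indicator (Gamma_bd s t) w) \<in> borel_measurable borel"
    unfolding ind .
  from nn_integral_arc_measure[OF s this] show ?thesis
    unfolding Lp_pow_def ind .
qed

lemma Hp_space_arc_bound:
  assumes \<sigma>: "\<sigma> > 0" and p: "1 < p" and F: "F \<in> Hp_space \<sigma> p" and st: "s > \<sigma>" "t < 0"
  shows "(\<integral>\<^sup>+w. ennreal (norm (F w) powr p) \<partial>arc_measure s t) \<le> ennreal (enn2real (Hp_norm \<sigma> p F) powr p)"
proof -
  have "Lp_norm p (arc_measure s t) F \<le> Hp_norm \<sigma> p F"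
    unfolding Hp_norm_def using st by (intro SUP_upper2[of "(s, t)"]) auto
  also have "Hp_norm \<sigma> p F = ennreal (enn2real (Hp_norm \<sigma> p F))"
    using F by (simp add: Hp_space_def)
  finally show ?thesis using p by (subst (asm) Lp_norm_le_iff) auto
qed

text \<open>
Exhaust each line by its intersections with the contours \<open>Gamma_bd s t\<close> and apply Fatou's lemma: for
horizontal lines \<open>s \<rightarrow> \<infinity>\<close> at fixed \<open>t\<close>, for vertical lines \<open>t \<rightarrow> -\<infinity>\<close> at fixed \<open>s\<close>. Adding 1 makes the bound positive
also for \<open>F = 0\<close>.
\<close>
lemma half_plane_Hp_halves:
  assumes \<sigma>: "\<sigma> > 0" and p: "1 < p" and F: "F \<in> Hp_space \<sigma> p"
  defines "K \<equiv> enn2real (Hp_norm \<sigma> p F) powr p"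
  shows "half_plane_Hp p (K + 1) (left_half \<sigma> F)" "half_plane_Hp p (K + 1) (lower_half F)"
    "half_plane_Hp p (K + 1) (right_half \<sigma> F)"
proof -
  have holo: "F holomorphic_on Omega_minus \<sigma>"
    using F by (simp add: Hp_space_def analytic_imp_holomorphic)
  note hol = holomorphic_halves[OF \<sigma> holo]
  have K: "ennreal K \<le> ennreal (K + 1)" by (rule ennreal_leI) simp
  have sum: "Lp_pow p (\<lambda>v. indicator {t<..} v *\<^sub>R F (Complex (- s) v)) + Lp_pow p (\<lambda>u. indicator {-s..s} u *\<^sub>R F (Complex u t))
      + Lp_pow p (\<lambda>v. indicator {t<..} v *\<^sub>R F (Complex s v)) \<le> ennreal K" if "s > \<sigma>" "t < 0" for s t
    using Hp_space_arc_bound[OF \<sigma> p F that] nn_integral_arc_powr[OF _ _ borel_measurable_on_Gamma_bd[OF \<sigma> that holo], of p] that \<sigma> p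
    by (simp add: K_def)
  have le: "a \<le> c" "b \<le> c" "d \<le> c" if "a + b + d \<le> c" for a b c d :: ennreal
    using that by (meson add_increasing add_increasing2 order_trans order_refl zero_le le_iff_add)+
  have cont: "continuous_on UNIV (\<lambda>v. F (Complex (- s) v))" "continuous_on UNIV (\<lambda>v. F (Complex s v))" if "s > \<sigma>" for s
    using that \<sigma>
    by (auto intro!: continuous_on_compose2[OF holomorphic_on_imp_continuous_on[OF holo]] continuous_intros simp: Complex_eq Omega_minus_iff)
  have cont2: "continuous_on UNIV (\<lambda>u. F (Complex u t))" if "t < 0" for t
    using that \<sigma>
    by (auto intro!: continuous_on_compose2[OF holomorphic_on_imp_continuous_on[OF holo]] continuous_intros simp: Complex_eq Omega_minus_iff)
  have vert: "Lp_pow p (\<lambda>v. F (Complex c v)) \<le> ennreal K" if c: "c = s \<or> c = - s" and s: "s > \<sigma>" for c s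
  proof (rule Lp_pow_Fatou[where u = "\<lambda>n v. indicator {- real (Suc n)<..} v *\<^sub>R F (Complex c v)" and N = 0])
    show "(\<lambda>v. indicator {- real (Suc n)<..} v *\<^sub>R F (Complex c v)) \<in> borel_measurable borel" for n
      using cont[OF s] c by (intro borel_measurable_continuous_on_indicator) (auto intro: continuous_on_subset)
    show "AE v in lborel. (\<lambda>n. indicator {- real (Suc n)<..} v *\<^sub>R F (Complex c v)) \<longlonglongrightarrow> F (Complex c v)"
    proof (rule AE_I2, rule tendsto_eventually)
      fix v
      obtain N where N: "- v < real N" using reals_Archimedean2 by blast
      then have "- real (Suc n) < v" if "n \<ge> N" for n using that by simp
      then show "\<forall>\<^sub>F n in sequentially. indicator {- real (Suc n)<..} v *\<^sub>R F (Complex c v) = F (Complex c v)"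
        by (intro eventually_sequentiallyI[of N]) (auto simp: indicator_def)
    qed
    show "Lp_pow p (\<lambda>v. indicator {- real (Suc n)<..} v *\<^sub>R F (Complex c v)) \<le> ennreal K" for n
      using le(1,3)[OF sum[OF s, of "- real (Suc n)"]] c by auto
  qed (use p in auto)
  have hor: "Lp_pow p (\<lambda>u. F (Complex u t)) \<le> ennreal K" if t: "t < 0" for t
  proof (rule Lp_pow_Fatou[where u = "\<lambda>n u. indicator {- (\<sigma> + real (Suc n))..\<sigma> + real (Suc n)} u *\<^sub>R F (Complex u t)" and N = 0])
    show "(\<lambda>u. indicator {- (\<sigma> + real (Suc n))..\<sigma> + real (Suc n)} u *\<^sub>R F (Complex u t)) \<in> borel_measurable borel" for n
      using cont2[OF t] by (intro borel_measurable_continuous_on_indicator) (auto intro: continuous_on_subset)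
    show "AE u in lborel. (\<lambda>n. indicator {- (\<sigma> + real (Suc n))..\<sigma> + real (Suc n)} u *\<^sub>R F (Complex u t)) \<longlonglongrightarrow> F (Complex u t)"
    proof (rule AE_I2, rule tendsto_eventually)
      fix u
      obtain N where N: "\<bar>u\<bar> < real N" using reals_Archimedean2 by blast
      have "u \<in> {- (\<sigma> + real (Suc n))..\<sigma> + real (Suc n)}" if "n \<ge> N" for n using that N \<sigma> by (simp add: abs_less_iff)
      then show "\<forall>\<^sub>F n in sequentially. indicator {- (\<sigma> + real (Suc n))..\<sigma> + real (Suc n)} u *\<^sub>R F (Complex u t) = F (Complex u t)"
        by (intro eventually_sequentiallyI[of N]) (simp only: indicator_simps scaleR_one)
    qed
    show "Lp_pow p (\<lambda>u. indicator {- (\<sigma> + real (Suc n))..\<sigma> + real (Suc n)} u *\<^sub>R F (Complex u t)) \<le> ennreal K" for n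
      using le(2)[OF sum[OF _ t, of "\<sigma> + real (Suc n)"]] by simp
  qed (use p in auto)
  have "Lp_pow p (\<lambda>v. left_half \<sigma> F (Complex v y)) \<le> ennreal (K + 1)" if "y > 0" for y
    unfolding half_Complex using that vert[of "- \<sigma> - y" "\<sigma> + y"] K by (auto intro: order_trans)
  then show "half_plane_Hp p (K + 1) (left_half \<sigma> F)" using hol by (simp add: half_plane_Hp_def)
  have "Lp_pow p (\<lambda>v. right_half \<sigma> F (Complex v y)) \<le> ennreal (K + 1)" if "y > 0" for y
    unfolding half_Complex using that vert[of "\<sigma> + y" "\<sigma> + y"] K cont(2)[of "\<sigma> + y"]
      Lp_pow_reflect[of "\<lambda>v. F (Complex (\<sigma> + y) v)" p]
    by (auto intro: order_trans simp: borel_measurable_continuous_onI)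
  then show "half_plane_Hp p (K + 1) (right_half \<sigma> F)" using hol by (simp add: half_plane_Hp_def)
  have "Lp_pow p (\<lambda>u. lower_half F (Complex u y)) \<le> ennreal (K + 1)" if "y > 0" for y
    unfolding half_Complex using that hor[of "- y"] K cont2[of "- y"]
      Lp_pow_reflect[of "\<lambda>u. F (Complex u (- y))" p]
    by (auto intro: order_trans simp: borel_measurable_continuous_onI)
  then show "half_plane_Hp p (K + 1) (lower_half F)" using hol by (simp add: half_plane_Hp_def)
qed

lemma Hp_space_pointwise:
  assumes \<sigma>: "\<sigma> > 0" and p: "1 < p" and F: "F \<in> Hp_space \<sigma> p"
  obtains C where "C > 0"
    "\<And>x y. y > 0 \<Longrightarrow> norm (F (Complex (- \<sigma> - y) x)) \<le> C * y powr (- 1 / p)"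
    "\<And>x y. y > 0 \<Longrightarrow> norm (F (Complex x (- y))) \<le> C * y powr (- 1 / p)"
    "\<And>x y. y > 0 \<Longrightarrow> norm (F (Complex (\<sigma> + y) x)) \<le> C * y powr (- 1 / p)"
proof -
  note H = half_plane_Hp_halves[OF \<sigma> p F]
  have K: "enn2real (Hp_norm \<sigma> p F) powr p + 1 > 0" by (simp add: add_nonneg_pos)
  obtain C1 where C1: "C1 > 0" "\<And>z. Im z > 0 \<Longrightarrow> norm (left_half \<sigma> F z) \<le> C1 * Im z powr (- 1 / p)"
    using half_plane_Hp_pointwise[OF p K H(1)] by blast
  obtain C2 where C2: "C2 > 0" "\<And>z. Im z > 0 \<Longrightarrow> norm (lower_half F z) \<le> C2 * Im z powr (- 1 / p)"
    using half_plane_Hp_pointwise[OF p K H(2)] by blast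
  obtain C3 where C3: "C3 > 0" "\<And>z. Im z > 0 \<Longrightarrow> norm (right_half \<sigma> F z) \<le> C3 * Im z powr (- 1 / p)"
    using half_plane_Hp_pointwise[OF p K H(3)] by blast
  have up: "n \<le> (C1 + C2 + C3) * r" if "n \<le> C * r" "C = C1 \<or> C = C2 \<or> C = C3" "r \<ge> 0" for n r C :: real
  proof -
    have "C * r \<le> (C1 + C2 + C3) * r" using that C1(1) C2(1) C3(1) by (intro mult_right_mono) auto
    with that(1) show ?thesis by linarith
  qed
  show ?thesis
  proof (rule that)
    show "C1 + C2 + C3 > 0" using C1 C2 C3 by simp
    fix x y :: real assume y: "y > 0"
    show "norm (F (Complex (- \<sigma> - y) x)) \<le> (C1 + C2 + C3) * y powr (- 1 / p)"
      using C1(2)[of "Complex x y"] y by (intro up[of _ C1]) (auto simp: half_Complex)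
    show "norm (F (Complex x (- y))) \<le> (C1 + C2 + C3) * y powr (- 1 / p)"
      using C2(2)[of "Complex (- x) y"] y by (intro up[of _ C2]) (auto simp: half_Complex)
    show "norm (F (Complex (\<sigma> + y) x)) \<le> (C1 + C2 + C3) * y powr (- 1 / p)"
      using C3(2)[of "Complex (- x) y"] y by (intro up[of _ C3]) (auto simp: half_Complex)
  qed
qed

section \<open>Pairing with a decaying kernel\<close>

text \<open>
Young's inequality with a small weight on the kernel. The constant \<open>N\<close> depends on \<open>C\<close> and \<open>e\<close> but not on \<open>g\<close> or
\<open>k\<close>, so that the bound can be used along a sequence.
\<close>
lemma nn_integral_Lp_times_decay:
  assumes p: "1 < p" and C: "C \<ge> 0" and e: "e > 0"
  obtains N where "N \<ge> 0" "\<And>g k. \<lbrakk>g \<in> borel_measurable borel; k \<in> borel_measurable borel; \<And>v. norm (k v) \<le> C / (1 + \<bar>v\<bar>)\<rbrakk>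
     \<Longrightarrow> (\<integral>\<^sup>+v. ennreal (norm (g v * k v :: complex)) \<partial>lborel) \<le> ennreal N * Lp_pow p g + ennreal e"
proof -
  define q where "q = p / (p - 1)"
  have q: "q > 1" using p by (simp add: q_def less_divide_eq)
  have pq: "1 / p + 1 / q = 1" using p by (simp add: q_def add_divide_distrib[symmetric])
  define M where "M = (\<integral>v. C powr q * (1 + \<bar>v\<bar>) powr - q \<partial>lborel)"
  have int: "integrable lborel (\<lambda>v. C powr q * (1 + \<bar>v\<bar>) powr - q)"
    by (intro integrable_mult_right integrable_powr_tail q)
  have M: "(\<integral>\<^sup>+v. ennreal (C powr q * (1 + \<bar>v\<bar>) powr - q) \<partial>lborel) = ennreal M"
    unfolding M_def by (rule nn_integral_eq_integral[OF int]) auto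
  have M0: "M \<ge> 0" unfolding M_def by (intro integral_nonneg_AE) auto
  \<comment> \<open>The weight makes the contribution \<open>\<theta>\<^sup>q M\<close> of the kernel at most \<open>e\<close>.\<close>
  define \<theta> where "\<theta> = (e / (M + 1)) powr (1 / q)"
  have \<theta>: "\<theta> > 0" using e M0 by (simp add: \<theta>_def)
  have \<theta>q: "\<theta> powr q * M \<le> e"
  proof -
    have "\<theta> powr q = e / (M + 1)" using e M0 q by (simp add: \<theta>_def powr_powr)
    moreover have "e * (M / (M + 1)) \<le> e * 1" using e M0 by (intro mult_left_mono) auto
    ultimately show ?thesis by simp
  qed
  show ?thesis
  proof (rule that[of "\<theta> powr - p"])
    show "\<theta> powr - p \<ge> 0" by simp
    fix g k :: "real \<Rightarrow> complex"
    assume [measurable]: "g \<in> borel_measurable borel" "k \<in> borel_measurable borel"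
      and k: "\<And>v. norm (k v) \<le> C / (1 + \<bar>v\<bar>)"
    have "(\<integral>\<^sup>+v. ennreal (norm (g v * k v)) \<partial>lborel) \<le>
       (\<integral>\<^sup>+v. ennreal (\<theta> powr - p) * ennreal (norm (g v) powr p) + ennreal (\<theta> powr q) * ennreal (C powr q * (1 + \<bar>v\<bar>) powr - q) \<partial>lborel)"
    proof (intro nn_integral_mono)
      fix v
      have g': "(norm (g v) / \<theta>) powr p = \<theta> powr - p * norm (g v) powr p"
        using \<theta> by (simp add: powr_divide powr_minus_divide)
      have "(\<theta> * norm (k v)) powr q \<le> (\<theta> * (C / (1 + \<bar>v\<bar>))) powr q"
        using \<theta> k q by (intro powr_mono2 mult_left_mono) auto
      also have "\<dots> = \<theta> powr q * (C powr q * (1 + \<bar>v\<bar>) powr - q)"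
        using \<theta> C by (simp add: powr_mult powr_divide powr_minus_divide)
      finally have k': "(\<theta> * norm (k v)) powr q \<le> \<theta> powr q * (C powr q * (1 + \<bar>v\<bar>) powr - q)" .
      have "norm (g v * k v) = (norm (g v) / \<theta>) * (\<theta> * norm (k v))"
        using \<theta> by (simp add: norm_mult)
      also have "\<dots> \<le> (norm (g v) / \<theta>) powr p / p + (\<theta> * norm (k v)) powr q / q"
        using p q \<theta> by (intro Youngs_inequality pq) auto
      also have "\<dots> \<le> (norm (g v) / \<theta>) powr p / 1 + (\<theta> * norm (k v)) powr q / 1"
        using p q by (intro add_mono divide_left_mono) auto
      finally have "norm (g v * k v) \<le> \<theta> powr - p * norm (g v) powr p + \<theta> powr q * (C powr q * (1 + \<bar>v\<bar>) powr - q)"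
        using g' k' by simp
      then have "ennreal (norm (g v * k v)) \<le> ennreal (\<theta> powr - p * norm (g v) powr p + \<theta> powr q * (C powr q * (1 + \<bar>v\<bar>) powr - q))"
        by (rule ennreal_leI)
      then show "ennreal (norm (g v * k v)) \<le> ennreal (\<theta> powr - p) * ennreal (norm (g v) powr p) + ennreal (\<theta> powr q) * ennreal (C powr q * (1 + \<bar>v\<bar>) powr - q)"
        by (simp only: ennreal_plus ennreal_mult mult_nonneg_nonneg powr_ge_zero)
    qed
    also have "\<dots> = ennreal (\<theta> powr - p) * Lp_pow p g + ennreal (\<theta> powr q) * ennreal M"
    proof -
      have m: "(\<lambda>v. ennreal (norm (g v) powr p)) \<in> borel_measurable lborel"
        "(\<lambda>v. ennreal (C powr q * (1 + \<bar>v\<bar>) powr - q)) \<in> borel_measurable lborel"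
        by measurable
      have "(\<integral>\<^sup>+v. ennreal (\<theta> powr - p) * ennreal (norm (g v) powr p) + ennreal (\<theta> powr q) * ennreal (C powr q * (1 + \<bar>v\<bar>) powr - q) \<partial>lborel)
        = (\<integral>\<^sup>+v. ennreal (\<theta> powr - p) * ennreal (norm (g v) powr p) \<partial>lborel) + (\<integral>\<^sup>+v. ennreal (\<theta> powr q) * ennreal (C powr q * (1 + \<bar>v\<bar>) powr - q) \<partial>lborel)"
        by (rule nn_integral_add) measurable
      then show ?thesis by (simp only: nn_integral_cmult m Lp_pow_def M)
    qed
    also have "\<dots> \<le> ennreal (\<theta> powr - p) * Lp_pow p g + ennreal e"
    proof (rule add_left_mono)
      show "ennreal (\<theta> powr q) * ennreal M \<le> ennreal e"
        using \<theta>q M0 by (simp add: ennreal_leI flip: ennreal_mult)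
    qed
    finally show "(\<integral>\<^sup>+v. ennreal (norm (g v * k v)) \<partial>lborel) \<le> ennreal (\<theta> powr - p) * Lp_pow p g + ennreal e" .
  qed
qed

lemma integrable_Lp_times_decay:
  fixes g k :: "real \<Rightarrow> complex"
  assumes p: "1 < p" and C: "C \<ge> 0" and [measurable]: "g \<in> borel_measurable borel" "k \<in> borel_measurable borel"
    and k: "\<And>v. norm (k v) \<le> C / (1 + \<bar>v\<bar>)" and fin: "Lp_pow p g < \<infinity>"
  shows "integrable lborel (\<lambda>v. g v * k v)"
proof -
  obtain N where "(\<integral>\<^sup>+v. ennreal (norm (g v * k v)) \<partial>lborel) \<le> ennreal N * Lp_pow p g + ennreal 1"
    by (rule nn_integral_Lp_times_decay[OF p C zero_less_one]) (use assms(3,4) k in blast)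
  then have "(\<integral>\<^sup>+v. ennreal (norm (g v * k v)) \<partial>lborel) < \<infinity>"
    using fin by (auto simp: ennreal_mult_less_top intro: le_less_trans)
  then show ?thesis by (simp add: integrable_iff_bounded)
qed

text \<open>
Split off \<open>g n - g0\<close>: the remaining integrals converge by dominated convergence, and those of the
difference tend to 0 by the preceding bound.
\<close>
lemma tendsto_integral_Lp_times_decay:
  fixes g :: "nat \<Rightarrow> real \<Rightarrow> complex"
  assumes p: "1 < p" and C: "C \<ge> 0"
    and meas[measurable]: "\<And>n. g n \<in> borel_measurable borel" "\<And>n. k n \<in> borel_measurable borel"
      "g0 \<in> borel_measurable borel" "k0 \<in> borel_measurable borel"
    and k: "\<And>n v. norm (k n v) \<le> C / (1 + \<bar>v\<bar>)" "\<And>v. norm (k0 v) \<le> C / (1 + \<bar>v\<bar>)"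
    and fin: "Lp_pow p g0 < \<infinity>" "\<And>n. Lp_pow p (g n) < \<infinity>"
    and limg: "(\<lambda>n. Lp_pow p (\<lambda>v. g n v - g0 v)) \<longlonglongrightarrow> 0"
    and limk: "AE v in lborel. (\<lambda>n. k n v) \<longlonglongrightarrow> k0 v"
  shows "(\<lambda>n. \<integral>v. g n v * k n v \<partial>lborel) \<longlonglongrightarrow> (\<integral>v. g0 v * k0 v \<partial>lborel)"
proof -
  have int: "integrable lborel (\<lambda>v. g n v * k n v)" "integrable lborel (\<lambda>v. g0 v * k n v)" for n
    using k fin by (auto intro!: integrable_Lp_times_decay[OF p C] meas)
  have dom: "integrable lborel (\<lambda>v. g0 v * of_real (C / (1 + \<bar>v\<bar>)))"
    using fin C by (intro integrable_Lp_times_decay[OF p C]) (auto simp del: of_real_divide of_real_add)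
  have "(\<lambda>n. \<integral>v. g0 v * k n v \<partial>lborel) \<longlonglongrightarrow> (\<integral>v. g0 v * k0 v \<partial>lborel)"
  proof (rule integral_dominated_convergence[where w = "\<lambda>v. norm (g0 v * of_real (C / (1 + \<bar>v\<bar>)))"])
    show "AE v in lborel. (\<lambda>n. g0 v * k n v) \<longlonglongrightarrow> g0 v * k0 v"
      using limk by eventually_elim (intro tendsto_intros)
    show "AE v in lborel. norm (g0 v * k n v) \<le> norm (g0 v * of_real (C / (1 + \<bar>v\<bar>)))" for n
    proof (rule AE_I2)
      fix v
      have "norm (g0 v) * norm (k n v) \<le> norm (g0 v) * (C / (1 + \<bar>v\<bar>))"
        by (intro mult_left_mono k) auto
      then show "norm (g0 v * k n v) \<le> norm (g0 v * of_real (C / (1 + \<bar>v\<bar>)))"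
        using C by (simp only: norm_mult norm_of_real abs_of_nonneg divide_nonneg_pos abs_ge_zero add_pos_nonneg zero_less_one)
    qed
  qed (use dom integrable_norm in auto)
  moreover have "(\<lambda>n. \<integral>v. (g n v - g0 v) * k n v \<partial>lborel) \<longlonglongrightarrow> 0"
  proof (rule Lim_null_comparison[OF always_eventually])
    show "\<forall>n. norm (\<integral>v. (g n v - g0 v) * k n v \<partial>lborel) \<le> enn2real (\<integral>\<^sup>+v. ennreal (norm ((g n v - g0 v) * k n v)) \<partial>lborel)"
    proof
      fix n
      have "integrable lborel (\<lambda>v. (g n v - g0 v) * k n v)"
        using Bochner_Integration.integrable_diff[OF int] by (simp add: left_diff_distrib)
      then have "ennreal (norm (\<integral>v. (g n v - g0 v) * k n v \<partial>lborel)) \<le> (\<integral>\<^sup>+v. ennreal (norm ((g n v - g0 v) * k n v)) \<partial>lborel)"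
        "(\<integral>\<^sup>+v. ennreal (norm ((g n v - g0 v) * k n v)) \<partial>lborel) < top"
        by (auto intro: integral_norm_bound_ennreal simp: integrable_iff_bounded)
      from enn2real_mono[OF this]
      show "norm (\<integral>v. (g n v - g0 v) * k n v \<partial>lborel) \<le> enn2real (\<integral>\<^sup>+v. ennreal (norm ((g n v - g0 v) * k n v)) \<partial>lborel)"
        by (simp only: enn2real_ennreal norm_ge_zero)
    qed
    have "(\<lambda>n. \<integral>\<^sup>+v. ennreal (norm ((g n v - g0 v) * k n v)) \<partial>lborel) \<longlonglongrightarrow> 0"
    proof (rule tendsto_zero_ennreal)
      fix r :: real assume r: "r > 0"
      obtain N where N: "N \<ge> 0" "\<And>g k. \<lbrakk>g \<in> borel_measurable borel; k \<in> borel_measurable borel; \<And>v. norm (k v) \<le> C / (1 + \<bar>v\<bar>)\<rbrakk>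
         \<Longrightarrow> (\<integral>\<^sup>+v. ennreal (norm (g v * k v :: complex)) \<partial>lborel) \<le> ennreal N * Lp_pow p g + ennreal (r / 2)"
        using nn_integral_Lp_times_decay[OF p C, of "r / 2"] r by auto
      have "(\<lambda>n. ennreal N * Lp_pow p (\<lambda>v. g n v - g0 v)) \<longlonglongrightarrow> ennreal N * 0"
        by (intro ennreal_tendsto_cmult limg) auto
      then have "\<forall>\<^sub>F n in sequentially. ennreal N * Lp_pow p (\<lambda>v. g n v - g0 v) < ennreal (r / 2)"
        using r by (intro order_tendstoD(2)) auto
      then show "\<forall>\<^sub>F n in sequentially. (\<integral>\<^sup>+v. ennreal (norm ((g n v - g0 v) * k n v)) \<partial>lborel) < ennreal r"
      proof eventually_elim
        case (elim n)
        have "(\<integral>\<^sup>+v. ennreal (norm ((g n v - g0 v) * k n v)) \<partial>lborel) \<le> ennreal N * Lp_pow p (\<lambda>v. g n v - g0 v) + ennreal (r / 2)"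
          using k by (intro N(2)) auto
        also have "\<dots> < ennreal (r / 2) + ennreal (r / 2)"
          using elim by (simp add: add.commute ennreal_add_left_cancel_less)
        also have "\<dots> = ennreal r" using r by (simp flip: ennreal_plus)
        finally show ?case .
      qed
    qed
    then have "(\<lambda>n. \<integral>\<^sup>+v. ennreal (norm ((g n v - g0 v) * k n v)) \<partial>lborel) \<longlonglongrightarrow> ennreal 0"
      by (simp only: ennreal_0)
    then show "(\<lambda>n. enn2real (\<integral>\<^sup>+v. ennreal (norm ((g n v - g0 v) * k n v)) \<partial>lborel)) \<longlonglongrightarrow> 0"
      by (rule tendsto_enn2real) simp
  qed
  ultimately have "(\<lambda>n. (\<integral>v. (g n v - g0 v) * k n v \<partial>lborel) + (\<integral>v. g0 v * k n v \<partial>lborel)) \<longlonglongrightarrow> 0 + (\<integral>v. g0 v * k0 v \<partial>lborel)"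
    by (intro tendsto_add)
  moreover have "(\<integral>v. (g n v - g0 v) * k n v \<partial>lborel) + (\<integral>v. g0 v * k n v \<partial>lborel) = (\<integral>v. g n v * k n v \<partial>lborel)" for n
    using int by (simp add: left_diff_distrib)
  ultimately show ?thesis by simp
qed

section \<open>Cauchy's formula on the boundary of a larger half-strip\<close>

text \<open>
The part below height \<open>R\<close> of the integral over \<open>Gamma_bd s t\<close>, with the orientation of \<^const>\<open>tangent\<close>.
\<close>
definition strip_contour :: "real \<Rightarrow> real \<Rightarrow> real \<Rightarrow> (complex \<Rightarrow> complex) \<Rightarrow> complex" where
  "strip_contour s t R h = - \<i> * integral {t..R} (\<lambda>v. h (Complex (- s) v))
     + integral {-s..s} (\<lambda>u. h (Complex u t)) + \<i> * integral {t..R} (\<lambda>v. h (Complex s v))"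

text \<open>
The sides of the square of half-side \<open>R\<close>, counterclockwise, without the part of the top side between \<open>-s\<close> and \<open>s\<close>.
\<close>
definition outer_contour :: "real \<Rightarrow> real \<Rightarrow> (complex \<Rightarrow> complex) \<Rightarrow> complex" where
  "outer_contour s R h = integral {-R..R} (\<lambda>u. h (Complex u (- R))) + \<i> * integral {-R..R} (\<lambda>v. h (Complex R v))
     - \<i> * integral {-R..R} (\<lambda>v. h (Complex (- R) v))
     - integral {-R..-s} (\<lambda>u. h (Complex u R)) - integral {s..R} (\<lambda>u. h (Complex u R))"

lemma continuous_on_Complex_line:
  assumes "continuous_on D h"
  shows "(\<And>v. v \<in> A \<Longrightarrow> Complex c v \<in> D) \<Longrightarrow> continuous_on A (\<lambda>v. h (Complex c v))"
    and "(\<And>u. u \<in> A \<Longrightarrow> Complex u c \<in> D) \<Longrightarrow> continuous_on A (\<lambda>u. h (Complex u c))"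
  by (rule continuous_on_compose2[OF assms]; auto simp: Complex_eq intro!: continuous_intros)+

lemma integral_split:
  fixes h :: "real \<Rightarrow> complex"
  assumes "a \<le> b" "b \<le> c" "continuous_on {a..c} h"
  shows "integral {a..c} h = integral {a..b} h + integral {b..c} h"
  using Henstock_Kurzweil_Integration.integral_combine[OF assms(1,2) integrable_continuous_real[OF assms(3)]] by simp

text \<open>
The region between the two contours consists of the rectangles \<open>[-R,-s] \<times> [t,R]\<close>, \<open>[-R,R] \<times> [-R,t]\<close> and
\<open>[s,R] \<times> [t,R]\<close>.
\<close>
lemma strip_contour_eq_outer_contour:
  assumes \<sigma>: "\<sigma> > 0" and st: "s > \<sigma>" "t < 0" and R: "R > s" "R > - t" and h: "h holomorphic_on Omega_minus \<sigma>"
  shows "strip_contour s t R h = outer_contour s R h"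
proof -
  have cont: "continuous_on (Omega_minus \<sigma>) h" using h by (rule holomorphic_on_imp_continuous_on)
  have sub: "cbox (Complex (- R) t) (Complex (- s) R) \<subseteq> Omega_minus \<sigma>"
    "cbox (Complex (- R) (- R)) (Complex R t) \<subseteq> Omega_minus \<sigma>"
    "cbox (Complex s t) (Complex R R) \<subseteq> Omega_minus \<sigma>"
    using \<sigma> st by (auto simp: Omega_minus_iff in_cbox_complex_iff)
  have "box_integral (- R) (- s) t R h = 0" "box_integral (- R) R (- R) t h = 0" "box_integral s R t R h = 0"
    using \<sigma> st R by (intro box_integral_eq_0 holomorphic_on_subset[OF h] sub; simp)+
  moreover have "integral {-R..R} (\<lambda>u. h (Complex u t)) =
      integral {-R..-s} (\<lambda>u. h (Complex u t)) + (integral {-s..s} (\<lambda>u. h (Complex u t)) + integral {s..R} (\<lambda>u. h (Complex u t)))"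
  proof -
    have c: "continuous_on A (\<lambda>u. h (Complex u t))" for A
      using \<sigma> st by (intro continuous_on_Complex_line(2)[OF cont]) (simp add: Omega_minus_iff)
    have "integral {-R..R} (\<lambda>u. h (Complex u t)) = integral {-R..-s} (\<lambda>u. h (Complex u t)) + integral {-s..R} (\<lambda>u. h (Complex u t))"
      using \<sigma> st R by (intro integral_split c) auto
    also have "integral {-s..R} (\<lambda>u. h (Complex u t)) = integral {-s..s} (\<lambda>u. h (Complex u t)) + integral {s..R} (\<lambda>u. h (Complex u t))"
      using \<sigma> st R by (intro integral_split c) auto
    finally show ?thesis .
  qed
  moreover have "integral {-R..R} (\<lambda>v. h (Complex c v)) = integral {-R..t} (\<lambda>v. h (Complex c v)) + integral {t..R} (\<lambda>v. h (Complex c v))"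
    if "c = R \<or> c = - R" for c
    using that \<sigma> st R by (intro integral_split continuous_on_Complex_line(1)[OF cont]) (auto simp: Omega_minus_iff)
  ultimately show ?thesis
    by (simp add: strip_contour_def outer_contour_def box_integral_def algebra_simps)
qed

text \<open>
The difference of the two contours is the full square, which winds once around \<open>w\<close>, minus the boundary of the
truncated half-strip, which does not wind around \<open>w\<close>.
\<close>
lemma outer_contour_minus_strip_contour_reciprocal:
  assumes s: "s > 0" and R: "R > s" "R > t" "R > norm w" and w: "Re w < - s \<or> Im w < t \<or> Re w > s"
  shows "outer_contour s R (\<lambda>\<zeta>. 1 / (\<zeta> - w)) - strip_contour s t R (\<lambda>\<zeta>. 1 / (\<zeta> - w)) = 2 * of_real pi * \<i>"
proof -
  let ?h = "\<lambda>\<zeta>. 1 / (\<zeta> - w)"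
  have wR: "\<bar>Re w\<bar> < R" "\<bar>Im w\<bar> < R"
    using abs_Re_le_cmod[of w] abs_Im_le_cmod[of w] R(3) by linarith+
  have "box_integral (- R) R (- R) R (\<lambda>\<zeta>. (\<lambda>_. 1) \<zeta> / (\<zeta> - w)) = 2 * of_real pi * \<i> * (\<lambda>_. 1) w"
    using wR by (intro box_integral_Cauchy) (auto simp: in_box_complex_iff)
  then have "box_integral (- R) R (- R) R ?h = 2 * of_real pi * \<i>" by simp
  moreover have "box_integral (- s) s t R ?h = 0"
    using s R w by (intro box_integral_eq_0 holomorphic_intros) (auto simp: in_cbox_complex_iff)
  moreover have "integral {-R..R} (\<lambda>u. ?h (Complex u R)) =
      integral {-R..-s} (\<lambda>u. ?h (Complex u R)) + (integral {-s..s} (\<lambda>u. ?h (Complex u R)) + integral {s..R} (\<lambda>u. ?h (Complex u R)))"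
  proof -
    have "continuous_on (- {w}) ?h" by (intro continuous_intros) auto
    then have c: "continuous_on A (\<lambda>u. ?h (Complex u R))" for A
      using wR by (intro continuous_on_Complex_line(2)) auto
    have "integral {-R..R} (\<lambda>u. ?h (Complex u R)) = integral {-R..-s} (\<lambda>u. ?h (Complex u R)) + integral {-s..R} (\<lambda>u. ?h (Complex u R))"
      using s R by (intro integral_split c) auto
    also have "integral {-s..R} (\<lambda>u. ?h (Complex u R)) = integral {-s..s} (\<lambda>u. ?h (Complex u R)) + integral {s..R} (\<lambda>u. ?h (Complex u R))"
      using s R by (intro integral_split c) auto
    finally show ?thesis .
  qed
  ultimately show ?thesis
    by (simp add: strip_contour_def outer_contour_def box_integral_def algebra_simps)
qed

text \<open>
Subtracting \<open>c / (\<zeta> - w)\<close> leaves a function that extends holomorphically to the whole exterior, even when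
\<open>w\<close> lies on a common side of two rectangles; the subtracted term is evaluated by the preceding lemma.
\<close>
lemma strip_contour_Cauchy:
  assumes \<sigma>: "\<sigma> > 0" and st: "s > \<sigma>" "t < 0" and R: "R > s" "R > - t" "R > norm w"
    and F: "F holomorphic_on Omega_minus \<sigma>" and w: "w \<notin> Gamma_bd s t"
    and c: "w \<in> Omega_plus \<sigma> \<and> c = 0 \<or> (Re w < - s \<or> Im w < t \<or> Re w > s) \<and> c = F w"
  shows "strip_contour s t R (\<lambda>\<zeta>. F \<zeta> / (\<zeta> - w)) = outer_contour s R (\<lambda>\<zeta>. F \<zeta> / (\<zeta> - w)) - 2 * of_real pi * \<i> * c"
proof -
  let ?\<phi> = "\<lambda>\<zeta>. F \<zeta> / (\<zeta> - w)" and ?\<psi> = "\<lambda>\<zeta>. 1 / (\<zeta> - w)"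
  obtain h where h: "h holomorphic_on Omega_minus \<sigma>" "\<And>\<zeta>. \<zeta> \<in> Omega_minus \<sigma> - {w} \<Longrightarrow> h \<zeta> = ?\<phi> \<zeta> - c * ?\<psi> \<zeta>"
  proof (cases "w \<in> Omega_plus \<sigma>")
    case True
    then have "w \<notin> Omega_minus \<sigma>" "c = 0"
      using \<sigma> st c by (auto simp: Omega_plus_iff Omega_minus_iff)
    moreover from this have "?\<phi> holomorphic_on Omega_minus \<sigma>"
      by (intro holomorphic_intros F) auto
    ultimately show ?thesis using that[of ?\<phi>] by simp
  next
    case False
    then have "c = F w" using c by auto
    have "(\<lambda>z. if z = w then deriv F w else (F z - F w) / (z - w)) holomorphic_on Omega_minus \<sigma>"
      by (rule pole_lemma_open[OF F open_Omega_minus])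
    then show ?thesis
      by (rule that) (auto simp: \<open>c = F w\<close> diff_divide_distrib)
  qed
  have cont: "continuous_on (Omega_minus \<sigma> - {w}) ?\<phi>" "continuous_on (Omega_minus \<sigma> - {w}) ?\<psi>"
    by (auto intro!: continuous_intros intro: continuous_on_subset[OF holomorphic_on_imp_continuous_on[OF F]])
  have ver: "integral {a..b} (\<lambda>v. h (Complex x v)) = integral {a..b} (\<lambda>v. ?\<phi> (Complex x v)) - c * integral {a..b} (\<lambda>v. ?\<psi> (Complex x v))"
    if "\<And>v. v \<in> {a..b} \<Longrightarrow> Complex x v \<in> Omega_minus \<sigma> - {w}" for a b x
  proof -
    have "integral {a..b} (\<lambda>v. h (Complex x v)) = integral {a..b} (\<lambda>v. ?\<phi> (Complex x v) - c * ?\<psi> (Complex x v))"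
      by (intro integral_cong h(2) that)
    also have "\<dots> = integral {a..b} (\<lambda>v. ?\<phi> (Complex x v)) - integral {a..b} (\<lambda>v. c * ?\<psi> (Complex x v))"
      using that by (intro Henstock_Kurzweil_Integration.integral_diff integrable_continuous_real continuous_on_mult continuous_on_const continuous_on_Complex_line(1)[OF cont(1)] continuous_on_Complex_line(1)[OF cont(2)]) auto
    finally show ?thesis by (simp only: integral_mult_right)
  qed
  have hor: "integral {a..b} (\<lambda>u. h (Complex u y)) = integral {a..b} (\<lambda>u. ?\<phi> (Complex u y)) - c * integral {a..b} (\<lambda>u. ?\<psi> (Complex u y))"
    if "\<And>u. u \<in> {a..b} \<Longrightarrow> Complex u y \<in> Omega_minus \<sigma> - {w}" for a b y
  proof -
    have "integral {a..b} (\<lambda>u. h (Complex u y)) = integral {a..b} (\<lambda>u. ?\<phi> (Complex u y) - c * ?\<psi> (Complex u y))"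
      by (intro integral_cong h(2) that)
    also have "\<dots> = integral {a..b} (\<lambda>u. ?\<phi> (Complex u y)) - integral {a..b} (\<lambda>u. c * ?\<psi> (Complex u y))"
      using that by (intro Henstock_Kurzweil_Integration.integral_diff integrable_continuous_real continuous_on_mult continuous_on_const continuous_on_Complex_line(2)[OF cont(1)] continuous_on_Complex_line(2)[OF cont(2)]) auto
    finally show ?thesis by (simp only: integral_mult_right)
  qed
  have s0: "s > 0" using \<sigma> st by simp
  have wR: "\<bar>Re w\<bar> < R" "\<bar>Im w\<bar> < R"
    using abs_Re_le_cmod[of w] abs_Im_le_cmod[of w] R(3) by linarith+
  have onG: "Complex (- s) v \<noteq> w" "Complex s v \<noteq> w" if "v \<ge> t" for v
    using w Complex_in_Gamma_bd[OF s0] that by blast+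
  have onG2: "Complex u t \<noteq> w" if "\<bar>u\<bar> \<le> s" for u
    using w Complex_in_Gamma_bd[OF s0] that by blast
  have J: "strip_contour s t R h = strip_contour s t R ?\<phi> - c * strip_contour s t R ?\<psi>"
  proof -
    have "integral {t..R} (\<lambda>v. h (Complex (- s) v)) = integral {t..R} (\<lambda>v. ?\<phi> (Complex (- s) v)) - c * integral {t..R} (\<lambda>v. ?\<psi> (Complex (- s) v))"
      using \<sigma> st onG by (intro ver) (auto simp: Omega_minus_iff)
    moreover have "integral {t..R} (\<lambda>v. h (Complex s v)) = integral {t..R} (\<lambda>v. ?\<phi> (Complex s v)) - c * integral {t..R} (\<lambda>v. ?\<psi> (Complex s v))"
      using \<sigma> st onG by (intro ver) (auto simp: Omega_minus_iff)
    moreover have "integral {-s..s} (\<lambda>u. h (Complex u t)) = integral {-s..s} (\<lambda>u. ?\<phi> (Complex u t)) - c * integral {-s..s} (\<lambda>u. ?\<psi> (Complex u t))"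
      using \<sigma> st onG2 by (intro hor) (auto simp: Omega_minus_iff abs_le_iff)
    ultimately show ?thesis by (simp only: strip_contour_def) (simp add: algebra_simps)
  qed
  have O: "outer_contour s R h = outer_contour s R ?\<phi> - c * outer_contour s R ?\<psi>"
  proof -
    have "integral {-R..R} (\<lambda>u. h (Complex u (- R))) = integral {-R..R} (\<lambda>u. ?\<phi> (Complex u (- R))) - c * integral {-R..R} (\<lambda>u. ?\<psi> (Complex u (- R)))"
      using \<sigma> st R wR by (intro hor) (auto simp: Omega_minus_iff)
    moreover have "integral {-R..R} (\<lambda>v. h (Complex x v)) = integral {-R..R} (\<lambda>v. ?\<phi> (Complex x v)) - c * integral {-R..R} (\<lambda>v. ?\<psi> (Complex x v))"
      if "x = R \<or> x = - R" for x
      using that \<sigma> st R wR by (intro ver) (auto simp: Omega_minus_iff)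
    moreover have "integral {-R..-s} (\<lambda>u. h (Complex u R)) = integral {-R..-s} (\<lambda>u. ?\<phi> (Complex u R)) - c * integral {-R..-s} (\<lambda>u. ?\<psi> (Complex u R))"
      using \<sigma> st R wR by (intro hor) (auto simp: Omega_minus_iff)
    moreover have "integral {s..R} (\<lambda>u. h (Complex u R)) = integral {s..R} (\<lambda>u. ?\<phi> (Complex u R)) - c * integral {s..R} (\<lambda>u. ?\<psi> (Complex u R))"
      using \<sigma> st R wR by (intro hor) (auto simp: Omega_minus_iff)
    ultimately show ?thesis by (simp only: outer_contour_def simp_thms) (simp add: algebra_simps)
  qed
  have eq: "strip_contour s t R h = outer_contour s R h"
    by (rule strip_contour_eq_outer_contour[OF \<sigma> st R(1,2) h(1)])
  have "c * (outer_contour s R ?\<psi> - strip_contour s t R ?\<psi>) = c * (2 * of_real pi * \<i>)"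
  proof (cases "c = 0")
    case False
    then have "Re w < - s \<or> Im w < t \<or> Re w > s" using c by auto
    moreover have "R > t" using R st by simp
    ultimately show ?thesis
      using outer_contour_minus_strip_contour_reciprocal[OF s0 R(1) _ R(3)] by simp
  qed simp
  then show ?thesis using eq unfolding J O by (simp add: algebra_simps)
qed

lemma norm_integral_powr_bound:
  fixes g :: "real \<Rightarrow> complex"
  assumes p: "1 < p" and s: "0 < \<sigma>" "\<sigma> < s" "s \<le> R" and D: "D \<ge> 0" and g: "continuous_on {s..R} g"
    "\<And>x. x \<in> {s..R} \<Longrightarrow> norm (g x) \<le> D * (x - \<sigma>) powr (- 1 / p)"
  shows "norm (integral {s..R} g) \<le> D * (R powr (1 - 1 / p) / (1 - 1 / p))"
proof -
  define r where "r = 1 - 1 / p"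
  have r: "r > 0" "- 1 / p = r - 1" using p by (auto simp: r_def)
  have "((\<lambda>x. (x - \<sigma>) powr (- 1 / p)) has_integral ((R - \<sigma>) powr r / r - (s - \<sigma>) powr r / r)) {s..R}"
  proof (rule fundamental_theorem_of_calculus[OF s(3)])
    fix x assume x: "x \<in> {s..R}"
    have "((\<lambda>x. (x - \<sigma>) powr r) has_real_derivative r * (x - \<sigma>) powr (r - 1)) (at x)"
      using x s by (auto intro!: derivative_eq_intros)
    from DERIV_cdivide[OF this, of r]
    have "((\<lambda>x. (x - \<sigma>) powr r / r) has_real_derivative (x - \<sigma>) powr (r - 1)) (at x)"
      using r by simp
    then show "((\<lambda>x. (x - \<sigma>) powr r / r) has_vector_derivative (x - \<sigma>) powr (- 1 / p)) (at x within {s..R})"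
      unfolding r(2) by (simp add: has_real_derivative_iff_has_vector_derivative has_vector_derivative_at_within)
  qed
  from has_integral_mult_right[OF this, of D]
  have I: "((\<lambda>x. D * (x - \<sigma>) powr (- 1 / p)) has_integral D * ((R - \<sigma>) powr r / r - (s - \<sigma>) powr r / r)) {s..R}" .
  have "norm (integral {s..R} g) \<le> integral {s..R} (\<lambda>x. D * (x - \<sigma>) powr (- 1 / p))"
    by (intro integral_norm_bound_integral integrable_continuous_real[OF g(1)] has_integral_integrable[OF I] g(2))
  also have "\<dots> = D * ((R - \<sigma>) powr r / r - (s - \<sigma>) powr r / r)"
    using I by (rule integral_unique)
  also have "\<dots> \<le> D * (R powr r / r)"
  proof (rule mult_left_mono[OF _ D])
    have "(R - \<sigma>) powr r / r \<le> R powr r / r" using s r by (intro divide_right_mono powr_mono2) auto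
    moreover have "(s - \<sigma>) powr r / r \<ge> 0" using r by simp
    ultimately show "(R - \<sigma>) powr r / r - (s - \<sigma>) powr r / r \<le> R powr r / r" by linarith
  qed
  finally show ?thesis by (simp only: r_def)
qed

text \<open>
On the left, bottom and right sides \<open>F\<close> is of order \<open>R\<^bsup>-1/p\<^esup>\<close> and the kernel of order \<open>1/R\<close>. On the two pieces of
the top side \<open>F\<close> does not tend to 0 uniformly, but its bound \<open>C (|x| - \<sigma>)\<^bsup>-1/p\<^esup>\<close> integrates to order \<open>R\<^bsup>1-1/p\<^esup>\<close>, since \<open>p > 1\<close>.
\<close>
lemma outer_contour_tendsto_0:
  assumes \<sigma>: "\<sigma> > 0" and p: "1 < p" and F: "F \<in> Hp_space \<sigma> p" and s: "s > \<sigma>"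
  shows "((\<lambda>R. outer_contour s R (\<lambda>\<zeta>. F \<zeta> / (\<zeta> - w))) \<longlongrightarrow> 0) at_top"
proof -
  let ?\<phi> = "\<lambda>\<zeta>. F \<zeta> / (\<zeta> - w)"
  obtain C where C: "C > 0"
    "\<And>x y. y > 0 \<Longrightarrow> norm (F (Complex (- \<sigma> - y) x)) \<le> C * y powr (- 1 / p)"
    "\<And>x y. y > 0 \<Longrightarrow> norm (F (Complex x (- y))) \<le> C * y powr (- 1 / p)"
    "\<And>x y. y > 0 \<Longrightarrow> norm (F (Complex (\<sigma> + y) x)) \<le> C * y powr (- 1 / p)"
    using Hp_space_pointwise[OF \<sigma> p F] by blast
  have "F holomorphic_on Omega_minus \<sigma>"
    using F by (simp add: Hp_space_def analytic_imp_holomorphic)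
  then have cont: "continuous_on (Omega_minus \<sigma> - {w}) ?\<phi>"
    by (auto intro!: continuous_intros intro: continuous_on_subset[OF holomorphic_on_imp_continuous_on])
  define r where "r = 1 - 1 / p"
  have r: "r > 0" using p by (simp add: r_def)
  let ?b = "\<lambda>R. C * (R / 2) powr (- 1 / p)"
  have bound: "norm (outer_contour s R ?\<phi>) \<le> 12 * ?b R + 4 * C / r * R powr (- 1 / p)"
    if R: "R > 2 * norm w" "R > 2 * \<sigma>" "R > s" for R
  proof -
    have R0: "R > 0" using R s \<sigma> by linarith
    have wR: "\<bar>Re w\<bar> < R" "\<bar>Im w\<bar> < R"
      using abs_Re_le_cmod[of w] abs_Im_le_cmod[of w] R(1) by linarith+
    have far: "norm (?\<phi> \<zeta>) \<le> B * (2 / R)" if "norm (F \<zeta>) \<le> B" "R \<le> norm \<zeta>" for \<zeta> B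
    proof -
      have "R / 2 \<le> norm (\<zeta> - w)" using norm_triangle_ineq2[of \<zeta> w] that(2) R(1) by linarith
      moreover have "B \<ge> 0" using that(1) norm_ge_zero order_trans by blast
      ultimately have "norm (?\<phi> \<zeta>) \<le> B / (R / 2)"
        unfolding norm_divide using that(1) R0 by (intro frac_le) auto
      then show ?thesis by simp
    qed
    have decay: "y powr (- 1 / p) \<le> (R / 2) powr (- 1 / p)" if "y \<ge> R / 2" for y
      using that R0 p by (intro powr_mono2') auto
    have le: "x \<le> C * y powr (- 1 / p) \<Longrightarrow> y \<ge> R / 2 \<Longrightarrow> x \<le> ?b R" for x y
      using decay[of y] C(1) by (meson less_imp_le mult_left_mono order_trans)
    have big: "norm z \<ge> R" if "\<bar>Re z\<bar> = R \<or> \<bar>Im z\<bar> = R" for z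
      using that abs_Re_le_cmod[of z] abs_Im_le_cmod[of z] by auto
    have "norm (integral {-R..R} (\<lambda>u. ?\<phi> (Complex u (- R)))) \<le> ?b R * (2 / R) * (R - (- R))"
    proof (intro integral_bound)
      show "continuous_on {- R..R} (\<lambda>u. ?\<phi> (Complex u (- R)))"
        using R0 wR \<sigma> by (intro continuous_on_Complex_line(2)[OF cont]) (auto simp: Omega_minus_iff)
      fix u show "norm (?\<phi> (Complex u (- R))) \<le> ?b R * (2 / R)"
        using R0 by (intro far big le[OF C(3)]) auto
    qed (use R0 in auto)
    moreover have "norm (integral {-R..R} (\<lambda>v. ?\<phi> (Complex R v))) \<le> ?b R * (2 / R) * (R - (- R))"
    proof (intro integral_bound)
      show "continuous_on {- R..R} (\<lambda>v. ?\<phi> (Complex R v))"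
        using R0 wR \<sigma> R by (intro continuous_on_Complex_line(1)[OF cont]) (auto simp: Omega_minus_iff)
      fix v show "norm (?\<phi> (Complex R v)) \<le> ?b R * (2 / R)"
        using R0 R C(4)[of "R - \<sigma>" v] by (intro far big le[of _ "R - \<sigma>"]) auto
    qed (use R0 in auto)
    moreover have "norm (integral {-R..R} (\<lambda>v. ?\<phi> (Complex (- R) v))) \<le> ?b R * (2 / R) * (R - (- R))"
    proof (intro integral_bound)
      show "continuous_on {- R..R} (\<lambda>v. ?\<phi> (Complex (- R) v))"
        using R0 wR \<sigma> R by (intro continuous_on_Complex_line(1)[OF cont]) (auto simp: Omega_minus_iff)
      fix v show "norm (?\<phi> (Complex (- R) v)) \<le> ?b R * (2 / R)"
        using R0 R C(2)[of "R - \<sigma>" v] by (intro far big le[of _ "R - \<sigma>"]) auto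
    qed (use R0 in auto)
    moreover have "norm (integral {s..R} (\<lambda>u. ?\<phi> (Complex u R))) \<le> C * (2 / R) * (R powr r / r)"
      unfolding r_def
    proof (rule norm_integral_powr_bound[OF p \<sigma> s])
      show "continuous_on {s..R} (\<lambda>u. ?\<phi> (Complex u R))"
        using R0 wR \<sigma> s R by (intro continuous_on_Complex_line(2)[OF cont]) (auto simp: Omega_minus_iff)
      fix u assume "u \<in> {s..R}"
      then have "norm (F (Complex u R)) \<le> C * (u - \<sigma>) powr (- 1 / p)"
        using C(4)[of "u - \<sigma>" R] s by simp
      then have "norm (?\<phi> (Complex u R)) \<le> C * (u - \<sigma>) powr (- 1 / p) * (2 / R)"
        using R0 by (intro far big) auto
      then show "norm (?\<phi> (Complex u R)) \<le> C * (2 / R) * (u - \<sigma>) powr (- 1 / p)" by (simp only: mult_ac)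
    qed (use R0 R C in auto)
    moreover have "norm (integral {-R..-s} (\<lambda>u. ?\<phi> (Complex u R))) \<le> C * (2 / R) * (R powr r / r)"
    proof -
      have "norm (integral {s..R} (\<lambda>u. ?\<phi> (Complex (- u) R))) \<le> C * (2 / R) * (R powr r / r)"
        unfolding r_def
      proof (rule norm_integral_powr_bound[OF p \<sigma> s])
        have "continuous_on {-R..-s} (\<lambda>u. ?\<phi> (Complex u R))"
          using R0 wR \<sigma> s R by (intro continuous_on_Complex_line(2)[OF cont]) (auto simp: Omega_minus_iff)
        then show "continuous_on {s..R} (\<lambda>u. ?\<phi> (Complex (- u) R))"
          by (rule continuous_on_compose2) (auto intro!: continuous_intros)
        fix u assume "u \<in> {s..R}"
        then have "norm (F (Complex (- u) R)) \<le> C * (u - \<sigma>) powr (- 1 / p)"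
          using C(2)[of "u - \<sigma>" R] s by simp
        then have "norm (?\<phi> (Complex (- u) R)) \<le> C * (u - \<sigma>) powr (- 1 / p) * (2 / R)"
          using R0 by (intro far big) auto
        then show "norm (?\<phi> (Complex (- u) R)) \<le> C * (2 / R) * (u - \<sigma>) powr (- 1 / p)" by (simp only: mult_ac)
      qed (use R0 R C in auto)
      also have "integral {s..R} (\<lambda>u. ?\<phi> (Complex (- u) R)) = integral {-R..-s} (\<lambda>u. ?\<phi> (Complex u R))"
        using Henstock_Kurzweil_Integration.integral_reflect_real[of "- s" "- R" "\<lambda>u. ?\<phi> (Complex u R)"] by simp
      finally show ?thesis .
    qed
    moreover have "norm (a + \<i> * b - \<i> * c - d - e) \<le> A + A + A + B + B"
      if "norm a \<le> A" "norm b \<le> A" "norm c \<le> A" "norm d \<le> B" "norm e \<le> B" for a b c d e :: complex and A B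
      using that norm_triangle_ineq4[of "a + \<i> * b - \<i> * c - d" e] norm_triangle_ineq4[of "a + \<i> * b - \<i> * c" d]
        norm_triangle_ineq4[of "a + \<i> * b" "\<i> * c"] norm_triangle_ineq[of a "\<i> * b"]
      by (simp add: norm_mult)
    ultimately have "norm (outer_contour s R ?\<phi>) \<le> ?b R * (2 / R) * (R - (- R)) + ?b R * (2 / R) * (R - (- R)) + ?b R * (2 / R) * (R - (- R))
        + C * (2 / R) * (R powr r / r) + C * (2 / R) * (R powr r / r)"
      unfolding outer_contour_def by blast
    also have "\<dots> = 12 * ?b R + 4 * C / r * (R powr r / R)"
      using R0 r by (simp add: field_simps)
    also have "R powr r / R = R powr (- 1 / p)"
      using R0 by (simp add: r_def powr_diff powr_minus field_simps)
    finally show ?thesis .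
  qed
  have lim: "((\<lambda>R. 12 * ?b R + 4 * C / r * R powr (- 1 / p)) \<longlongrightarrow> 12 * (C * 0) + 4 * C / r * 0) at_top"
  proof -
    have half: "filterlim (\<lambda>R::real. R / 2) at_top at_top"
      using filterlim_tendsto_pos_mult_at_top[OF tendsto_const[of "1/2::real"] _ filterlim_ident] by simp
    have neg: "- 1 / p < 0" using p by simp
    show ?thesis
      by (intro tendsto_intros tendsto_neg_powr[OF neg] half filterlim_ident)
  qed
  show ?thesis
  proof (rule Lim_null_comparison)
    show "\<forall>\<^sub>F R in at_top. norm (outer_contour s R ?\<phi>) \<le> 12 * ?b R + 4 * C / r * R powr (- 1 / p)"
      using eventually_gt_at_top[of "2 * norm w"] eventually_gt_at_top[of "2 * \<sigma>"] eventually_gt_at_top[of s]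
      by eventually_elim (rule bound)
    show "((\<lambda>R. 12 * ?b R + 4 * C / r * R powr (- 1 / p)) \<longlongrightarrow> 0) at_top" using lim by simp
  qed
qed

section \<open>The Cauchy integral over the half-strip boundaries\<close>

lemma tendsto_integral_atLeastAtMost_at_top:
  fixes h :: "real \<Rightarrow> complex"
  assumes h: "set_integrable lborel {t<..} h"
  shows "((\<lambda>R. integral {t..R} h) \<longlongrightarrow> (LBINT v:{t<..}. h v)) at_top"
proof -
  have eq: "integral {t..R} h = (\<integral>v. indicator {t<..R} v *\<^sub>R h v \<partial>lborel)" for R
  proof -
    have "set_integrable lborel {t<..R} h"
      by (rule set_integrable_subset[OF h]) auto
    from set_borel_integral_eq_integral(2)[OF this]
    have "(\<integral>v. indicator {t<..R} v *\<^sub>R h v \<partial>lborel) = integral {t<..R} h"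
      by (simp add: set_lebesgue_integral_def)
    also have "\<dots> = integral {t..R} h"
      by (rule integral_spike_set) (auto intro: negligible_subset[of "{t}"])
    finally show ?thesis by simp
  qed
  have int: "integrable lborel (\<lambda>v. indicator {t<..} v *\<^sub>R h v)" using h by (simp add: set_integrable_def)
  have "((\<lambda>R. \<integral>v. indicator {..R} v *\<^sub>R (indicator {t<..} v *\<^sub>R h v) \<partial>lborel) \<longlongrightarrow> (\<integral>v. indicator {t<..} v *\<^sub>R h v \<partial>lborel)) at_top"
    by (rule tendsto_integral_at_top[OF _ int]) simp
  moreover have "indicator {..R} v *\<^sub>R (indicator {t<..} v *\<^sub>R h v) = indicator {t<..R} v *\<^sub>R h v" for R v
    by (auto simp: indicator_def)
  ultimately show ?thesis unfolding eq set_lebesgue_integral_def by (simp only:)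
qed

text \<open>
Cauchy kernels on the sides, extended by 0: with them, integrals over all the contours become
integrals over the whole line, and the domain of integration moves into the kernel.
\<close>
definition side_kernel :: "real \<Rightarrow> real \<Rightarrow> complex \<Rightarrow> real \<Rightarrow> complex" where
  "side_kernel c t w v = indicator {t<..} v *\<^sub>R (1 / (Complex c v - w))"

definition bottom_kernel :: "real \<Rightarrow> real \<Rightarrow> complex \<Rightarrow> real \<Rightarrow> complex" where
  "bottom_kernel s t w u = indicator {-s..s} u *\<^sub>R (1 / (Complex u t - w))"

lemma borel_measurable_kernels [measurable]:
  "side_kernel c t w \<in> borel_measurable borel" "bottom_kernel s t w \<in> borel_measurable borel"
  unfolding side_kernel_def bottom_kernel_def by measurable

lemma set_integral_kernel:
  "indicator {t<..} v *\<^sub>R (a / (Complex c v - w)) = a * side_kernel c t w v"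
  "indicator {-s..s} u *\<^sub>R (a / (Complex u t - w)) = a * bottom_kernel s t w u"
  by (auto simp: side_kernel_def bottom_kernel_def indicator_def)

lemma norm_kernels_le:
  assumes s: "s > 0" and \<delta>: "\<delta> > 0" and far: "\<And>\<zeta>. \<zeta> \<in> Gamma_bd s t \<Longrightarrow> \<delta> \<le> norm (\<zeta> - w)"
  defines "C \<equiv> 1 + (1 + norm w) / \<delta>"
  shows "norm (side_kernel s t w v) \<le> C / (1 + \<bar>v\<bar>)" "norm (side_kernel (- s) t w v) \<le> C / (1 + \<bar>v\<bar>)"
    "norm (bottom_kernel s t w v) \<le> C / (1 + \<bar>v\<bar>)"
proof -
  have C0: "C \<ge> 0" using \<delta> by (simp add: C_def)
  have *: "norm (1 / (\<zeta> - w)) \<le> C / (1 + \<bar>v\<bar>)" if \<zeta>: "\<zeta> \<in> Gamma_bd s t" "\<bar>v\<bar> \<le> norm \<zeta>" for \<zeta>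
  proof -
    have f: "\<delta> \<le> norm (\<zeta> - w)" by (rule far[OF \<zeta>(1)])
    have "1 + \<bar>v\<bar> \<le> norm (\<zeta> - w) + (1 + norm w)" using \<zeta>(2) norm_triangle_ineq2[of \<zeta> w] by linarith
    also have "1 + norm w \<le> (1 + norm w) / \<delta> * norm (\<zeta> - w)"
    proof -
      have "(1 + norm w) / \<delta> * \<delta> \<le> (1 + norm w) / \<delta> * norm (\<zeta> - w)"
        using \<delta> f by (intro mult_left_mono) auto
      then show ?thesis using \<delta> by simp
    qed
    finally have "1 + \<bar>v\<bar> \<le> C * norm (\<zeta> - w)" by (simp add: C_def distrib_right)
    moreover have "norm (\<zeta> - w) > 0" using f \<delta> by linarith
    ultimately have "(1 + \<bar>v\<bar>) / norm (\<zeta> - w) \<le> C" by (simp add: pos_divide_le_eq)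
    then have "(1 + \<bar>v\<bar>) / norm (\<zeta> - w) / (1 + \<bar>v\<bar>) \<le> C / (1 + \<bar>v\<bar>)" by (rule divide_right_mono) simp
    then have "1 / norm (\<zeta> - w) \<le> C / (1 + \<bar>v\<bar>)" by simp
    then show ?thesis by (simp add: norm_divide)
  qed
  have le: "\<bar>v\<bar> \<le> norm (Complex c v)" "\<bar>v\<bar> \<le> norm (Complex v c)" for c
    using abs_Im_le_cmod[of "Complex c v"] abs_Re_le_cmod[of "Complex v c"] by auto
  have C1: "0 \<le> C / (1 + \<bar>v\<bar>)" using C0 by simp
  show "norm (side_kernel s t w v) \<le> C / (1 + \<bar>v\<bar>)"
    using *[of "Complex s v"] le C1 Complex_in_Gamma_bd[OF s] by (cases "v > t") (auto simp: side_kernel_def)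
  show "norm (side_kernel (- s) t w v) \<le> C / (1 + \<bar>v\<bar>)"
    using *[of "Complex (- s) v"] le C1 Complex_in_Gamma_bd[OF s] by (cases "v > t") (auto simp: side_kernel_def)
  show "norm (bottom_kernel s t w v) \<le> C / (1 + \<bar>v\<bar>)"
    using *[of "Complex v t"] le C1 Complex_in_Gamma_bd[OF s] by (cases "\<bar>v\<bar> \<le> s") (auto simp: bottom_kernel_def abs_le_iff)
qed

text \<open>
The constant serves as margin and as range for \<open>\<tau>\<close> at once: half the distance from \<open>w\<close> to the edge of a half-plane
that contains it if \<open>w\<close> is outside, and the distance to the boundary if \<open>w\<close> is inside, since the contours
move away from it.
\<close>
lemma Gamma_bd_uniformly_far:
  assumes \<sigma>: "\<sigma> > 0" and w: "w \<in> Omega_plus \<sigma> \<union> Omega_minus \<sigma>"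
  obtains \<delta> where "\<delta> > 0" "\<And>\<tau> \<zeta>. \<lbrakk>0 \<le> \<tau>; \<tau> \<le> \<delta>; \<zeta> \<in> Gamma_bd (\<sigma> + \<tau>) (- \<tau>)\<rbrakk> \<Longrightarrow> \<delta> \<le> norm (\<zeta> - w)"
    "\<And>\<tau>. \<lbrakk>0 \<le> \<tau>; \<tau> \<le> \<delta>; w \<in> Omega_minus \<sigma>\<rbrakk> \<Longrightarrow> Re w < - (\<sigma> + \<tau>) \<or> Im w < - \<tau> \<or> Re w > \<sigma> + \<tau>"
proof -
  have coord: "\<delta> \<le> norm (\<zeta> - w)" if "\<delta> \<le> \<bar>Re \<zeta> - Re w\<bar> \<or> \<delta> \<le> \<bar>Im \<zeta> - Im w\<bar>" for \<delta> \<zeta>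
    using that abs_Re_le_cmod[of "\<zeta> - w"] abs_Im_le_cmod[of "\<zeta> - w"] by auto
  have G: "(Re \<zeta> = - (\<sigma> + \<tau>) \<and> Im \<zeta> > - \<tau>) \<or> (Im \<zeta> = - \<tau> \<and> \<bar>Re \<zeta>\<bar> \<le> \<sigma> + \<tau>) \<or> (Re \<zeta> = \<sigma> + \<tau> \<and> Im \<zeta> > - \<tau>)"
    if "\<zeta> \<in> Gamma_bd (\<sigma> + \<tau>) (- \<tau>)" for \<tau> \<zeta>
    using that by (auto simp: Gamma_bd_def Gamma1_def Gamma2_def Gamma3_def)
  consider "w \<in> Omega_plus \<sigma>" | "Re w < - \<sigma>" | "Im w < 0" | "Re w > \<sigma>" using w Omega_minus_iff[OF \<sigma>] by auto
  then show ?thesis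
  proof cases
    case 1
    then have w': "\<bar>Re w\<bar> < \<sigma>" "Im w > 0" by (auto simp: Omega_plus_iff)
    show ?thesis
    proof (rule that[of "min (\<sigma> - \<bar>Re w\<bar>) (Im w)"])
      fix \<tau> \<zeta> assume "0 \<le> \<tau>" "\<zeta> \<in> Gamma_bd (\<sigma> + \<tau>) (- \<tau>)"
      with G[OF this(2)] w' show "min (\<sigma> - \<bar>Re w\<bar>) (Im w) \<le> norm (\<zeta> - w)"
        by (intro coord) (auto simp: min_def abs_if split: if_splits)
    qed (use w' Omega_minus_iff[OF \<sigma>] in auto)
  next
    case 2
    show ?thesis
    proof (rule that[of "(- \<sigma> - Re w) / 2"])
      fix \<tau> \<zeta> assume \<tau>: "0 \<le> \<tau>" "\<tau> \<le> (- \<sigma> - Re w) / 2" "\<zeta> \<in> Gamma_bd (\<sigma> + \<tau>) (- \<tau>)"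
      have "Re \<zeta> \<ge> - (\<sigma> + \<tau>)" using G[OF \<tau>(3)] \<tau>(1) \<sigma> by auto
      then show "(- \<sigma> - Re w) / 2 \<le> norm (\<zeta> - w)"
        using \<tau> by (intro coord disjI1 order_trans[OF _ abs_ge_self]) (simp add: field_simps)
    qed (use 2 in \<open>auto simp: field_simps\<close>)
  next
    case 3
    show ?thesis
    proof (rule that[of "- Im w / 2"])
      fix \<tau> \<zeta> assume \<tau>: "0 \<le> \<tau>" "\<tau> \<le> - Im w / 2" "\<zeta> \<in> Gamma_bd (\<sigma> + \<tau>) (- \<tau>)"
      have "Im \<zeta> \<ge> - \<tau>" using G[OF \<tau>(3)] \<tau>(1) \<sigma> by auto
      then show "- Im w / 2 \<le> norm (\<zeta> - w)"
        using \<tau> by (intro coord disjI2 order_trans[OF _ abs_ge_self]) (simp add: field_simps)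
    qed (use 3 in \<open>auto simp: field_simps\<close>)
  next
    case 4
    show ?thesis
    proof (rule that[of "(Re w - \<sigma>) / 2"])
      fix \<tau> \<zeta> assume \<tau>: "0 \<le> \<tau>" "\<tau> \<le> (Re w - \<sigma>) / 2" "\<zeta> \<in> Gamma_bd (\<sigma> + \<tau>) (- \<tau>)"
      have "Re \<zeta> \<le> \<sigma> + \<tau>" using G[OF \<tau>(3)] \<tau>(1) \<sigma> by auto
      then show "(Re w - \<sigma>) / 2 \<le> norm (\<zeta> - w)"
        using \<tau> by (intro coord disjI1 order_trans[OF _ abs_ge_minus_self]) (simp add: field_simps)
    qed (use 4 in \<open>auto simp: field_simps\<close>)
  qed
qed

lemma continuous_on_outer_lines:
  assumes \<sigma>: "\<sigma> > 0" and F: "F holomorphic_on Omega_minus \<sigma>" and \<tau>: "\<tau> > 0"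
  shows "continuous_on A (\<lambda>v. F (Complex (- (\<sigma> + \<tau>)) v))" "continuous_on A (\<lambda>v. F (Complex (\<sigma> + \<tau>) v))"
    "continuous_on A (\<lambda>u. F (Complex u (- \<tau>)))"
  using \<tau> \<sigma> by (auto intro!: continuous_on_Complex_line[OF holomorphic_on_imp_continuous_on[OF F]] simp: Omega_minus_iff)

lemma Lp_pow_outer_lines_finite:
  assumes \<sigma>: "\<sigma> > 0" and p: "1 < p" and F: "F \<in> Hp_space \<sigma> p" and \<tau>: "\<tau> > 0"
  shows "Lp_pow p (\<lambda>v. F (Complex (- (\<sigma> + \<tau>)) v)) < \<infinity>" "Lp_pow p (\<lambda>v. F (Complex (\<sigma> + \<tau>) v)) < \<infinity>"
    "Lp_pow p (\<lambda>u. F (Complex u (- \<tau>))) < \<infinity>"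
proof -
  have holo: "F holomorphic_on Omega_minus \<sigma>"
    using F by (simp add: Hp_space_def analytic_imp_holomorphic)
  have fin: "a < \<infinity>" if "a \<le> ennreal b" for a b using that by (simp add: le_less_trans)
  note c = continuous_on_outer_lines[OF \<sigma> holo \<tau>, THEN borel_measurable_continuous_onI]
  note H = half_plane_Hp_halves[OF \<sigma> p F, unfolded half_plane_Hp_def half_Complex]
  have e: "- \<sigma> - \<tau> = - (\<sigma> + \<tau>)" by simp
  show "Lp_pow p (\<lambda>v. F (Complex (- (\<sigma> + \<tau>)) v)) < \<infinity>"
    using H(1)[THEN conjunct2, rule_format, OF \<tau>] unfolding e by (rule fin)
  show "Lp_pow p (\<lambda>v. F (Complex (\<sigma> + \<tau>) v)) < \<infinity>"
    using H(3)[THEN conjunct2, rule_format, OF \<tau>] unfolding Lp_pow_reflect[OF c(2)] by (rule fin)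
  show "Lp_pow p (\<lambda>u. F (Complex u (- \<tau>))) < \<infinity>"
    using H(2)[THEN conjunct2, rule_format, OF \<tau>] unfolding Lp_pow_reflect[OF c(3)] by (rule fin)
qed

text \<open>
Let \<open>R \<rightarrow> \<infinity>\<close> in the truncated formula.
\<close>
lemma Cauchy_integral_outer_lines:
  assumes \<sigma>: "\<sigma> > 0" and p: "1 < p" and F: "F \<in> Hp_space \<sigma> p" and \<tau>: "\<tau> > 0"
    and \<delta>: "\<delta> > 0" and far: "\<And>\<zeta>. \<zeta> \<in> Gamma_bd (\<sigma> + \<tau>) (- \<tau>) \<Longrightarrow> \<delta> \<le> norm (\<zeta> - w)"
    and c: "w \<in> Omega_plus \<sigma> \<and> c = 0 \<or> (Re w < - (\<sigma> + \<tau>) \<or> Im w < - \<tau> \<or> Re w > \<sigma> + \<tau>) \<and> c = F w"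
  shows "- \<i> * (\<integral>v. F (Complex (- (\<sigma> + \<tau>)) v) * side_kernel (- (\<sigma> + \<tau>)) (- \<tau>) w v \<partial>lborel)
     + (\<integral>u. F (Complex u (- \<tau>)) * bottom_kernel (\<sigma> + \<tau>) (- \<tau>) w u \<partial>lborel)
     + \<i> * (\<integral>v. F (Complex (\<sigma> + \<tau>) v) * side_kernel (\<sigma> + \<tau>) (- \<tau>) w v \<partial>lborel) = - (2 * of_real pi * \<i> * c)"
proof -
  let ?s = "\<sigma> + \<tau>" and ?t = "- \<tau>" and ?\<phi> = "\<lambda>\<zeta>. F \<zeta> / (\<zeta> - w)"
  have s: "?s > 0" "?s > \<sigma>" "?t < 0" using \<sigma> \<tau> by auto
  have holo: "F holomorphic_on Omega_minus \<sigma>"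
    using F by (simp add: Hp_space_def analytic_imp_holomorphic)
  note meas = continuous_on_outer_lines[OF \<sigma> holo \<tau>, THEN borel_measurable_continuous_onI]
  note kb = norm_kernels_le[where s = ?s and t = ?t, OF s(1) \<delta> far]
  have C0: "1 + (1 + norm w) / \<delta> \<ge> 0" using \<delta> by simp
  have int: "set_integrable lborel {?t<..} (\<lambda>v. ?\<phi> (Complex (- ?s) v))" "set_integrable lborel {?t<..} (\<lambda>v. ?\<phi> (Complex ?s v))"
    "set_integrable lborel {-?s..?s} (\<lambda>u. ?\<phi> (Complex u ?t))"
    unfolding set_integrable_def set_integral_kernel
    by (intro integrable_Lp_times_decay[OF p C0] meas kb Lp_pow_outer_lines_finite[OF \<sigma> p F \<tau>]
        borel_measurable_kernels; assumption)+
  have wG: "w \<notin> Gamma_bd ?s ?t" using far[of w] \<delta> by auto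
  have "((\<lambda>R. strip_contour ?s ?t R ?\<phi>) \<longlongrightarrow>
     - \<i> * (LBINT v:{?t<..}. ?\<phi> (Complex (- ?s) v)) + integral {-?s..?s} (\<lambda>u. ?\<phi> (Complex u ?t)) + \<i> * (LBINT v:{?t<..}. ?\<phi> (Complex ?s v))) at_top"
    unfolding strip_contour_def by (intro tendsto_intros tendsto_integral_atLeastAtMost_at_top int)
  moreover have "((\<lambda>R. strip_contour ?s ?t R ?\<phi>) \<longlongrightarrow> 0 - 2 * of_real pi * \<i> * c) at_top"
  proof (rule Lim_transform_eventually)
    show "((\<lambda>R. outer_contour ?s R ?\<phi> - 2 * of_real pi * \<i> * c) \<longlongrightarrow> 0 - 2 * of_real pi * \<i> * c) at_top"
      by (intro tendsto_intros outer_contour_tendsto_0[OF \<sigma> p F s(2)])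
    show "\<forall>\<^sub>F R in at_top. outer_contour ?s R ?\<phi> - 2 * of_real pi * \<i> * c = strip_contour ?s ?t R ?\<phi>"
      using eventually_gt_at_top[of ?s] eventually_gt_at_top[of "- ?t"] eventually_gt_at_top[of "norm w"]
      by eventually_elim (rule strip_contour_Cauchy[OF \<sigma> s(2,3) _ _ _ holo wG c, symmetric])
  qed
  ultimately have "- \<i> * (LBINT v:{?t<..}. ?\<phi> (Complex (- ?s) v)) + integral {-?s..?s} (\<lambda>u. ?\<phi> (Complex u ?t)) + \<i> * (LBINT v:{?t<..}. ?\<phi> (Complex ?s v))
     = 0 - 2 * of_real pi * \<i> * c"
    using tendsto_unique trivial_limit_at_top_linorder by blast
  then show ?thesis
    unfolding set_borel_integral_eq_integral(2)[OF int(3), symmetric] set_lebesgue_integral_def set_integral_kernel by simp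
qed

section \<open>The boundary function\<close>

text \<open>
Boundary values are indexed by the coordinate on the line itself; the reflections undo
those in \<^const>\<open>lower_half\<close> and \<^const>\<open>right_half\<close>.
\<close>
definition left_bv :: "real \<Rightarrow> (complex \<Rightarrow> complex) \<Rightarrow> real \<Rightarrow> complex" where
  "left_bv \<sigma> F = boundary_value (left_half \<sigma> F)"

definition bottom_bv :: "(complex \<Rightarrow> complex) \<Rightarrow> real \<Rightarrow> complex" where
  "bottom_bv F u = boundary_value (lower_half F) (- u)"

definition right_bv :: "real \<Rightarrow> (complex \<Rightarrow> complex) \<Rightarrow> real \<Rightarrow> complex" where
  "right_bv \<sigma> F v = boundary_value (right_half \<sigma> F) (- v)"

definition strip_bv :: "real \<Rightarrow> (complex \<Rightarrow> complex) \<Rightarrow> complex \<Rightarrow> complex" where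
  "strip_bv \<sigma> F \<zeta> = (if \<zeta> \<in> Gamma1 \<sigma> 0 then left_bv \<sigma> F (Im \<zeta>)
     else if \<zeta> \<in> Gamma3 \<sigma> 0 then right_bv \<sigma> F (Im \<zeta>) else bottom_bv F (Re \<zeta>))"

lemma AE_lborel_uminus:
  assumes "AE x in lborel. P (x::real)"
  shows "AE x in lborel. P (- x)"
proof -
  have "AE x in distr lborel borel uminus. P x"
    using assms by (simp only: lborel_distr_uminus)
  then show ?thesis by (rule AE_distrD[rotated]) simp
qed

lemma AE_lines_measure:
  assumes "AE v in lborel. P (Complex (- s) v)" "AE u in lborel. P (Complex u t)" "AE v in lborel. P (Complex s v)"
  shows "AE \<zeta> in lines_measure s t. P \<zeta>"
proof -
  obtain N1 where N1: "{v. \<not> P (Complex (- s) v)} \<subseteq> N1" "N1 \<in> null_sets lborel"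
    using assms(1) by (auto elim!: AE_E simp: null_sets_def)
  obtain N2 where N2: "{u. \<not> P (Complex u t)} \<subseteq> N2" "N2 \<in> null_sets lborel"
    using assms(2) by (auto elim!: AE_E simp: null_sets_def)
  obtain N3 where N3: "{v. \<not> P (Complex s v)} \<subseteq> N3" "N3 \<in> null_sets lborel"
    using assms(3) by (auto elim!: AE_E simp: null_sets_def)
  have [measurable]: "N1 \<in> sets borel" "N2 \<in> sets borel" "N3 \<in> sets borel"
    using N1 N2 N3 by (auto simp: null_sets_def)
  \<comment> \<open>On each line \<open>B\<close> stays inside the null set of that line; off the lines its size does not matter.\<close>
  define B where "B = {w. (Re w = - s \<longrightarrow> Im w \<in> N1) \<and> (Im w = t \<longrightarrow> Re w \<in> N2) \<and> (Re w = s \<longrightarrow> Im w \<in> N3)}"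
  have "{w \<in> space borel. (Re w = - s \<longrightarrow> Im w \<in> N1) \<and> (Im w = t \<longrightarrow> Re w \<in> N2) \<and> (Re w = s \<longrightarrow> Im w \<in> N3)} \<in> sets borel"
    by measurable
  then have B: "B \<in> sets borel" by (simp add: B_def)
  have "emeasure lborel {v. Complex (- s) v \<in> B} = 0"
    by (rule emeasure_eq_0[of N1]) (use N1 in \<open>auto simp: B_def null_sets_def\<close>)
  moreover have "emeasure lborel {u. Complex u t \<in> B} = 0"
    by (rule emeasure_eq_0[of N2]) (use N2 in \<open>auto simp: B_def null_sets_def\<close>)
  moreover have "emeasure lborel {v. Complex s v \<in> B} = 0"
    by (rule emeasure_eq_0[of N3]) (use N3 in \<open>auto simp: B_def null_sets_def\<close>)
  ultimately have "B \<in> null_sets (lines_measure s t)"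
    using B by (simp add: null_sets_def emeasure_lines_measure)
  moreover have "{\<zeta> \<in> space (lines_measure s t). \<not> P \<zeta>} \<subseteq> B"
  proof
    fix w assume "w \<in> {\<zeta> \<in> space (lines_measure s t). \<not> P \<zeta>}"
    then have np: "\<not> P (Complex (Re w) (Im w))" by simp
    have "Im w \<in> N1" if "Re w = - s" using np N1(1) unfolding that by blast
    moreover have "Re w \<in> N2" if "Im w = t" using np N2(1) unfolding that by blast
    moreover have "Im w \<in> N3" if "Re w = s" using np N3(1) unfolding that by blast
    ultimately show "w \<in> B" by (simp add: B_def)
  qed
  ultimately show ?thesis by (rule AE_I')
qed

lemma tendsto_pullback:
  fixes \<phi> f F :: "complex \<Rightarrow> complex"
  assumes f: "(f \<longlongrightarrow> L) (at z0 within S)" and \<phi>: "isCont \<phi> \<zeta>" "\<phi> \<zeta> = z0"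
    and T: "\<And>w. w \<in> T \<Longrightarrow> \<phi> w \<in> S - {z0}" "\<And>w. w \<in> T \<Longrightarrow> F w = f (\<phi> w)"
  shows "(F \<longlongrightarrow> L) (at \<zeta> within T)"
proof -
  have "filterlim \<phi> (at z0 within S) (at \<zeta> within T)"
    unfolding filterlim_at
  proof
    show "\<forall>\<^sub>F w in at \<zeta> within T. \<phi> w \<in> S \<and> \<phi> w \<noteq> z0"
      using T(1) by (auto simp: eventually_at_filter)
    show "(\<phi> \<longlongrightarrow> z0) (at \<zeta> within T)"
      using \<phi> by (auto simp: isCont_def intro: tendsto_within_subset[of _ _ _ UNIV])
  qed
  from filterlim_compose[OF f this] have "((\<lambda>w. f (\<phi> w)) \<longlongrightarrow> L) (at \<zeta> within T)" .
  then show ?thesis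
    by (rule Lim_transform_eventually) (use T(2) in \<open>auto simp: eventually_at_filter\<close>)
qed

lemma has_nt_limit_left:
  assumes \<sigma>: "\<sigma> > 0" and v: "v > 0" and L: "\<And>\<alpha>. \<alpha> > 0 \<Longrightarrow> (left_half \<sigma> F \<longlongrightarrow> L) (at (Complex v 0) within nt_cone \<alpha> v)"
  shows "has_nt_limit \<sigma> F (Complex (- \<sigma>) v) L"
  unfolding has_nt_limit_def
proof (intro conjI allI impI)
  show "Complex (- \<sigma>) v \<in> Gamma_bd \<sigma> 0 - {complex_of_real \<sigma>, - complex_of_real \<sigma>}"
    using \<sigma> v by (auto simp: Complex_in_Gamma_bd complex_eq_iff)
  fix \<alpha> :: real assume \<alpha>: "\<alpha> > 0"
  have G: "Complex (- \<sigma>) v \<in> Gamma1 \<sigma> 0" using v by (simp add: Gamma1_def)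
  show "(F \<longlongrightarrow> L) (at (Complex (- \<sigma>) v) within nt_region \<sigma> \<alpha> (Complex (- \<sigma>) v) \<inter> Omega_minus \<sigma>)"
  proof (rule tendsto_pullback[OF L[OF \<alpha>], where \<phi> = "\<lambda>w. - \<i> * (w + of_real \<sigma>)"])
    show "isCont (\<lambda>w. - \<i> * (w + of_real \<sigma>)) (Complex (- \<sigma>) v)" by (intro continuous_intros)
    show "- \<i> * (Complex (- \<sigma>) v + of_real \<sigma>) = Complex v 0" by (simp add: complex_eq_iff)
    fix w
    show "F w = left_half \<sigma> F (- \<i> * (w + of_real \<sigma>))"
      unfolding left_half_def by (rule arg_cong[where f = F]) (simp add: algebra_simps)
    assume "w \<in> nt_region \<sigma> \<alpha> (Complex (- \<sigma>) v) \<inter> Omega_minus \<sigma>"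
    then obtain x y where "w = Complex (- \<sigma>) v - Complex x y" "x > 0" "\<bar>y\<bar> < \<alpha> * x"
      using G by (auto simp: nt_region_def)
    then show "- \<i> * (w + of_real \<sigma>) \<in> nt_cone \<alpha> v - {Complex v 0}"
      by (auto simp: nt_cone_def complex_eq_iff)
  qed
qed

lemma has_nt_limit_bottom:
  assumes \<sigma>: "\<sigma> > 0" and u: "\<bar>u\<bar> < \<sigma>" and L: "\<And>\<alpha>. \<alpha> > 0 \<Longrightarrow> (lower_half F \<longlongrightarrow> L) (at (Complex (- u) 0) within nt_cone \<alpha> (- u))"
  shows "has_nt_limit \<sigma> F (Complex u 0) L"
  unfolding has_nt_limit_def
proof (intro conjI allI impI)
  show "Complex u 0 \<in> Gamma_bd \<sigma> 0 - {complex_of_real \<sigma>, - complex_of_real \<sigma>}"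
    using \<sigma> u by (auto simp: Complex_in_Gamma_bd complex_eq_iff)
  fix \<alpha> :: real assume \<alpha>: "\<alpha> > 0"
  have G: "Complex u 0 \<notin> Gamma1 \<sigma> 0" "Complex u 0 \<notin> Gamma3 \<sigma> 0" using u by (auto simp: Gamma1_def Gamma3_def)
  show "(F \<longlongrightarrow> L) (at (Complex u 0) within nt_region \<sigma> \<alpha> (Complex u 0) \<inter> Omega_minus \<sigma>)"
  proof (rule tendsto_pullback[OF L[OF \<alpha>], where \<phi> = uminus])
    show "isCont uminus (Complex u 0)" by (intro continuous_intros)
    show "- Complex u 0 = Complex (- u) 0" by (simp add: complex_eq_iff)
    fix w
    show "F w = lower_half F (- w)" by (simp add: lower_half_def)
    assume "w \<in> nt_region \<sigma> \<alpha> (Complex u 0) \<inter> Omega_minus \<sigma>"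
    then obtain x y where "w = Complex u 0 - Complex x y" "y > 0" "\<bar>x\<bar> < \<alpha> * y"
      using G by (auto simp: nt_region_def)
    then show "- w \<in> nt_cone \<alpha> (- u) - {Complex (- u) 0}"
      by (auto simp: nt_cone_def complex_eq_iff)
  qed
qed

lemma has_nt_limit_right:
  assumes \<sigma>: "\<sigma> > 0" and v: "v > 0" and L: "\<And>\<alpha>. \<alpha> > 0 \<Longrightarrow> (right_half \<sigma> F \<longlongrightarrow> L) (at (Complex (- v) 0) within nt_cone \<alpha> (- v))"
  shows "has_nt_limit \<sigma> F (Complex \<sigma> v) L"
  unfolding has_nt_limit_def
proof (intro conjI allI impI)
  show "Complex \<sigma> v \<in> Gamma_bd \<sigma> 0 - {complex_of_real \<sigma>, - complex_of_real \<sigma>}"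
    using \<sigma> v by (auto simp: Complex_in_Gamma_bd complex_eq_iff)
  fix \<alpha> :: real assume \<alpha>: "\<alpha> > 0"
  have G: "Complex \<sigma> v \<in> Gamma3 \<sigma> 0" "Complex \<sigma> v \<notin> Gamma1 \<sigma> 0" using v \<sigma> by (auto simp: Gamma1_def Gamma3_def)
  show "(F \<longlongrightarrow> L) (at (Complex \<sigma> v) within nt_region \<sigma> \<alpha> (Complex \<sigma> v) \<inter> Omega_minus \<sigma>)"
  proof (rule tendsto_pullback[OF L[OF \<alpha>], where \<phi> = "\<lambda>w. \<i> * (w - of_real \<sigma>)"])
    show "isCont (\<lambda>w. \<i> * (w - of_real \<sigma>)) (Complex \<sigma> v)" by (intro continuous_intros)
    show "\<i> * (Complex \<sigma> v - of_real \<sigma>) = Complex (- v) 0" by (simp add: complex_eq_iff)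
    fix w
    show "F w = right_half \<sigma> F (\<i> * (w - of_real \<sigma>))"
      unfolding right_half_def by (rule arg_cong[where f = F]) (simp add: algebra_simps)
    assume "w \<in> nt_region \<sigma> \<alpha> (Complex \<sigma> v) \<inter> Omega_minus \<sigma>"
    then obtain x y where "w = Complex \<sigma> v - Complex x y" "x < 0" "\<bar>y\<bar> < - \<alpha> * x"
      using G by (auto simp: nt_region_def)
    then show "\<i> * (w - of_real \<sigma>) \<in> nt_cone \<alpha> (- v) - {Complex (- v) 0}"
      by (auto simp: nt_cone_def complex_eq_iff)
  qed
qed

lemma strip_bv_Complex:
  assumes "\<sigma> > 0"
  shows "v > 0 \<Longrightarrow> strip_bv \<sigma> F (Complex (- \<sigma>) v) = left_bv \<sigma> F v"
    "v > 0 \<Longrightarrow> strip_bv \<sigma> F (Complex \<sigma> v) = right_bv \<sigma> F v"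
    "strip_bv \<sigma> F (Complex u 0) = bottom_bv F u"
  using assms by (auto simp: strip_bv_def Gamma1_def Gamma3_def)

locale Hp_exterior =
  fixes \<sigma> p :: real and F :: "complex \<Rightarrow> complex"
  assumes \<sigma>: "\<sigma> > 0" and p: "1 < p" and F: "F \<in> Hp_space \<sigma> p"
begin

lemma holo: "F holomorphic_on Omega_minus \<sigma>"
  using F by (simp add: Hp_space_def analytic_imp_holomorphic)

lemma K_pos: "enn2real (Hp_norm \<sigma> p F) powr p + 1 > 0"
  by (simp add: add_nonneg_pos)

lemmas halves = half_plane_Hp_halves[OF \<sigma> p F]
lemmas lines_meas = continuous_on_outer_lines[OF \<sigma> holo, THEN borel_measurable_continuous_onI]

lemma bv_measurable [measurable]:
  "left_bv \<sigma> F \<in> borel_measurable borel" "bottom_bv F \<in> borel_measurable borel" "right_bv \<sigma> F \<in> borel_measurable borel"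
proof -
  note [measurable] = borel_measurable_boundary_value[OF holomorphic_halves(1)[OF \<sigma> holo]]
    borel_measurable_boundary_value[OF holomorphic_halves(2)[OF \<sigma> holo]]
    borel_measurable_boundary_value[OF holomorphic_halves(3)[OF \<sigma> holo]]
  show "left_bv \<sigma> F \<in> borel_measurable borel" "bottom_bv F \<in> borel_measurable borel" "right_bv \<sigma> F \<in> borel_measurable borel"
    unfolding left_bv_def bottom_bv_def right_bv_def by measurable
qed

lemma strip_bv_measurable [measurable]: "strip_bv \<sigma> F \<in> borel_measurable borel"
  unfolding strip_bv_def by measurable

lemma bv_Lp_finite: "Lp_pow p (left_bv \<sigma> F) < \<infinity>" "Lp_pow p (bottom_bv F) < \<infinity>" "Lp_pow p (right_bv \<sigma> F) < \<infinity>"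
proof -
  have fin: "a < \<infinity>" if "a \<le> ennreal b" for a b using that by (simp add: le_less_trans)
  have hol: "left_half \<sigma> F holomorphic_on {z. Im z > 0}" "lower_half F holomorphic_on {z. Im z > 0}" "right_half \<sigma> F holomorphic_on {z. Im z > 0}"
    by (rule holomorphic_halves[OF \<sigma> holo])+
  show "Lp_pow p (left_bv \<sigma> F) < \<infinity>"
    unfolding left_bv_def by (rule fin[OF half_plane_boundary_Lp[OF p K_pos halves(1)]])
  have "Lp_pow p (bottom_bv F) = Lp_pow p (boundary_value (lower_half F))"
    unfolding bottom_bv_def by (rule Lp_pow_reflect[OF borel_measurable_boundary_value[OF hol(2)]])
  then show "Lp_pow p (bottom_bv F) < \<infinity>"
    using fin[OF half_plane_boundary_Lp[OF p K_pos halves(2)]] by simp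
  have "Lp_pow p (right_bv \<sigma> F) = Lp_pow p (boundary_value (right_half \<sigma> F))"
    unfolding right_bv_def by (rule Lp_pow_reflect[OF borel_measurable_boundary_value[OF hol(3)]])
  then show "Lp_pow p (right_bv \<sigma> F) < \<infinity>"
    using fin[OF half_plane_boundary_Lp[OF p K_pos halves(3)]] by simp
qed

lemma nt_limit_AE: "AE \<zeta> in arc_measure \<sigma> 0. has_nt_limit \<sigma> F \<zeta> (strip_bv \<sigma> F \<zeta>)"
proof -
  let ?P = "\<lambda>\<zeta>. \<zeta> \<in> Gamma_bd \<sigma> 0 \<longrightarrow> has_nt_limit \<sigma> F \<zeta> (strip_bv \<sigma> F \<zeta>)"
  have "AE v in lborel. ?P (Complex (- \<sigma>) v)"
    using half_plane_nt_limit[OF p K_pos halves(1)] AE_lborel_singleton[of 0]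
    by eventually_elim
       (use \<sigma> in \<open>auto simp: Complex_in_Gamma_bd strip_bv_Complex left_bv_def intro!: has_nt_limit_left\<close>)
  moreover have "AE u in lborel. ?P (Complex u 0)"
    using AE_lborel_uminus[OF half_plane_nt_limit[OF p K_pos halves(2)]] AE_lborel_singleton[of \<sigma>] AE_lborel_singleton[of "- \<sigma>"]
    by eventually_elim
       (use \<sigma> in \<open>auto simp: Complex_in_Gamma_bd strip_bv_Complex bottom_bv_def intro!: has_nt_limit_bottom\<close>)
  moreover have "AE v in lborel. ?P (Complex \<sigma> v)"
    using AE_lborel_uminus[OF half_plane_nt_limit[OF p K_pos halves(3)]] AE_lborel_singleton[of 0]
    by eventually_elim
       (use \<sigma> in \<open>auto simp: Complex_in_Gamma_bd strip_bv_Complex right_bv_def intro!: has_nt_limit_right\<close>)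
  ultimately have "AE \<zeta> in lines_measure \<sigma> 0. ?P \<zeta>" by (rule AE_lines_measure)
  then show ?thesis
    unfolding arc_measure_def using \<sigma> by (subst AE_restrict_space_iff) auto
qed

lemma outer_lines_Lp_convergence:
  "((\<lambda>\<tau>. Lp_pow p (\<lambda>v. F (Complex (- (\<sigma> + \<tau>)) v) - left_bv \<sigma> F v)) \<longlongrightarrow> 0) (at_right 0)"
  "((\<lambda>\<tau>. Lp_pow p (\<lambda>u. F (Complex u (- \<tau>)) - bottom_bv F u)) \<longlongrightarrow> 0) (at_right 0)"
  "((\<lambda>\<tau>. Lp_pow p (\<lambda>v. F (Complex (\<sigma> + \<tau>) v) - right_bv \<sigma> F v)) \<longlongrightarrow> 0) (at_right 0)"
proof -
  have e: "- \<sigma> - \<tau> = - (\<sigma> + \<tau>)" for \<tau> by simp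
  show "((\<lambda>\<tau>. Lp_pow p (\<lambda>v. F (Complex (- (\<sigma> + \<tau>)) v) - left_bv \<sigma> F v)) \<longlongrightarrow> 0) (at_right 0)"
    using half_plane_Lp_convergence[OF p K_pos halves(1)] unfolding half_Complex e left_bv_def .
  show "((\<lambda>\<tau>. Lp_pow p (\<lambda>u. F (Complex u (- \<tau>)) - bottom_bv F u)) \<longlongrightarrow> 0) (at_right 0)"
  proof (rule Lim_transform_eventually[OF half_plane_Lp_convergence[OF p K_pos halves(2)]])
    show "\<forall>\<^sub>F \<tau> in at_right 0. Lp_pow p (\<lambda>x. lower_half F (Complex x \<tau>) - boundary_value (lower_half F) x) = Lp_pow p (\<lambda>u. F (Complex u (- \<tau>)) - bottom_bv F u)"
      using eventually_at_right_less[of 0]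
    proof eventually_elim
      case (elim \<tau>)
      from Lp_pow_reflect[OF borel_measurable_diff[OF lines_meas(3)[OF elim] bv_measurable(2)], of p]
      show ?case by (simp add: half_Complex bottom_bv_def)
    qed
  qed
  show "((\<lambda>\<tau>. Lp_pow p (\<lambda>v. F (Complex (\<sigma> + \<tau>) v) - right_bv \<sigma> F v)) \<longlongrightarrow> 0) (at_right 0)"
  proof (rule Lim_transform_eventually[OF half_plane_Lp_convergence[OF p K_pos halves(3)]])
    show "\<forall>\<^sub>F \<tau> in at_right 0. Lp_pow p (\<lambda>x. right_half \<sigma> F (Complex x \<tau>) - boundary_value (right_half \<sigma> F) x) = Lp_pow p (\<lambda>v. F (Complex (\<sigma> + \<tau>) v) - right_bv \<sigma> F v)"
      using eventually_at_right_less[of 0]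
    proof eventually_elim
      case (elim \<tau>)
      from Lp_pow_reflect[OF borel_measurable_diff[OF lines_meas(2)[OF elim] bv_measurable(3)], of p]
      show ?case by (simp add: half_Complex right_bv_def)
    qed
  qed
qed

lemma outer_lines_pointwise_limit:
  "AE v in lborel. (\<lambda>n. F (Complex (- (\<sigma> + inverse (real (Suc n)))) v)) \<longlonglongrightarrow> left_bv \<sigma> F v"
  "AE u in lborel. (\<lambda>n. F (Complex u (- inverse (real (Suc n))))) \<longlonglongrightarrow> bottom_bv F u"
  "AE v in lborel. (\<lambda>n. F (Complex (\<sigma> + inverse (real (Suc n))) v)) \<longlonglongrightarrow> right_bv \<sigma> F v"
proof -
  have e: "- \<sigma> - \<tau> = - (\<sigma> + \<tau>)" for \<tau> by simp
  show "AE v in lborel. (\<lambda>n. F (Complex (- (\<sigma> + inverse (real (Suc n)))) v)) \<longlonglongrightarrow> left_bv \<sigma> F v"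
    using half_plane_vertical_limit[OF p K_pos halves(1)] unfolding half_Complex e left_bv_def .
  show "AE u in lborel. (\<lambda>n. F (Complex u (- inverse (real (Suc n))))) \<longlonglongrightarrow> bottom_bv F u"
    using AE_lborel_uminus[OF half_plane_vertical_limit[OF p K_pos halves(2)]] unfolding half_Complex bottom_bv_def minus_minus .
  show "AE v in lborel. (\<lambda>n. F (Complex (\<sigma> + inverse (real (Suc n))) v)) \<longlonglongrightarrow> right_bv \<sigma> F v"
    using AE_lborel_uminus[OF half_plane_vertical_limit[OF p K_pos halves(3)]] unfolding half_Complex right_bv_def minus_minus .
qed

end

section \<open>Norm bound, Cauchy formula and convergence on the boundary\<close>

lemma nn_integral_sum3_eq_Lp_pow:
  assumes [measurable]: "a \<in> borel_measurable borel" "b \<in> borel_measurable borel" "c \<in> borel_measurable borel"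
  shows "(\<integral>\<^sup>+x. ennreal (norm (a x) powr p) + ennreal (norm (b x) powr p) + ennreal (norm (c x) powr p) \<partial>lborel)
    = Lp_pow p a + Lp_pow p b + Lp_pow p c"
  unfolding Lp_pow_def by (simp add: nn_integral_add)

lemma eventually_indicator_side:
  fixes \<tau> :: "nat \<Rightarrow> real"
  assumes "\<And>n. \<tau> n > 0" "\<tau> \<longlonglongrightarrow> 0" "v \<noteq> 0"
  shows "\<forall>\<^sub>F n in sequentially. v \<in> {- \<tau> n<..} \<longleftrightarrow> v \<in> {0<..}"
proof (cases "v > 0")
  case True
  have "- \<tau> n < v" for n using assms(1)[of n] True by linarith
  then show ?thesis using True by simp
next
  case False
  then have "- v > 0" using assms(3) by simp
  from order_tendstoD(2)[OF assms(2) this] show ?thesis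
    by eventually_elim (use False in auto)
qed

lemma eventually_indicator_bottom:
  fixes \<tau> :: "nat \<Rightarrow> real"
  assumes "\<And>n. \<tau> n > 0" "\<tau> \<longlonglongrightarrow> 0"
  shows "\<forall>\<^sub>F n in sequentially. u \<in> {- (\<sigma> + \<tau> n)..\<sigma> + \<tau> n} \<longleftrightarrow> u \<in> {-\<sigma>..\<sigma>}"
proof (cases "\<bar>u\<bar> \<le> \<sigma>")
  case True
  then have "u \<in> {- (\<sigma> + \<tau> n)..\<sigma> + \<tau> n}" for n using assms(1)[of n] by auto
  then show ?thesis using True by (auto simp: abs_le_iff)
next
  case False
  then have "\<bar>u\<bar> - \<sigma> > 0" by simp
  from order_tendstoD(2)[OF assms(2) this] show ?thesis
    by eventually_elim (use False in auto)
qed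

lemma tendsto_eventually_indicator:
  fixes f :: "nat \<Rightarrow> complex"
  assumes "f \<longlonglongrightarrow> l" "\<forall>\<^sub>F n in sequentially. x \<in> A n \<longleftrightarrow> x \<in> B"
  shows "(\<lambda>n. indicator (A n) x *\<^sub>R f n) \<longlonglongrightarrow> indicator B x *\<^sub>R l"
proof (rule Lim_transform_eventually)
  show "(\<lambda>n. indicator B x *\<^sub>R f n) \<longlonglongrightarrow> indicator B x *\<^sub>R l" by (intro tendsto_intros assms(1))
  show "\<forall>\<^sub>F n in sequentially. indicator B x *\<^sub>R f n = indicator (A n) x *\<^sub>R f n"
    using assms(2) by eventually_elim (simp add: indicator_def)
qed

text \<open>
The second error term tends to 0 in \<open>L\<^sup>p\<close> by dominated convergence, since almost every point leaves the sets \<open>S n\<close>.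
\<close>
lemma tendsto_Lp_pow_of_shrinking_error:
  fixes g D :: "nat \<Rightarrow> real \<Rightarrow> complex"
  assumes p: "p > 0" and [measurable]: "\<And>n. g n \<in> borel_measurable borel" "b \<in> borel_measurable borel" "\<And>n. S n \<in> sets borel"
    and fin: "Lp_pow p b < \<infinity>" and lim: "(\<lambda>n. Lp_pow p (\<lambda>v. g n v - b v)) \<longlonglongrightarrow> 0"
    and S: "AE v in lborel. \<forall>\<^sub>F n in sequentially. v \<notin> S n"
    and D: "\<And>n. AE v in lborel. norm (D n v) \<le> norm (g n v - b v) + norm (indicator (S n) v *\<^sub>R b v)"
  shows "(\<lambda>n. Lp_pow p (D n)) \<longlonglongrightarrow> 0"
proof -
  let ?e = "\<lambda>n v. ennreal (norm (indicator (S n) v *\<^sub>R b v) powr p)"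
  have "(\<lambda>n. \<integral>\<^sup>+v. ?e n v \<partial>lborel) \<longlonglongrightarrow> (\<integral>\<^sup>+v. 0 \<partial>(lborel :: real measure))"
  proof (rule nn_integral_dominated_convergence[where w = "\<lambda>v. ennreal (norm (b v) powr p)"])
    show "AE v in lborel. ?e n v \<le> ennreal (norm (b v) powr p)" for n
      by (intro AE_I2) (auto simp: indicator_def)
    show "(\<integral>\<^sup>+v. ennreal (norm (b v) powr p) \<partial>lborel) < \<infinity>" using fin by (simp add: Lp_pow_def)
    show "AE v in lborel. (\<lambda>n. ?e n v) \<longlonglongrightarrow> 0"
      using S
    proof eventually_elim
      case (elim v)
      then have "\<forall>\<^sub>F n in sequentially. ?e n v = 0" by eventually_elim simp
      then show ?case by (rule tendsto_eventually)
    qed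
  qed measurable
  then have e0: "(\<lambda>n. \<integral>\<^sup>+v. ?e n v \<partial>lborel) \<longlonglongrightarrow> 0" by simp
  have le: "Lp_pow p (D n) \<le> ennreal (2 powr p) * Lp_pow p (\<lambda>v. g n v - b v) + ennreal (2 powr p) * (\<integral>\<^sup>+v. ?e n v \<partial>lborel)" for n
  proof -
    have "Lp_pow p (D n) \<le> (\<integral>\<^sup>+v. ennreal (2 powr p) * ennreal (norm (g n v - b v) powr p) + ennreal (2 powr p) * ?e n v \<partial>lborel)"
      unfolding Lp_pow_def
    proof (rule nn_integral_mono_AE)
      show "AE v in lborel. ennreal (norm (D n v) powr p) \<le> ennreal (2 powr p) * ennreal (norm (g n v - b v) powr p) + ennreal (2 powr p) * ?e n v"
        using D[of n]
      proof eventually_elim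
        case (elim v)
        define x y where "x = norm (g n v - b v)" and "y = norm (indicator (S n) v *\<^sub>R b v)"
        have xy: "x \<ge> 0" "y \<ge> 0" by (auto simp: x_def y_def)
        have "norm (D n v) powr p \<le> (2 * max x y) powr p"
          using elim p by (intro powr_mono2) (auto simp: x_def y_def)
        also have "\<dots> = 2 powr p * max x y powr p" using xy by (simp add: powr_mult)
        also have "max x y powr p \<le> x powr p + y powr p" by (auto simp: max_def)
        finally have "norm (D n v) powr p \<le> 2 powr p * (x powr p + y powr p)" by simp
        then have "ennreal (norm (D n v) powr p) \<le> ennreal (2 powr p * x powr p + 2 powr p * y powr p)"
          by (intro ennreal_leI) (simp add: distrib_left)
        then show ?case unfolding x_def y_def
          by (simp only: ennreal_plus ennreal_mult mult_nonneg_nonneg powr_ge_zero)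
      qed
    qed
    also have "\<dots> = ennreal (2 powr p) * Lp_pow p (\<lambda>v. g n v - b v) + ennreal (2 powr p) * (\<integral>\<^sup>+v. ?e n v \<partial>lborel)"
      unfolding Lp_pow_def by (subst nn_integral_add) (auto simp: nn_integral_cmult)
    finally show ?thesis .
  qed
  have "(\<lambda>n. ennreal (2 powr p) * Lp_pow p (\<lambda>v. g n v - b v) + ennreal (2 powr p) * (\<integral>\<^sup>+v. ?e n v \<partial>lborel)) \<longlonglongrightarrow> ennreal (2 powr p) * 0 + ennreal (2 powr p) * 0"
    by (intro tendsto_add ennreal_tendsto_cmult lim e0) auto
  then have *: "(\<lambda>n. ennreal (2 powr p) * Lp_pow p (\<lambda>v. g n v - b v) + ennreal (2 powr p) * (\<integral>\<^sup>+v. ?e n v \<partial>lborel)) \<longlonglongrightarrow> 0" by simp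
  show ?thesis
    by (rule tendsto_sandwich[OF always_eventually[OF allI[OF zero_le]] always_eventually[OF allI[OF le]] tendsto_const *])
qed

context Hp_exterior
begin

lemma nn_integral_strip_bv_le:
  "(\<integral>\<^sup>+\<zeta>. ennreal (norm (strip_bv \<sigma> F \<zeta>) powr p) \<partial>arc_measure \<sigma> 0) \<le> ennreal (enn2real (Hp_norm \<sigma> p F) powr p)"
proof -
  define \<tau> where "\<tau> = (\<lambda>n. inverse (real (Suc n)))"
  have \<tau>: "\<tau> n > 0" "\<tau> \<longlonglongrightarrow> 0" for n unfolding \<tau>_def using LIMSEQ_inverse_real_of_nat by auto
  note [measurable] = lines_meas[OF \<tau>(1)]
  let ?a = "\<lambda>n v. indicator {- \<tau> n<..} v *\<^sub>R F (Complex (- (\<sigma> + \<tau> n)) v)"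
  let ?b = "\<lambda>n u. indicator {- (\<sigma> + \<tau> n)..\<sigma> + \<tau> n} u *\<^sub>R F (Complex u (- \<tau> n))"
  let ?c = "\<lambda>n v. indicator {- \<tau> n<..} v *\<^sub>R F (Complex (\<sigma> + \<tau> n) v)"
  let ?a' = "\<lambda>v. indicator {0<..} v *\<^sub>R left_bv \<sigma> F v"
  let ?b' = "\<lambda>u. indicator {- \<sigma>..\<sigma>} u *\<^sub>R bottom_bv F u"
  let ?c' = "\<lambda>v. indicator {0<..} v *\<^sub>R right_bv \<sigma> F v"
  let ?N = "\<lambda>z::complex. ennreal (norm z powr p)"
  have p0: "p > 0" using p by simp
  have "(\<lambda>\<zeta>. indicator (Gamma_bd \<sigma> 0) \<zeta> *\<^sub>R strip_bv \<sigma> F \<zeta>) \<in> borel_measurable borel"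
    using Gamma_bd_borel[OF \<sigma>, of 0] by measurable
  from nn_integral_arc_powr[OF \<sigma> p0 this]
  have "(\<integral>\<^sup>+\<zeta>. ennreal (norm (strip_bv \<sigma> F \<zeta>) powr p) \<partial>arc_measure \<sigma> 0) =
     Lp_pow p (\<lambda>v. indicator {0<..} v *\<^sub>R strip_bv \<sigma> F (Complex (- \<sigma>) v)) + Lp_pow p (\<lambda>u. indicator {-\<sigma>..\<sigma>} u *\<^sub>R strip_bv \<sigma> F (Complex u 0))
      + Lp_pow p (\<lambda>v. indicator {0<..} v *\<^sub>R strip_bv \<sigma> F (Complex \<sigma> v))" .
  also have "(\<lambda>v. indicator {0<..} v *\<^sub>R strip_bv \<sigma> F (Complex (- \<sigma>) v)) = ?a'"
    by (auto simp: fun_eq_iff indicator_def strip_bv_Complex[OF \<sigma>])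
  also have "(\<lambda>v. indicator {0<..} v *\<^sub>R strip_bv \<sigma> F (Complex \<sigma> v)) = ?c'"
    by (auto simp: fun_eq_iff indicator_def strip_bv_Complex[OF \<sigma>])
  also have "(\<lambda>u. indicator {-\<sigma>..\<sigma>} u *\<^sub>R strip_bv \<sigma> F (Complex u 0)) = ?b'"
    by (simp add: strip_bv_Complex[OF \<sigma>])
  also have "Lp_pow p ?a' + Lp_pow p ?b' + Lp_pow p ?c' = (\<integral>\<^sup>+x. ?N (?a' x) + ?N (?b' x) + ?N (?c' x) \<partial>lborel)"
    by (rule nn_integral_sum3_eq_Lp_pow[symmetric]) measurable
  also have "\<dots> \<le> ennreal (enn2real (Hp_norm \<sigma> p F) powr p)"
  proof (rule nn_integral_le_of_AE_tendsto[where N = 0])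
    show "AE x in lborel. (\<lambda>n. ?N (?a n x) + ?N (?b n x) + ?N (?c n x)) \<longlonglongrightarrow> ?N (?a' x) + ?N (?b' x) + ?N (?c' x)"
      using outer_lines_pointwise_limit(1)[folded \<tau>_def[THEN fun_cong]] outer_lines_pointwise_limit(2)[folded \<tau>_def[THEN fun_cong]] outer_lines_pointwise_limit(3)[folded \<tau>_def[THEN fun_cong]] AE_lborel_singleton[of 0]
    proof eventually_elim
      case (elim x)
      show ?case
        using eventually_indicator_side[OF \<tau> elim(4)] eventually_indicator_bottom[OF \<tau>, of x \<sigma>]
        by (intro tendsto_add tendsto_norm_powr_ennreal[OF p0] tendsto_eventually_indicator elim)
    qed
    show "(\<integral>\<^sup>+x. ?N (?a n x) + ?N (?b n x) + ?N (?c n x) \<partial>lborel) \<le> ennreal (enn2real (Hp_norm \<sigma> p F) powr p)" for n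
    proof -
      have st: "\<sigma> + \<tau> n > \<sigma>" "- \<tau> n < 0" "\<sigma> + \<tau> n > 0" using \<tau>(1)[of n] \<sigma> by auto
      have "(\<integral>\<^sup>+x. ?N (?a n x) + ?N (?b n x) + ?N (?c n x) \<partial>lborel) = Lp_pow p (?a n) + Lp_pow p (?b n) + Lp_pow p (?c n)"
        by (rule nn_integral_sum3_eq_Lp_pow) measurable
      also have "\<dots> = (\<integral>\<^sup>+w. ennreal (norm (F w) powr p) \<partial>arc_measure (\<sigma> + \<tau> n) (- \<tau> n))"
        by (rule nn_integral_arc_powr[OF st(3) p0 borel_measurable_on_Gamma_bd[OF \<sigma> st(1,2) holo], symmetric])
      also have "\<dots> \<le> ennreal (enn2real (Hp_norm \<sigma> p F) powr p)"
        by (rule Hp_space_arc_bound[OF \<sigma> p F st(1,2)])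
      finally show ?thesis .
    qed
  qed measurable
  finally show ?thesis .
qed

lemma Lp_norm_strip_bv_le: "Lp_norm p (arc_measure \<sigma> 0) (strip_bv \<sigma> F) \<le> Hp_norm \<sigma> p F"
proof -
  have "Lp_norm p (arc_measure \<sigma> 0) (strip_bv \<sigma> F) \<le> ennreal (enn2real (Hp_norm \<sigma> p F))"
    using nn_integral_strip_bv_le p by (subst Lp_norm_le_iff) auto
  also have "\<dots> = Hp_norm \<sigma> p F" using F by (simp add: Hp_space_def)
  finally show ?thesis .
qed

lemma strip_bv_in_Lp_space: "strip_bv \<sigma> F \<in> Lp_space p (arc_measure \<sigma> 0)"
proof -
  have "strip_bv \<sigma> F \<in> borel_measurable (arc_measure \<sigma> 0)"
    unfolding arc_measure_def by (intro measurable_restrict_space1) simp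
  moreover have "Lp_norm p (arc_measure \<sigma> 0) (strip_bv \<sigma> F) < \<infinity>"
    using Lp_norm_strip_bv_le F by (auto simp: Hp_space_def intro: le_less_trans)
  ultimately show ?thesis by (simp add: Lp_space_def)
qed

lemma Cauchy_integral_strip_bv:
  assumes w: "w \<in> Omega_plus \<sigma> \<union> Omega_minus \<sigma>"
  shows "arc_integrable \<sigma> 0 (\<lambda>\<zeta>. strip_bv \<sigma> F \<zeta> / (\<zeta> - w))"
    and "arc_integral \<sigma> 0 (\<lambda>\<zeta>. strip_bv \<sigma> F \<zeta> / (\<zeta> - w)) = - (2 * of_real pi * \<i> * (if w \<in> Omega_plus \<sigma> then 0 else F w))"
proof -
  let ?f = "\<lambda>\<zeta>. strip_bv \<sigma> F \<zeta> / (\<zeta> - w)"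
  define c where "c = (if w \<in> Omega_plus \<sigma> then 0 else F w)"
  obtain \<delta> where \<delta>: "\<delta> > 0" "\<And>\<tau> \<zeta>. \<lbrakk>0 \<le> \<tau>; \<tau> \<le> \<delta>; \<zeta> \<in> Gamma_bd (\<sigma> + \<tau>) (- \<tau>)\<rbrakk> \<Longrightarrow> \<delta> \<le> norm (\<zeta> - w)"
    "\<And>\<tau>. \<lbrakk>0 \<le> \<tau>; \<tau> \<le> \<delta>; w \<in> Omega_minus \<sigma>\<rbrakk> \<Longrightarrow> Re w < - (\<sigma> + \<tau>) \<or> Im w < - \<tau> \<or> Re w > \<sigma> + \<tau>"
    using Gamma_bd_uniformly_far[OF \<sigma> w] by blast
  define C where "C = 1 + (1 + norm w) / \<delta>"
  have C: "C \<ge> 0" using \<delta>(1) by (simp add: C_def)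
  define \<tau> where "\<tau> = (\<lambda>n. \<delta> * inverse (real (Suc n)))"
  have \<tau>: "\<tau> n > 0" "\<tau> n \<le> \<delta>" for n
    using \<delta>(1) by (auto simp: \<tau>_def mult_le_cancel_left1 inverse_le_1_iff)
  have \<tau>0: "\<tau> \<longlonglongrightarrow> 0"
    unfolding \<tau>_def using tendsto_mult[OF tendsto_const[of \<delta>] LIMSEQ_inverse_real_of_nat] by simp
  have fl: "filterlim \<tau> (at_right 0) sequentially"
  proof -
    have "\<tau> n \<in> {0<..} \<and> \<tau> n \<noteq> 0" for n using \<tau>(1)[of n] by simp
    then show ?thesis using \<tau>0 by (simp add: filterlim_at)
  qed
  have far0: "\<delta> \<le> norm (\<zeta> - w)" if "\<zeta> \<in> Gamma_bd \<sigma> 0" for \<zeta>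
    using \<delta>(2)[of 0 \<zeta>] that \<delta>(1) by simp
  have far: "\<delta> \<le> norm (\<zeta> - w)" if "\<zeta> \<in> Gamma_bd (\<sigma> + \<tau> n) (- \<tau> n)" for \<zeta> n
    using \<delta>(2)[OF _ \<tau>(2) that] \<tau>(1)[of n] by simp
  have sn: "\<sigma> + \<tau> n > 0" for n using \<sigma> \<tau>(1)[of n] by simp
  note kb0 = norm_kernels_le[where s = \<sigma> and t = 0, OF \<sigma> \<delta>(1) far0, folded C_def]
  note kb = norm_kernels_le[OF sn \<delta>(1) far, folded C_def]
  have bk: "strip_bv \<sigma> F (Complex (- \<sigma>) v) * side_kernel (- \<sigma>) 0 w v = left_bv \<sigma> F v * side_kernel (- \<sigma>) 0 w v"
    "strip_bv \<sigma> F (Complex \<sigma> v) * side_kernel \<sigma> 0 w v = right_bv \<sigma> F v * side_kernel \<sigma> 0 w v" for v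
    by (auto simp: side_kernel_def indicator_def strip_bv_Complex[OF \<sigma>])
  have int: "set_integrable lborel {0<..} (\<lambda>v. ?f (Complex (- \<sigma>) v))" "set_integrable lborel {-\<sigma>..\<sigma>} (\<lambda>u. ?f (Complex u 0))"
    "set_integrable lborel {0<..} (\<lambda>v. ?f (Complex \<sigma> v))"
    unfolding set_integrable_def set_integral_kernel bk strip_bv_Complex(3)[OF \<sigma>]
    by (intro integrable_Lp_times_decay[OF p C] bv_measurable kb0 bv_Lp_finite borel_measurable_kernels; assumption)+
  have "(\<lambda>\<zeta>. indicator (Gamma_bd \<sigma> 0) \<zeta> *\<^sub>R ?f \<zeta>) \<in> borel_measurable borel"
    using Gamma_bd_borel[OF \<sigma>, of 0] by measurable
  note arc = arc_integral_eq[OF \<sigma> this int]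
  show "arc_integrable \<sigma> 0 ?f" by (rule arc(1))
  have arc_eq: "arc_integral \<sigma> 0 ?f = - \<i> * (\<integral>v. left_bv \<sigma> F v * side_kernel (- \<sigma>) 0 w v \<partial>lborel)
     + (\<integral>u. bottom_bv F u * bottom_kernel \<sigma> 0 w u \<partial>lborel) + \<i> * (\<integral>v. right_bv \<sigma> F v * side_kernel \<sigma> 0 w v \<partial>lborel)"
    unfolding arc(2) set_lebesgue_integral_def set_integral_kernel bk strip_bv_Complex(3)[OF \<sigma>] ..
  have side_lim: "AE v in lborel. (\<lambda>n. side_kernel (a n) (- \<tau> n) w v) \<longlonglongrightarrow> side_kernel a' 0 w v"
    if a: "a \<longlonglongrightarrow> a'" "a' = \<sigma> \<or> a' = - \<sigma>" for a a'
    using AE_lborel_singleton[of 0]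
  proof eventually_elim
    case (elim v)
    have ev: "\<forall>\<^sub>F n in sequentially. v \<in> {- \<tau> n<..} \<longleftrightarrow> v \<in> {0<..}"
      by (rule eventually_indicator_side[OF \<tau>(1) \<tau>0 elim])
    show ?case
    proof (cases "v > 0")
      case True
      then have "Complex a' v \<in> Gamma_bd \<sigma> 0" using a(2) Complex_in_Gamma_bd[OF \<sigma>] by auto
      then have "Complex a' v - w \<noteq> 0" using far0 \<delta>(1) by force
      then show ?thesis unfolding side_kernel_def
        by (intro tendsto_eventually_indicator[OF _ ev] tendsto_intros tendsto_Complex a(1))
    next
      case False
      from ev have "\<forall>\<^sub>F n in sequentially. side_kernel (a n) (- \<tau> n) w v = side_kernel a' 0 w v"
        by eventually_elim (use False in \<open>simp add: side_kernel_def\<close>)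
      then show ?thesis by (rule tendsto_eventually)
    qed
  qed
  have bottom_lim: "AE u in lborel. (\<lambda>n. bottom_kernel (\<sigma> + \<tau> n) (- \<tau> n) w u) \<longlonglongrightarrow> bottom_kernel \<sigma> 0 w u"
  proof (rule AE_I2)
    fix u
    have ev: "\<forall>\<^sub>F n in sequentially. u \<in> {- (\<sigma> + \<tau> n)..\<sigma> + \<tau> n} \<longleftrightarrow> u \<in> {-\<sigma>..\<sigma>}"
      by (rule eventually_indicator_bottom[OF \<tau>(1) \<tau>0])
    show "(\<lambda>n. bottom_kernel (\<sigma> + \<tau> n) (- \<tau> n) w u) \<longlonglongrightarrow> bottom_kernel \<sigma> 0 w u"
    proof (cases "\<bar>u\<bar> \<le> \<sigma>")
      case True
      then have "Complex u 0 \<in> Gamma_bd \<sigma> 0" using Complex_in_Gamma_bd[OF \<sigma>] by auto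
      then have "Complex u (- 0) - w \<noteq> 0" using far0 \<delta>(1) by force
      then have "(\<lambda>n. 1 / (Complex u (- \<tau> n) - w)) \<longlonglongrightarrow> 1 / (Complex u (- 0) - w)"
        by (intro tendsto_intros tendsto_Complex \<tau>0)
      then show ?thesis unfolding bottom_kernel_def
        by (intro tendsto_eventually_indicator[OF _ ev]) simp
    next
      case False
      from ev have "\<forall>\<^sub>F n in sequentially. bottom_kernel (\<sigma> + \<tau> n) (- \<tau> n) w u = bottom_kernel \<sigma> 0 w u"
        by eventually_elim (use False in \<open>auto simp: bottom_kernel_def indicator_def\<close>)
      then show ?thesis by (rule tendsto_eventually)
    qed
  qed
  have lims: "(\<lambda>n. - (\<sigma> + \<tau> n)) \<longlonglongrightarrow> - \<sigma>" "(\<lambda>n. \<sigma> + \<tau> n) \<longlonglongrightarrow> \<sigma>"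
    using tendsto_minus[OF tendsto_add[OF tendsto_const \<tau>0, of \<sigma>]] tendsto_add[OF tendsto_const \<tau>0, of \<sigma>] by simp_all
  note conv = filterlim_compose[OF _ fl]
  have "(\<lambda>n. \<integral>v. F (Complex (- (\<sigma> + \<tau> n)) v) * side_kernel (- (\<sigma> + \<tau> n)) (- \<tau> n) w v \<partial>lborel) \<longlonglongrightarrow> (\<integral>v. left_bv \<sigma> F v * side_kernel (- \<sigma>) 0 w v \<partial>lborel)"
    by (rule tendsto_integral_Lp_times_decay[OF p C lines_meas(1)[OF \<tau>(1)] borel_measurable_kernels(1) bv_measurable(1) borel_measurable_kernels(1)
        kb(2) kb0(2) bv_Lp_finite(1) Lp_pow_outer_lines_finite(1)[OF \<sigma> p F \<tau>(1)] conv[OF outer_lines_Lp_convergence(1)] side_lim[OF lims(1) disjI2[OF refl]]])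
  moreover have "(\<lambda>n. \<integral>u. F (Complex u (- \<tau> n)) * bottom_kernel (\<sigma> + \<tau> n) (- \<tau> n) w u \<partial>lborel) \<longlonglongrightarrow> (\<integral>u. bottom_bv F u * bottom_kernel \<sigma> 0 w u \<partial>lborel)"
    by (rule tendsto_integral_Lp_times_decay[OF p C lines_meas(3)[OF \<tau>(1)] borel_measurable_kernels(2) bv_measurable(2) borel_measurable_kernels(2)
        kb(3) kb0(3) bv_Lp_finite(2) Lp_pow_outer_lines_finite(3)[OF \<sigma> p F \<tau>(1)] conv[OF outer_lines_Lp_convergence(2)] bottom_lim])
  moreover have "(\<lambda>n. \<integral>v. F (Complex (\<sigma> + \<tau> n) v) * side_kernel (\<sigma> + \<tau> n) (- \<tau> n) w v \<partial>lborel) \<longlonglongrightarrow> (\<integral>v. right_bv \<sigma> F v * side_kernel \<sigma> 0 w v \<partial>lborel)"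
    by (rule tendsto_integral_Lp_times_decay[OF p C lines_meas(2)[OF \<tau>(1)] borel_measurable_kernels(1) bv_measurable(3) borel_measurable_kernels(1)
        kb(1) kb0(1) bv_Lp_finite(3) Lp_pow_outer_lines_finite(2)[OF \<sigma> p F \<tau>(1)] conv[OF outer_lines_Lp_convergence(3)] side_lim[OF lims(2) disjI1[OF refl]]])
  ultimately have "(\<lambda>n. - \<i> * (\<integral>v. F (Complex (- (\<sigma> + \<tau> n)) v) * side_kernel (- (\<sigma> + \<tau> n)) (- \<tau> n) w v \<partial>lborel)
     + (\<integral>u. F (Complex u (- \<tau> n)) * bottom_kernel (\<sigma> + \<tau> n) (- \<tau> n) w u \<partial>lborel)
     + \<i> * (\<integral>v. F (Complex (\<sigma> + \<tau> n) v) * side_kernel (\<sigma> + \<tau> n) (- \<tau> n) w v \<partial>lborel)) \<longlonglongrightarrow> arc_integral \<sigma> 0 ?f"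
    unfolding arc_eq by (intro tendsto_intros)
  moreover have "w \<in> Omega_plus \<sigma> \<and> c = 0 \<or> (Re w < - (\<sigma> + \<tau> n) \<or> Im w < - \<tau> n \<or> Re w > \<sigma> + \<tau> n) \<and> c = F w" for n
    using w \<delta>(3)[OF _ \<tau>(2), of n] \<tau>(1)[of n] by (auto simp: c_def)
  note Cauchy_integral_outer_lines[OF \<sigma> p F \<tau>(1) \<delta>(1) far this]
  ultimately have "(\<lambda>n::nat. - (2 * of_real pi * \<i> * c)) \<longlonglongrightarrow> arc_integral \<sigma> 0 ?f" by simp
  then have "arc_integral \<sigma> 0 ?f = - (2 * of_real pi * \<i> * c)"
    using LIMSEQ_unique[OF tendsto_const] by metis
  then show "arc_integral \<sigma> 0 ?f = - (2 * of_real pi * \<i> * (if w \<in> Omega_plus \<sigma> then 0 else F w))"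
    by (simp only: c_def)
qed

lemma borel_measurable_transported:
  assumes \<tau>: "\<tau> > 0"
  shows "transported \<sigma> (\<sigma> + \<tau>) (- \<tau>) F \<in> borel_measurable borel"
proof -
  let ?G = "\<lambda>w. indicator (Gamma_bd (\<sigma> + \<tau>) (- \<tau>)) w *\<^sub>R F w"
  have [measurable]: "?G \<in> borel_measurable borel"
    using \<sigma> \<tau> by (intro borel_measurable_on_Gamma_bd[OF \<sigma> _ _ holo]) auto
  have [measurable]: "gamma1 \<sigma> (- \<tau>) \<in> sets borel" "gamma2 (\<sigma> + \<tau>) \<in> sets borel" "gamma3 \<sigma> (- \<tau>) \<in> sets borel"
  proof -
    have "{w \<in> space borel. Re w = - \<sigma> \<and> Im w > - \<tau>} \<in> sets borel" "{w \<in> space borel. Im w = 0 \<and> \<bar>Re w\<bar> \<le> \<sigma> + \<tau>} \<in> sets borel"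
      "{w \<in> space borel. Re w = \<sigma> \<and> Im w > - \<tau>} \<in> sets borel" by measurable
    then show "gamma1 \<sigma> (- \<tau>) \<in> sets borel" "gamma2 (\<sigma> + \<tau>) \<in> sets borel" "gamma3 \<sigma> (- \<tau>) \<in> sets borel"
      by (simp_all add: gamma1_def gamma2_def gamma3_def)
  qed
  have [measurable]: "shift_map \<sigma> (\<sigma> + \<tau>) (- \<tau>) \<in> borel_measurable borel"
    unfolding shift_map_def by measurable
  have "shift_map \<sigma> (\<sigma> + \<tau>) (- \<tau>) \<zeta> \<in> Gamma_bd (\<sigma> + \<tau>) (- \<tau>)"
    if "\<zeta> \<in> gamma1 \<sigma> (- \<tau>) \<union> gamma2 (\<sigma> + \<tau>) \<union> gamma3 \<sigma> (- \<tau>)" for \<zeta>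
    using that by (cases \<zeta>) (auto simp: shift_map_def gamma1_def gamma2_def gamma3_def Gamma_bd_def Gamma1_def Gamma2_def Gamma3_def complex_eq_iff)
  then have "transported \<sigma> (\<sigma> + \<tau>) (- \<tau>) F = (\<lambda>\<zeta>. if \<zeta> \<in> gamma1 \<sigma> (- \<tau>) \<union> gamma2 (\<sigma> + \<tau>) \<union> gamma3 \<sigma> (- \<tau>)
      then ?G (shift_map \<sigma> (\<sigma> + \<tau>) (- \<tau>) \<zeta>) else 0)"
    by (auto simp: transported_def fun_eq_iff)
  also have "\<dots> \<in> borel_measurable borel" by measurable
  finally show ?thesis .
qed

definition transport_error :: "real \<Rightarrow> complex \<Rightarrow> complex" where
  "transport_error \<tau> \<zeta> = transported \<sigma> (\<sigma> + \<tau>) (- \<tau>) F \<zeta> - extend_zero (Gamma_bd \<sigma> 0) (strip_bv \<sigma> F) \<zeta>"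

text \<open>
Besides the difference on the line, the error contains \<open>F\<close> itself on the piece of length \<open>\<tau>\<close> below the
corner, where the boundary function is extended by 0; there \<open>F\<close> is compared with the boundary value on the full line.
\<close>
lemma transport_error_left:
  assumes "\<tau> > 0" "v \<noteq> 0"
  shows "norm (transport_error \<tau> (Complex (- \<sigma>) v)) \<le>
    norm (F (Complex (- (\<sigma> + \<tau>)) v) - left_bv \<sigma> F v) + norm (indicator {- \<tau>..0} v *\<^sub>R left_bv \<sigma> F v)"
proof -
  have t: "transported \<sigma> (\<sigma> + \<tau>) (- \<tau>) F (Complex (- \<sigma>) v) = (if v > - \<tau> then F (Complex (- (\<sigma> + \<tau>)) v) else 0)"
  proof -
    have "Complex (- \<sigma>) v + of_real (\<sigma> - (\<sigma> + \<tau>)) = Complex (- (\<sigma> + \<tau>)) v" by (simp add: complex_eq_iff)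
    then show ?thesis using assms \<sigma> by (simp add: transported_def shift_map_def gamma1_def gamma2_def gamma3_def)
  qed
  have e: "extend_zero (Gamma_bd \<sigma> 0) (strip_bv \<sigma> F) (Complex (- \<sigma>) v) = (if v > 0 then left_bv \<sigma> F v else 0)"
    using assms by (auto simp: extend_zero_def Complex_in_Gamma_bd[OF \<sigma>] strip_bv_Complex[OF \<sigma>])
  have "norm x \<le> norm (x - y) + norm y" for x y :: complex using norm_triangle_ineq[of "x - y" y] by simp
  then show ?thesis using assms unfolding transport_error_def t e by (auto simp: indicator_def)
qed

lemma transport_error_right:
  assumes "\<tau> > 0" "v \<noteq> 0"
  shows "norm (transport_error \<tau> (Complex \<sigma> v)) \<le>
    norm (F (Complex (\<sigma> + \<tau>) v) - right_bv \<sigma> F v) + norm (indicator {- \<tau>..0} v *\<^sub>R right_bv \<sigma> F v)"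
proof -
  have t: "transported \<sigma> (\<sigma> + \<tau>) (- \<tau>) F (Complex \<sigma> v) = (if v > - \<tau> then F (Complex (\<sigma> + \<tau>) v) else 0)"
  proof -
    have "Complex \<sigma> v - of_real (\<sigma> - (\<sigma> + \<tau>)) = Complex (\<sigma> + \<tau>) v" by (simp add: complex_eq_iff)
    then show ?thesis using assms \<sigma> by (simp add: transported_def shift_map_def gamma1_def gamma2_def gamma3_def)
  qed
  have e: "extend_zero (Gamma_bd \<sigma> 0) (strip_bv \<sigma> F) (Complex \<sigma> v) = (if v > 0 then right_bv \<sigma> F v else 0)"
    using assms by (auto simp: extend_zero_def Complex_in_Gamma_bd[OF \<sigma>] strip_bv_Complex[OF \<sigma>])
  have "norm x \<le> norm (x - y) + norm y" for x y :: complex using norm_triangle_ineq[of "x - y" y] by simp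
  then show ?thesis using assms unfolding transport_error_def t e by (auto simp: indicator_def)
qed

lemma transport_error_bottom:
  assumes "\<tau> > 0" "u \<noteq> \<sigma>" "u \<noteq> - \<sigma>"
  shows "norm (transport_error \<tau> (Complex u 0)) \<le>
    norm (F (Complex u (- \<tau>)) - bottom_bv F u) + norm (indicator ({- (\<sigma> + \<tau>)..\<sigma> + \<tau>} - {-\<sigma>..\<sigma>}) u *\<^sub>R bottom_bv F u)"
proof -
  have t: "transported \<sigma> (\<sigma> + \<tau>) (- \<tau>) F (Complex u 0) = (if \<bar>u\<bar> \<le> \<sigma> + \<tau> then F (Complex u (- \<tau>)) else 0)"
  proof -
    have "Complex u 0 + \<i> * of_real (- \<tau>) = Complex u (- \<tau>)" by (simp add: complex_eq_iff)
    then show ?thesis using assms by (simp add: transported_def shift_map_def gamma1_def gamma2_def gamma3_def)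
  qed
  have e: "extend_zero (Gamma_bd \<sigma> 0) (strip_bv \<sigma> F) (Complex u 0) = (if \<bar>u\<bar> \<le> \<sigma> then bottom_bv F u else 0)"
    by (auto simp: extend_zero_def Complex_in_Gamma_bd[OF \<sigma>] strip_bv_Complex[OF \<sigma>])
  have "norm x \<le> norm (x - y) + norm y" for x y :: complex using norm_triangle_ineq[of "x - y" y] by simp
  then show ?thesis using assms unfolding transport_error_def t e by (auto simp: indicator_def abs_le_iff)
qed

lemma transported_Lp_convergence:
  "((\<lambda>\<tau>. Lp_norm p (gamma_measure \<sigma>) (\<lambda>\<zeta>. transported \<sigma> (\<sigma> + \<tau>) (- \<tau>) F \<zeta> - extend_zero (Gamma_bd \<sigma> 0) (strip_bv \<sigma> F) \<zeta>))
     \<longlongrightarrow> 0) (at_right 0)"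
  unfolding transport_error_def[symmetric]
proof (rule tendsto_Lp_norm_0)
  have p0: "p > 0" using p by simp
  then show "p > 0" .
  have "(\<lambda>n. \<integral>\<^sup>+\<zeta>. ennreal (norm (transport_error (\<tau> n) \<zeta>) powr p) \<partial>gamma_measure \<sigma>) \<longlonglongrightarrow> 0"
    if \<tau>: "\<And>n. \<tau> n > 0" "\<tau> \<longlonglongrightarrow> 0" for \<tau> :: "nat \<Rightarrow> real"
  proof -
    have fl: "filterlim \<tau> (at_right 0) sequentially"
    proof -
      have "\<tau> n \<in> {0<..} \<and> \<tau> n \<noteq> 0" for n using \<tau>(1)[of n] by simp
      then show ?thesis using \<tau>(2) by (simp add: filterlim_at)
    qed
    note conv = filterlim_compose[OF _ fl]
    have meas: "transport_error (\<tau> n) \<in> borel_measurable borel" for n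
    proof -
      have [measurable]: "Gamma_bd \<sigma> 0 \<in> sets borel" using \<sigma> by simp
      note [measurable] = borel_measurable_transported[OF \<tau>(1)]
      show ?thesis unfolding transport_error_def extend_zero_def by measurable
    qed
    have "(\<integral>\<^sup>+\<zeta>. ennreal (norm (transport_error (\<tau> n) \<zeta>) powr p) \<partial>gamma_measure \<sigma>) =
      Lp_pow p (\<lambda>v. transport_error (\<tau> n) (Complex (- \<sigma>) v)) + Lp_pow p (\<lambda>u. transport_error (\<tau> n) (Complex u 0))
        + Lp_pow p (\<lambda>v. transport_error (\<tau> n) (Complex \<sigma> v))" for n
    proof -
      have "(\<lambda>\<zeta>. ennreal (norm (transport_error (\<tau> n) \<zeta>) powr p)) \<in> borel_measurable borel"
        using meas[of n] by measurable
      then show ?thesis unfolding gamma_measure_def Lp_pow_def by (rule nn_integral_lines_measure)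
    qed
    moreover have side: "AE v in lborel. \<forall>\<^sub>F n in sequentially. v \<notin> {- \<tau> n..0}"
      using AE_lborel_singleton[of 0]
    proof eventually_elim
      case (elim v)
      show ?case
      proof (cases "v > 0")
        case False
        then have "- v > 0" using elim by simp
        from order_tendstoD(2)[OF \<tau>(2) this] show ?thesis by eventually_elim auto
      qed auto
    qed
    have "(\<lambda>n. Lp_pow p (\<lambda>v. transport_error (\<tau> n) (Complex (- \<sigma>) v))) \<longlonglongrightarrow> 0"
    proof (rule tendsto_Lp_pow_of_shrinking_error[OF p0 lines_meas(1)[OF \<tau>(1)] bv_measurable(1) _ bv_Lp_finite(1) conv[OF outer_lines_Lp_convergence(1)] side])
      show "AE v in lborel. norm (transport_error (\<tau> n) (Complex (- \<sigma>) v)) \<le>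
        norm (F (Complex (- (\<sigma> + \<tau> n)) v) - left_bv \<sigma> F v) + norm (indicator {- \<tau> n..0} v *\<^sub>R left_bv \<sigma> F v)" for n
        using AE_lborel_singleton[of 0] by eventually_elim (rule transport_error_left[OF \<tau>(1)])
    qed simp
    moreover have "(\<lambda>n. Lp_pow p (\<lambda>v. transport_error (\<tau> n) (Complex \<sigma> v))) \<longlonglongrightarrow> 0"
    proof (rule tendsto_Lp_pow_of_shrinking_error[OF p0 lines_meas(2)[OF \<tau>(1)] bv_measurable(3) _ bv_Lp_finite(3) conv[OF outer_lines_Lp_convergence(3)] side])
      show "AE v in lborel. norm (transport_error (\<tau> n) (Complex \<sigma> v)) \<le>
        norm (F (Complex (\<sigma> + \<tau> n) v) - right_bv \<sigma> F v) + norm (indicator {- \<tau> n..0} v *\<^sub>R right_bv \<sigma> F v)" for n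
        using AE_lborel_singleton[of 0] by eventually_elim (rule transport_error_right[OF \<tau>(1)])
    qed simp
    moreover have "(\<lambda>n. Lp_pow p (\<lambda>u. transport_error (\<tau> n) (Complex u 0))) \<longlonglongrightarrow> 0"
    proof (rule tendsto_Lp_pow_of_shrinking_error[where S = "\<lambda>n. {- (\<sigma> + \<tau> n)..\<sigma> + \<tau> n} - {-\<sigma>..\<sigma>}",
          OF p0 lines_meas(3)[OF \<tau>(1)] bv_measurable(2) _ bv_Lp_finite(2) conv[OF outer_lines_Lp_convergence(2)]])
      show "AE u in lborel. \<forall>\<^sub>F n in sequentially. u \<notin> {- (\<sigma> + \<tau> n)..\<sigma> + \<tau> n} - {-\<sigma>..\<sigma>}"
      proof (rule AE_I2)
        fix u
        show "\<forall>\<^sub>F n in sequentially. u \<notin> {- (\<sigma> + \<tau> n)..\<sigma> + \<tau> n} - {-\<sigma>..\<sigma>}"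
          using eventually_indicator_bottom[OF \<tau>, of u \<sigma>] by eventually_elim blast
      qed
      show "AE u in lborel. norm (transport_error (\<tau> n) (Complex u 0)) \<le>
        norm (F (Complex u (- \<tau> n)) - bottom_bv F u) + norm (indicator ({- (\<sigma> + \<tau> n)..\<sigma> + \<tau> n} - {-\<sigma>..\<sigma>}) u *\<^sub>R bottom_bv F u)" for n
        using AE_lborel_singleton[of \<sigma>] AE_lborel_singleton[of "- \<sigma>"]
        by eventually_elim (rule transport_error_bottom[OF \<tau>(1)])
    qed simp
    ultimately show ?thesis
      using tendsto_add[OF tendsto_add, of "\<lambda>n. Lp_pow p (\<lambda>v. transport_error (\<tau> n) (Complex (- \<sigma>) v))" 0 sequentially "\<lambda>n. Lp_pow p (\<lambda>u. transport_error (\<tau> n) (Complex u 0))" 0 "\<lambda>n. Lp_pow p (\<lambda>v. transport_error (\<tau> n) (Complex \<sigma> v))" 0]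
      by simp
  qed
  then show "((\<lambda>\<tau>. \<integral>\<^sup>+\<zeta>. ennreal (norm (transport_error \<tau> \<zeta>) powr p) \<partial>gamma_measure \<sigma>) \<longlongrightarrow> 0) (at_right 0)"
    by (intro tendsto_at_right_sequentially[of 0 1]) auto
qed

end

theorem theorem5p8:
  fixes \<sigma> p :: real and F :: "complex \<Rightarrow> complex"
  assumes "\<sigma> > 0" and "1 < p" and "F \<in> Hp_space \<sigma> p"
  shows "\<exists>Fb :: complex \<Rightarrow> complex.
      Fb \<in> Lp_space p (arc_measure \<sigma> 0) \<and>
      (AE \<zeta> in arc_measure \<sigma> 0. has_nt_limit \<sigma> F \<zeta> (Fb \<zeta>)) \<and>
      Lp_norm p (arc_measure \<sigma> 0) Fb \<le> Hp_norm \<sigma> p F \<and>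
      (\<forall>w \<in> Omega_plus \<sigma> \<union> Omega_minus \<sigma>. arc_integrable \<sigma> 0 (\<lambda>\<zeta>. Fb \<zeta> / (\<zeta> - w))) \<and>
      (\<forall>w \<in> Omega_plus \<sigma>.
         1 / (2 * of_real pi * \<i>) * arc_integral \<sigma> 0 (\<lambda>\<zeta>. Fb \<zeta> / (\<zeta> - w)) = 0) \<and>
      (\<forall>w \<in> Omega_minus \<sigma>.
         1 / (2 * of_real pi * \<i>) * arc_integral \<sigma> 0 (\<lambda>\<zeta>. Fb \<zeta> / (\<zeta> - w)) = - F w) \<and>
      ((\<lambda>\<tau>. Lp_norm p (gamma_measure \<sigma>)
          (\<lambda>\<zeta>. transported \<sigma> (\<sigma> + \<tau>) (- \<tau>) F \<zeta> - extend_zero (Gamma_bd \<sigma> 0) Fb \<zeta>))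
        \<longlongrightarrow> 0) (at_right 0)"
proof -
  interpret Hp_exterior \<sigma> p F by unfold_locales (rule assms)+
  have disj: "w \<notin> Omega_plus \<sigma>" if "w \<in> Omega_minus \<sigma>" for w
    using that Omega_minus_iff[OF assms(1)] by (auto simp: Omega_plus_iff)
  show ?thesis
  proof (intro exI[of _ "strip_bv \<sigma> F"] conjI ballI)
    fix w assume w: "w \<in> Omega_minus \<sigma>"
    have "arc_integral \<sigma> 0 (\<lambda>\<zeta>. strip_bv \<sigma> F \<zeta> / (\<zeta> - w)) = - (2 * of_real pi * \<i> * F w)"
      using Cauchy_integral_strip_bv(2)[of w] w disj[OF w] by simp
    then show "1 / (2 * of_real pi * \<i>) * arc_integral \<sigma> 0 (\<lambda>\<zeta>. strip_bv \<sigma> F \<zeta> / (\<zeta> - w)) = - F w"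
      by simp
  next
    fix w assume "w \<in> Omega_plus \<sigma>"
    then show "1 / (2 * of_real pi * \<i>) * arc_integral \<sigma> 0 (\<lambda>\<zeta>. strip_bv \<sigma> F \<zeta> / (\<zeta> - w)) = 0"
      using Cauchy_integral_strip_bv(2)[of w] by simp
  qed (use strip_bv_in_Lp_space nt_limit_AE Lp_norm_strip_bv_le Cauchy_integral_strip_bv(1) transported_Lp_convergence in auto)
qed

end
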